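(* Let $V\colon\mathbb{R}^3\to S^2\subset\mathbb{R}^3$ be a smooth unit vector field defining a line fibration of $\mathbb{R}^3$, and let $\xi$ be the plane field $\xi_p=\langle V(p)\rangle^{\perp}\subset T_p\mathbb{R}^3$. If $\xi$ is a contact structure, then $\xi$ is diffeomorphic to the standard contact structure $\xi_{\mathrm{st}}=\ker(\mathrm{d}z+x\,\mathrm{d}y)$ on $\mathbb{R}^3$, i.e. there is a diffeomorphism $\phi\colon\mathbb{R}^3\to\mathbb{R}^3$ with $T\phi(\xi_{\mathrm{st}})=\xi$. *)

theory Defs
  imports "HOL-Analysis.Analysis"
begin

text \<open>C^k regularity on all of the space (finite-dimensional source): C^0 = continuous,
C^(k+1) = everywhere differentiable with derivative D such that every directional
derivative x |-> D x v is C^k.\<close>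
fun Ck :: "nat \<Rightarrow> ('a::real_normed_vector \<Rightarrow> 'b::real_normed_vector) \<Rightarrow> bool" where
  "Ck 0 f = continuous_on UNIV f"
| "Ck (Suc k) f = (continuous_on UNIV f \<and>
      (\<exists>D. (\<forall>x. (f has_derivative D x) (at x)) \<and> (\<forall>v. Ck k (\<lambda>x. D x v))))"

definition smooth :: "('a::real_normed_vector \<Rightarrow> 'b::real_normed_vector) \<Rightarrow> bool" where
  "smooth f \<longleftrightarrow> (\<forall>k. Ck k f)"

definition diffeomorphism :: "('a::real_normed_vector \<Rightarrow> 'a) \<Rightarrow> bool" where
  "diffeomorphism \<phi> \<longleftrightarrow> (\<exists>\<psi>. smooth \<phi> \<and> smooth \<psi> \<and> (\<forall>x. \<psi> (\<phi> x) = x) \<and> (\<forall>y. \<phi> (\<psi> y) = y))"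

definition fibre_line :: "(real^3 \<Rightarrow> real^3) \<Rightarrow> real^3 \<Rightarrow> (real^3) set" where
  "fibre_line V p = {p + t *\<^sub>R V p | t. True}"

text \<open>V defines a line fibration: the lines p + R V(p) partition R^3
(each p lies on its line; if q lies on the line of p, the lines of p and q coincide).\<close>
definition defines_line_fibration :: "(real^3 \<Rightarrow> real^3) \<Rightarrow> bool" where
  "defines_line_fibration V \<longleftrightarrow> (\<forall>p q. q \<in> fibre_line V p \<longrightarrow> fibre_line V q = fibre_line V p)"

definition pd :: "(real^3 \<Rightarrow> real^3) \<Rightarrow> 3 \<Rightarrow> 3 \<Rightarrow> real^3 \<Rightarrow> real" where
  "pd f i j x = (frechet_derivative f (at x) (axis i 1)) $ j"

text \<open>A 1-form alpha = a1 dx + a2 dy + a3 dz is encoded by its coefficient field a.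
Then alpha /\ d alpha = (a . curl a) dx/\dy/\dz; we record the coefficient.\<close>
definition wedge_d_coeff :: "(real^3 \<Rightarrow> real^3) \<Rightarrow> real^3 \<Rightarrow> real" where
  "wedge_d_coeff a x =
     a x $ 1 * (pd a 2 3 x - pd a 3 2 x)
   + a x $ 2 * (pd a 3 1 x - pd a 1 3 x)
   + a x $ 3 * (pd a 1 2 x - pd a 2 1 x)"

definition contact_form :: "(real^3 \<Rightarrow> real^3) \<Rightarrow> bool" where
  "contact_form a \<longleftrightarrow> (\<forall>x. wedge_d_coeff a x \<noteq> 0)"

definition perp_plane_field :: "(real^3 \<Rightarrow> real^3) \<Rightarrow> real^3 \<Rightarrow> (real^3) set" where
  "perp_plane_field V p = {w. V p \<bullet> w = 0}"

definition alpha_st :: "real^3 \<Rightarrow> real^3" where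
  "alpha_st p = vector [0, p $ 1, 1]"

definition xi_st :: "real^3 \<Rightarrow> (real^3) set" where
  "xi_st p = {w. w $ 3 + p $ 1 * w $ 2 = 0}"

end

theory Submission
  imports Defs
begin

text \<open>Since its integral curves are unit speed lines, \<^term>\<open>V\<close> is the Reeb field of the form dual to it. The space
  of lines is identified with a plane by an isotopy through the surfaces of points closest to the
  origin, so the form becomes \<^term>\<open>dz + \<beta>\<close> with \<^term>\<open>\<beta>\<close> a one-form on the plane whose derivative is an area form.
  A gauge change and a Moser isotopy along circles make \<^term>\<open>\<beta>\<close> rotationally invariant, because circles are
  compact and the area density on each can be equalised by reparametrising it. Passing to a suitably
  rotating frame then turns the form into the standard one, also when the total area is finite.\<close>

section \<open>Calculus of functions of class C^k\<close>

text \<open>A contact structure on R^3 need not be standard, and on an open manifold the field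
  generating a Moser isotopy may escape in finite time. The lines settle the first point by
  providing global coordinates. For the second, both isotopies are generated by fields that preserve
  a distance: one moves points on spheres about the origin, the other moves the horizontal
  coordinates along circles about the axis. The height is then the only coordinate that can grow,
  and its velocity depends on the horizontal ones and time alone. Total area is an invariant of area
  forms on the plane, so \<open>\<beta>\<close> cannot be normalised by diffeomorphisms of the plane
  alone. What removes this invariant is that only the kernel of the form counts, so that the form
  may be multiplied by a nonvanishing function. The contact condition leaves the sign of the area
  form open; a negative one is made positive by reversing the height.\<close>

declare Ck.simps(2) [simp del]

lemma Ck_continuous_on: "Ck k f \<Longrightarrow> continuous_on A f"
  by (cases k) (auto simp: Ck.simps(2) intro: continuous_on_subset)

lemma Ck_SucI:
  assumes "\<And>x. (f has_derivative D x) (at x)" "\<And>v. Ck k (\<lambda>x. D x v)"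
  shows "Ck (Suc k) f"
  using assms unfolding Ck.simps(2)
  by (blast intro: has_derivative_continuous_on has_derivative_at_withinI)

text \<open>The witness \<open>D\<close> hidden in \<open>Ck\<close> is unique, so it can be
  replaced by \<open>frechet_derivative\<close>; later arguments compute with this canonical
  choice.\<close>

lemma Ck_SucD:
  assumes "Ck (Suc k) f"
  shows "(f has_derivative frechet_derivative f (at x)) (at x)"
    and "Ck k (\<lambda>x. frechet_derivative f (at x) v)"
proof -
  obtain D where D: "\<And>x. (f has_derivative D x) (at x)" "\<And>v. Ck k (\<lambda>x. D x v)"
    using assms by (auto simp: Ck.simps(2))
  have "frechet_derivative f (at x) = D x" for x
    using frechet_derivative_at[OF D(1)] by metis
  then show "(f has_derivative frechet_derivative f (at x)) (at x)"
    "Ck k (\<lambda>x. frechet_derivative f (at x) v)" using D by simp_all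
qed

lemma Ck_Suc_imp_Ck: "Ck (Suc k) f \<Longrightarrow> Ck k f"
proof (induction k arbitrary: f)
  case (Suc k)
  then obtain D where D: "\<And>x. (f has_derivative D x) (at x)" "\<And>v. Ck (Suc k) (\<lambda>x. D x v)"
    by (metis Ck.simps(2))
  show ?case by (rule Ck_SucI[OF D(1)]) (rule Suc.IH[OF D(2)])
qed (simp add: Ck_continuous_on)

lemma Ck_const: "Ck k (\<lambda>x. c)"
  by (induction k arbitrary: c) (auto intro!: Ck_SucI[where D="\<lambda>x v. 0"])

lemma Ck_linear: "bounded_linear f \<Longrightarrow> Ck k f"
  by (cases k) (auto intro: linear_continuous_on Ck_SucI[where D="\<lambda>x. f"]
      bounded_linear_imp_has_derivative Ck_const)

lemma Ck_add: "Ck k f \<Longrightarrow> Ck k g \<Longrightarrow> Ck k (\<lambda>x. f x + g x)"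
proof (induction k arbitrary: f g)
  case (Suc k)
  show ?case
    by (rule Ck_SucI[where D="\<lambda>x v. frechet_derivative f (at x) v + frechet_derivative g (at x) v"])
      (intro has_derivative_add Suc.IH Ck_SucD[OF Suc.prems(1)] Ck_SucD[OF Suc.prems(2)])+
qed (auto intro: continuous_intros)

text \<open>The product rule splits the derivative into two products of C^k factors, so one
  induction serves scaling, multiplication and inner product.\<close>

lemma (in bounded_bilinear) Ck_bilinear:
  "Ck k f \<Longrightarrow> Ck k g \<Longrightarrow> Ck k (\<lambda>x. prod (f x) (g x))"
proof (induction k arbitrary: f g)
  case (Suc k)
  note d = Ck_SucD[OF Suc.prems(1)] Ck_SucD[OF Suc.prems(2)]
  have fg: "Ck k f" "Ck k g" using Suc.prems Ck_Suc_imp_Ck by blast+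
  show ?case
    by (rule Ck_SucI[where D="\<lambda>x v. prod (f x) (frechet_derivative g (at x) v)
             + prod (frechet_derivative f (at x) v) (g x)"])
      (intro FDERIV Ck_add Suc.IH d fg)+
qed (auto intro: continuous_on)

lemmas Ck_scaleR = bounded_bilinear.Ck_bilinear[OF bounded_bilinear_scaleR]
lemmas Ck_mult = bounded_bilinear.Ck_bilinear[OF bounded_bilinear_mult]
lemmas Ck_inner = bounded_bilinear.Ck_bilinear[OF bounded_bilinear_inner]

lemma Ck_linear_compose: "bounded_linear L \<Longrightarrow> Ck k f \<Longrightarrow> Ck k (\<lambda>x. L (f x))"
proof (induction k arbitrary: f)
  case 0
  then show ?case by (auto intro: continuous_on_compose2[OF linear_continuous_on])
next
  case (Suc k)
  show ?case
    by (rule Ck_SucI[where D="\<lambda>x v. L (frechet_derivative f (at x) v)"])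
      (intro bounded_linear.has_derivative[OF Suc.prems(1)] Suc.IH[OF Suc.prems(1)] Ck_SucD[OF Suc.prems(2)])+
qed

lemma Ck_minus: "Ck k f \<Longrightarrow> Ck k (\<lambda>x. - f x)"
  by (rule Ck_linear_compose[OF bounded_linear_minus[OF bounded_linear_ident]])

lemma Ck_diff: "Ck k f \<Longrightarrow> Ck k g \<Longrightarrow> Ck k (\<lambda>x. f x - g x)"
  using Ck_add[of k f "\<lambda>x. - g x"] Ck_minus[of k g] by simp

lemma Ck_Pair: "Ck k f \<Longrightarrow> Ck k g \<Longrightarrow> Ck k (\<lambda>x. (f x, g x))"
proof (induction k arbitrary: f g)
  case (Suc k)
  show ?case
    by (rule Ck_SucI[where D="\<lambda>x v. (frechet_derivative f (at x) v, frechet_derivative g (at x) v)"])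
      (intro has_derivative_Pair Suc.IH Ck_SucD[OF Suc.prems(1)] Ck_SucD[OF Suc.prems(2)])+
qed (auto intro: continuous_intros)

lemma Ck_sum: "(\<And>i. i \<in> I \<Longrightarrow> Ck k (f i)) \<Longrightarrow> Ck k (\<lambda>x. \<Sum>i\<in>I. f i x)"
  by (induction I rule: infinite_finite_induct) (auto intro: Ck_const Ck_add)

lemma linear_on_basis:
  fixes w :: "'a::euclidean_space"
  assumes "linear L"
  shows "L w = (\<Sum>b\<in>Basis. (w \<bullet> b) *\<^sub>R L b)"
  using assms by (metis (no_types, lifting) euclidean_representation linear_sum linear_scale sum.cong)

text \<open>\<open>Ck\<close> controls a derivative only in constant directions. Expanding the
  varying direction \<open>h x\<close> in a basis reduces it to finitely many constant ones; this is
  what lets the chain rule be iterated.\<close>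

lemma Ck_linear_family:
  fixes h :: "'a::real_normed_vector \<Rightarrow> 'b::euclidean_space"
    and L :: "'a \<Rightarrow> 'b \<Rightarrow> 'c::real_normed_vector"
  assumes "\<And>x. linear (L x)" "\<And>b. Ck k (\<lambda>x. L x b)" "Ck k h"
  shows "Ck k (\<lambda>x. L x (h x))"
proof -
  have "L x (h x) = (\<Sum>b\<in>Basis. (h x \<bullet> b) *\<^sub>R L x b)" for x
    by (rule linear_on_basis[OF assms(1)])
  then show ?thesis
    by (auto intro!: Ck_sum Ck_scaleR Ck_inner assms Ck_const)
qed

lemma Ck_compose:
  fixes g :: "'a::real_normed_vector \<Rightarrow> 'b::euclidean_space" and f :: "'b \<Rightarrow> 'c::real_normed_vector"
  shows "Ck k f \<Longrightarrow> Ck k g \<Longrightarrow> Ck k (\<lambda>x. f (g x))"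
proof (induction k arbitrary: f g)
  case 0
  then show ?case by (auto intro: continuous_on_compose2)
next
  case (Suc k)
  note df = Ck_SucD[OF Suc.prems(1)] and dg = Ck_SucD[OF Suc.prems(2)]
  show ?case
  proof (rule Ck_SucI)
    show "((\<lambda>x. f (g x)) has_derivative
        (\<lambda>v. frechet_derivative f (at (g x)) (frechet_derivative g (at x) v))) (at x)" for x
      using has_derivative_compose[OF dg(1) df(1)] .
    show "Ck k (\<lambda>x. frechet_derivative f (at (g x)) (frechet_derivative g (at x) v))" for v
      by (rule Ck_linear_family)
        (intro Suc.IH[OF df(2) Ck_Suc_imp_Ck[OF Suc.prems(2)]] has_derivative_linear[OF df(1)] dg(2))+
  qed
qed

lemma Ck_frechet_derivative:
  fixes f :: "'b::euclidean_space \<Rightarrow> 'c::real_normed_vector"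
    and g h :: "'a::real_normed_vector \<Rightarrow> 'b"
  assumes "Ck (Suc k) f" "Ck k g" "Ck k h"
  shows "Ck k (\<lambda>x. frechet_derivative f (at (g x)) (h x))"
  by (rule Ck_linear_family)
    (intro Ck_compose[OF Ck_SucD(2)[OF assms(1)] assms(2)] assms(3)
      has_derivative_linear[OF Ck_SucD(1)[OF assms(1)]])+

section \<open>Quotients, square roots and trigonometric functions\<close>

lemma Ck_inverse:
  fixes f :: "'a::real_normed_vector \<Rightarrow> real"
  assumes "\<And>x. f x \<noteq> 0" "Ck k f"
  shows "Ck k (\<lambda>x. inverse (f x))"
  using assms(2)
proof (induction k)
  case 0
  then show ?case using assms(1) by (auto intro: continuous_intros)
next
  case (Suc k)
  have i: "Ck k (\<lambda>x. inverse (f x))" using Suc Ck_Suc_imp_Ck by blast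
  show ?case
    by (rule Ck_SucI[where D="\<lambda>x v. - (inverse (f x) * frechet_derivative f (at x) v * inverse (f x))"])
      (intro Deriv.has_derivative_inverse Ck_minus Ck_mult Ck_SucD[OF Suc.prems] i assms(1))+
qed

lemma Ck_divide:
  fixes f g :: "'a::real_normed_vector \<Rightarrow> real"
  shows "(\<And>x. g x \<noteq> 0) \<Longrightarrow> Ck k f \<Longrightarrow> Ck k g \<Longrightarrow> Ck k (\<lambda>x. f x / g x)"
  by (simp add: divide_inverse Ck_mult Ck_inverse)

lemma Ck_sqrt:
  fixes f :: "'a::real_normed_vector \<Rightarrow> real"
  assumes "\<And>x. 0 < f x" "Ck k f"
  shows "Ck k (\<lambda>x. sqrt (f x))"
  using assms(2)
proof (induction k)
  case 0
  then show ?case by (auto intro: continuous_intros)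
next
  case (Suc k)
  have sq: "Ck k (\<lambda>x. sqrt (f x))" using Suc Ck_Suc_imp_Ck by blast
  have "((\<lambda>x. sqrt (f x)) has_derivative (\<lambda>v. frechet_derivative f (at x) v * (1 / (2 * sqrt (f x))))) (at x)" for x
    using assms(1)[of x]
    by (auto intro!: derivative_eq_intros Ck_SucD(1)[OF Suc.prems] simp: field_simps)
  then show ?case
    by (rule Ck_SucI)
      (intro Ck_mult Ck_divide Ck_const sq Ck_SucD(2)[OF Suc.prems],
        use assms(1) in \<open>simp add: less_imp_neq[symmetric]\<close>)
qed

lemma Ck_sin_cos: "Ck k (sin :: real \<Rightarrow> real) \<and> Ck k (cos :: real \<Rightarrow> real)"
proof (induction k)
  case 0
  then show ?case by (auto intro: continuous_intros)
next
  case (Suc k)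
  have "Ck (Suc k) (sin :: real \<Rightarrow> real)"
    by (rule Ck_SucI[where D="\<lambda>x v. v * cos x"])
      (use Suc in \<open>auto intro!: Ck_mult Ck_const derivative_eq_intros\<close>)
  moreover have "Ck (Suc k) (cos :: real \<Rightarrow> real)"
    by (rule Ck_SucI[where D="\<lambda>x v. - (v * sin x)"])
      (use Suc in \<open>auto intro!: Ck_mult Ck_minus Ck_const derivative_eq_intros\<close>)
  ultimately show ?case by blast
qed

subsection \<open>Continuous partial derivatives\<close>

text \<open>Change one coordinate at a time: on each coordinate segment the mean value inequality
  applies to the function minus its linear part, whose slope is small by continuity of the partial
  derivative.\<close>

lemma has_derivative_partials_Basis:
  fixes f :: "'a::euclidean_space \<Rightarrow> 'b::real_normed_vector"
  assumes cont: "\<And>b. b \<in> Basis \<Longrightarrow> continuous_on UNIV (g b)"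
    and der: "\<And>b x. b \<in> Basis \<Longrightarrow> ((\<lambda>h. f (x + h *\<^sub>R b)) has_vector_derivative g b x) (at 0)"
  shows "(f has_derivative (\<lambda>w. \<Sum>b\<in>Basis. (w \<bullet> b) *\<^sub>R g b x)) (at x)"
proof -
  have line: "((\<lambda>h. f (y + h *\<^sub>R b)) has_vector_derivative g b (y + s *\<^sub>R b)) (at s)"
    if "b \<in> Basis" for b y s
  proof -
    have "((\<lambda>h. h - s) has_vector_derivative 1) (at s)"
      by (rule has_vector_derivative_eq_rhs) (rule has_vector_derivative_diff has_vector_derivative_id
          has_vector_derivative_const | simp)+
    moreover have "((\<lambda>h. f (y + s *\<^sub>R b + h *\<^sub>R b)) has_vector_derivative g b (y + s *\<^sub>R b)) (at (s - s))"
      using der[OF that, of "y + s *\<^sub>R b"] by simp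
    ultimately have "((\<lambda>h. f (y + s *\<^sub>R b + (h - s) *\<^sub>R b)) has_vector_derivative g b (y + s *\<^sub>R b)) (at s)"
      using vector_diff_chain_at[of "\<lambda>h. h - s" 1 s "\<lambda>h. f (y + s *\<^sub>R b + h *\<^sub>R b)"] by (simp add: o_def)
    then show ?thesis by (simp add: algebra_simps)
  qed
  have step: "\<exists>d>0. \<forall>y w. norm (y - x) < d \<longrightarrow> norm w < d \<longrightarrow>
      norm (f (y + (\<Sum>b\<in>B. (w \<bullet> b) *\<^sub>R b)) - f y - (\<Sum>b\<in>B. (w \<bullet> b) *\<^sub>R g b x)) \<le> e * norm w"
    if "finite B" "B \<subseteq> Basis" "e > 0" for B e
    using that
  proof (induction B arbitrary: e rule: finite_induct)
    case empty
    then show ?case by (auto intro: exI[of _ 1])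
  next
    case (insert c B)
    \<comment> \<open>The offset of \<open>y\<close>, the moves along the coordinates in
      \<open>B\<close> and the last segment together stay below \<open>n * d\<close>, and
      \<open>d\<close> is chosen to keep this within the radius \<open>d2\<close> on which
      \<open>g c\<close> varies by less than \<open>e/2\<close>. The other half of \<open>e\<close>
      goes to the induction hypothesis.\<close>
    define n where "n = real (card B) + 2"
    have n: "n > 1" by (simp add: n_def)
    from insert obtain d1 where d1: "d1 > 0"
      "\<And>y w. norm (y - x) < d1 \<Longrightarrow> norm w < d1 \<Longrightarrow>
        norm (f (y + (\<Sum>b\<in>B. (w \<bullet> b) *\<^sub>R b)) - f y - (\<Sum>b\<in>B. (w \<bullet> b) *\<^sub>R g b x)) \<le> (e/2) * norm w"
      using insert.IH[of "e/2"] insert.prems by auto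
    have c: "c \<in> Basis" using insert by auto
    have "continuous (at x) (g c)" using cont[OF c] by (simp add: continuous_on_eq_continuous_at)
    then obtain d2 where d2: "d2 > 0" "\<And>z. norm (z - x) < d2 \<Longrightarrow> norm (g c z - g c x) < e/2"
      using half_gt_zero[OF insert.prems(2)] unfolding continuous_at_eps_delta dist_norm by blast
    define d where "d = min d1 (d2 / (2 * n))"
    have "d > 0" using d1 d2 n by (simp add: d_def)
    moreover have "norm (f (y + (\<Sum>b\<in>insert c B. (w \<bullet> b) *\<^sub>R b)) - f y
        - (\<Sum>b\<in>insert c B. (w \<bullet> b) *\<^sub>R g b x)) \<le> e * norm w"
      if y: "norm (y - x) < d" and w: "norm w < d" for y w
    proof -
      define z where "z = y + (\<Sum>b\<in>B. (w \<bullet> b) *\<^sub>R b)"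
      have nw: "\<bar>w \<bullet> b\<bar> \<le> norm w" if "b \<in> Basis" for b using that by (simp add: Basis_le_norm)
      have "norm (\<Sum>b\<in>B. (w \<bullet> b) *\<^sub>R b) \<le> (\<Sum>b\<in>B. norm w)"
        using insert.prems nw by (intro norm_sum[THEN order_trans] sum_mono) auto
      then have nB: "norm (\<Sum>b\<in>B. (w \<bullet> b) *\<^sub>R b) \<le> (n - 2) * norm w" by (simp add: n_def)
      have seg: "norm (g c (z + s *\<^sub>R c) - g c x) \<le> e/2" if "\<bar>s\<bar> \<le> norm w" for s
      proof -
        have "norm (z + s *\<^sub>R c - x) \<le> norm (y - x) + (n - 2) * norm w + norm w"
          using nB that c norm_triangle_ineq[of "(y - x) + (\<Sum>b\<in>B. (w \<bullet> b) *\<^sub>R b)" "s *\<^sub>R c"]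
            norm_triangle_ineq[of "y - x" "\<Sum>b\<in>B. (w \<bullet> b) *\<^sub>R b"]
          by (simp add: z_def algebra_simps)
        also have "\<dots> < n * d"
        proof -
          have "(n - 1) * norm w \<le> (n - 1) * d" using w n by (intro mult_left_mono) auto
          then show ?thesis using y by (simp add: algebra_simps)
        qed
        also have "\<dots> \<le> n * (d2 / (2 * n))" using n by (intro mult_left_mono) (auto simp: d_def)
        also have "\<dots> = d2 / 2" using n by simp
        also have "\<dots> < d2" using d2 by simp
        finally show ?thesis using d2(2) by (simp add: less_imp_le)
      qed
      have "norm ((f (z + (w \<bullet> c) *\<^sub>R c) - (w \<bullet> c) *\<^sub>R g c x) - (f (z + 0 *\<^sub>R c) - 0 *\<^sub>R g c x))
          \<le> (e/2) * norm ((w \<bullet> c) - 0)"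
      proof (rule differentiable_bound[where S="closed_segment 0 (w \<bullet> c)"
            and f="\<lambda>s. f (z + s *\<^sub>R c) - s *\<^sub>R g c x"
            and f'="\<lambda>s t. t *\<^sub>R g c (z + s *\<^sub>R c) - t *\<^sub>R g c x"])
        fix s assume "s \<in> closed_segment 0 (w \<bullet> c)"
        then have s: "\<bar>s\<bar> \<le> norm w" using nw[OF c] by (auto simp: closed_segment_eq_real_ivl split: if_splits)
        show "((\<lambda>s. f (z + s *\<^sub>R c) - s *\<^sub>R g c x) has_derivative
            (\<lambda>t. t *\<^sub>R g c (z + s *\<^sub>R c) - t *\<^sub>R g c x)) (at s within closed_segment 0 (w \<bullet> c))"
          by (rule has_derivative_diff[OF has_derivative_at_withinI[OF line[OF c, of z s,
                  unfolded has_vector_derivative_def]] has_derivative_scaleR_left[OF has_derivative_ident]])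
        have "norm (t *\<^sub>R g c (z + s *\<^sub>R c) - t *\<^sub>R g c x) \<le> (e/2) * norm t" for t
          using mult_left_mono[OF seg[OF s], of "\<bar>t\<bar>"]
          by (simp add: mult.commute scaleR_diff_right[symmetric] del: scaleR_diff_right)
        then show "onorm (\<lambda>t. t *\<^sub>R g c (z + s *\<^sub>R c) - t *\<^sub>R g c x) \<le> e/2"
          using insert.prems by (intro onorm_bound) auto
      qed auto
      also have "\<dots> \<le> (e/2) * norm w" using nw[OF c] insert.prems by (intro mult_left_mono) auto
      finally have 2: "norm (f (z + (w \<bullet> c) *\<^sub>R c) - f z - (w \<bullet> c) *\<^sub>R g c x) \<le> (e/2) * norm w"
        by (simp add: algebra_simps)
      have 1: "norm (f z - f y - (\<Sum>b\<in>B. (w \<bullet> b) *\<^sub>R g b x)) \<le> (e/2) * norm w"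
        unfolding z_def using y w by (intro d1) (auto simp: d_def)
      have "f (y + (\<Sum>b\<in>insert c B. (w \<bullet> b) *\<^sub>R b)) - f y - (\<Sum>b\<in>insert c B. (w \<bullet> b) *\<^sub>R g b x)
         = (f (z + (w \<bullet> c) *\<^sub>R c) - f z - (w \<bullet> c) *\<^sub>R g c x)
          + (f z - f y - (\<Sum>b\<in>B. (w \<bullet> b) *\<^sub>R g b x))"
        using insert.hyps by (simp add: z_def algebra_simps)
      moreover have "(e/2) * norm w + (e/2) * norm w = e * norm w" by simp
      ultimately show ?thesis using norm_triangle_mono[OF 2 1] by (simp only:)
    qed
    ultimately show ?case by blast
  qed
  show ?thesis
    unfolding has_derivative_at_alt
  proof (intro conjI allI impI)
    show "bounded_linear (\<lambda>w. \<Sum>b\<in>Basis. (w \<bullet> b) *\<^sub>R g b x)"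
      by (intro bounded_linear_sum bounded_linear_scaleR_const bounded_linear_inner_left)
  next
    fix e :: real assume "e > 0"
    then obtain d where "d > 0" "\<And>w. norm w < d \<Longrightarrow>
      norm (f (x + (\<Sum>b\<in>Basis. (w \<bullet> b) *\<^sub>R b)) - f x - (\<Sum>b\<in>Basis. (w \<bullet> b) *\<^sub>R g b x)) \<le> e * norm w"
      using step[OF finite_Basis subset_refl \<open>e > 0\<close>] by force
    then have "norm (f (x + (y - x)) - f x - (\<Sum>b\<in>Basis. ((y - x) \<bullet> b) *\<^sub>R g b x)) \<le> e * norm (y - x)"
      if "norm (y - x) < d" for y
      using that unfolding euclidean_representation by blast
    with \<open>d > 0\<close> show "\<exists>d>0. \<forall>y. norm (y - x) < d \<longrightarrow>
        norm (f y - f x - (\<Sum>b\<in>Basis. ((y - x) \<bullet> b) *\<^sub>R g b x)) \<le> e * norm (y - x)"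
      by (intro exI[of _ d]) simp
  qed
qed

text \<open>For integrals and flows only the derivatives along basis directions are computed
  directly; this criterion turns them into \<open>Ck\<close>.\<close>

lemma Ck_Suc_partialsI:
  fixes f :: "'a::euclidean_space \<Rightarrow> 'b::real_normed_vector"
  assumes "\<And>b. b \<in> Basis \<Longrightarrow> Ck k (g b)"
    and "\<And>b x. b \<in> Basis \<Longrightarrow> ((\<lambda>h. f (x + h *\<^sub>R b)) has_vector_derivative g b x) (at 0)"
  shows "Ck (Suc k) f"
  by (rule Ck_SucI[OF has_derivative_partials_Basis[of g]])
    (use assms in \<open>auto intro!: Ck_sum Ck_scaleR[OF Ck_const] intro: Ck_continuous_on\<close>)

subsection \<open>Smooth functions\<close>

lemma smooth_const: "smooth (\<lambda>x. c)"
  and smooth_linear: "bounded_linear L \<Longrightarrow> smooth L"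
  and smooth_add: "smooth f \<Longrightarrow> smooth g \<Longrightarrow> smooth (\<lambda>x. f x + g x)"
  and smooth_diff: "smooth f \<Longrightarrow> smooth g \<Longrightarrow> smooth (\<lambda>x. f x - g x)"
  and smooth_minus: "smooth f \<Longrightarrow> smooth (\<lambda>x. - f x)"
  and smooth_Pair: "smooth f \<Longrightarrow> smooth h \<Longrightarrow> smooth (\<lambda>x. (f x, h x))"
  and smooth_linear_compose: "bounded_linear L' \<Longrightarrow> smooth f \<Longrightarrow> smooth (\<lambda>x. L' (f x))"
  by (simp_all add: smooth_def Ck_const Ck_linear Ck_add Ck_diff Ck_minus Ck_Pair Ck_linear_compose)

lemma smooth_scaleR: "smooth f \<Longrightarrow> smooth g \<Longrightarrow> smooth (\<lambda>x. f x *\<^sub>R g x)"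
  by (simp add: smooth_def Ck_scaleR)

lemma smooth_mult:
  fixes f g :: "'a::real_normed_vector \<Rightarrow> 'b::real_normed_algebra"
  shows "smooth f \<Longrightarrow> smooth g \<Longrightarrow> smooth (\<lambda>x. f x * g x)"
  by (simp add: smooth_def Ck_mult)

lemma smooth_power2:
  fixes f :: "'a::real_normed_vector \<Rightarrow> real"
  shows "smooth f \<Longrightarrow> smooth (\<lambda>x. (f x)\<^sup>2)"
  by (simp add: power2_eq_square smooth_mult)

lemma smooth_inner: "smooth f \<Longrightarrow> smooth g \<Longrightarrow> smooth (\<lambda>x. f x \<bullet> g x)"
  by (simp add: smooth_def Ck_inner)

lemma smooth_divide:
  fixes f g :: "'a::real_normed_vector \<Rightarrow> real"
  shows "(\<And>x. g x \<noteq> 0) \<Longrightarrow> smooth f \<Longrightarrow> smooth g \<Longrightarrow> smooth (\<lambda>x. f x / g x)"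
  by (simp add: smooth_def Ck_divide)

lemma smooth_sqrt:
  fixes f :: "'a::real_normed_vector \<Rightarrow> real"
  shows "(\<And>x. 0 < f x) \<Longrightarrow> smooth f \<Longrightarrow> smooth (\<lambda>x. sqrt (f x))"
  by (simp add: smooth_def Ck_sqrt)

lemma smooth_compose:
  fixes g :: "'a::real_normed_vector \<Rightarrow> 'b::euclidean_space"
  shows "smooth f \<Longrightarrow> smooth g \<Longrightarrow> smooth (\<lambda>x. f (g x))"
  by (simp add: smooth_def Ck_compose)

lemma smooth_sin: "smooth f \<Longrightarrow> smooth (\<lambda>x. sin (f x :: real))"
  and smooth_cos: "smooth f \<Longrightarrow> smooth (\<lambda>x. cos (f x :: real))"
  using Ck_sin_cos by (auto simp: smooth_def intro: Ck_compose[where f=sin] Ck_compose[where f=cos])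

lemma smooth_frechet_derivative:
  fixes f :: "'b::euclidean_space \<Rightarrow> 'c::real_normed_vector"
  shows "smooth f \<Longrightarrow> smooth g \<Longrightarrow> smooth h
    \<Longrightarrow> smooth (\<lambda>x. frechet_derivative f (at (g x)) (h x))"
  unfolding smooth_def using Ck_frechet_derivative by blast

lemma smooth_ident: "smooth (\<lambda>x. x)"
  by (rule smooth_linear[OF bounded_linear_ident])

lemma smooth_vec_nth: "smooth f \<Longrightarrow> smooth (\<lambda>x. f x $ i)"
  by (rule smooth_linear_compose[OF bounded_linear_vec_nth])

lemma smooth_fst: "smooth f \<Longrightarrow> smooth (\<lambda>x. fst (f x))"
  by (rule smooth_linear_compose[OF bounded_linear_fst])

lemma smooth_snd: "smooth f \<Longrightarrow> smooth (\<lambda>x. snd (f x))"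
  by (rule smooth_linear_compose[OF bounded_linear_snd])

lemma vector_3_axis:
  fixes a b c :: real
  shows "vector [a, b, c] = a *\<^sub>R axis 1 1 + b *\<^sub>R axis 2 1 + c *\<^sub>R (axis 3 1 :: real^3)"
  by (simp add: vec_eq_iff forall_3 axis_def)

lemma smooth_vector_3:
  "smooth f \<Longrightarrow> smooth g \<Longrightarrow> smooth h \<Longrightarrow> smooth (\<lambda>x. vector [f x, g x, h x] :: real^3)"
  unfolding vector_3_axis by (intro smooth_add smooth_scaleR smooth_const)

lemmas smooth_intros = smooth_const smooth_ident smooth_add smooth_diff smooth_minus smooth_Pair
  smooth_scaleR smooth_mult smooth_power2 smooth_inner smooth_sin smooth_cos
  smooth_vec_nth smooth_fst smooth_snd smooth_vector_3 smooth_frechet_derivative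

lemma smooth_continuous_on: "smooth f \<Longrightarrow> continuous_on A f"
  using Ck_continuous_on by (auto simp: smooth_def)

lemma smooth_has_derivative:
  "smooth f \<Longrightarrow> (f has_derivative frechet_derivative f (at x)) (at x)"
  unfolding smooth_def using Ck_SucD(1) by blast

lemma smooth_frechet_linear: "smooth f \<Longrightarrow> linear (frechet_derivative f (at x))"
  using smooth_has_derivative has_derivative_linear by blast

subsection \<open>Integrals with parameters\<close>

lemma continuous_on_param_integral:
  fixes f :: "real \<times> 'a::real_normed_vector \<Rightarrow> 'b::banach"
  assumes "continuous_on UNIV f"
  shows "continuous_on UNIV (\<lambda>x. integral {a..b} (\<lambda>s. f (s, x)))"
proof -
  have "continuous_on (UNIV \<times> cbox a b) (\<lambda>(x, s). f (s, x))"
    by (auto simp: split_beta intro!: continuous_on_compose2[OF assms] continuous_intros)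
  from integral_continuous_on_param[OF this] show ?thesis by (simp add: cbox_interval)
qed

text \<open>Used when the quotient \<open>q\<close> is given by an integral or a differential
  equation that makes sense at step zero; only its continuity at zero is then left to check.\<close>

lemma has_vector_derivative_quotient:
  assumes "\<And>h. f h - f 0 = h *\<^sub>R q h" "(q \<longlongrightarrow> q 0) (at 0)"
  shows "(f has_vector_derivative q 0) (at 0)"
proof -
  have "((\<lambda>h. norm (q h - q 0)) \<longlongrightarrow> 0) (at 0)"
    using assms(2) LIM_zero tendsto_norm_zero by blast
  moreover have "\<forall>\<^sub>F h in at 0. norm (q h - q 0) = norm (f (0 + h) - f 0 - h *\<^sub>R q 0) / norm h"
    unfolding eventually_at
    by (intro exI[of _ 1]) (auto simp: assms(1) scaleR_diff_right[symmetric] simp del: scaleR_diff_right)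
  ultimately show ?thesis
    unfolding has_vector_derivative_def has_derivative_at
    by (auto intro: bounded_linear_scaleR_left Lim_transform_eventually)
qed

lemma has_vector_derivative_along:
  assumes "(f has_derivative f') (at (x + s *\<^sub>R v))"
  shows "((\<lambda>s. f (x + s *\<^sub>R v)) has_vector_derivative f' v) (at s)"
proof -
  have "((\<lambda>s. x + s *\<^sub>R v) has_derivative (\<lambda>t. t *\<^sub>R v)) (at s)"
    by (auto intro!: derivative_eq_intros)
  from has_derivative_compose[OF this assms] show ?thesis
    using linear_scale[OF has_derivative_linear[OF assms]] by (simp add: has_vector_derivative_def)
qed

text \<open>The fundamental theorem of calculus on the segment from \<open>x\<close> to
  \<open>x + v\<close>. It turns a difference quotient into an average of derivatives, with no
  division by the step.\<close>

lemma hadamard_integral: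
  fixes f :: "'a::real_normed_vector \<Rightarrow> 'b::banach"
  assumes "\<And>x. (f has_derivative f' x) (at x)"
  shows "f (x + v) - f x = integral {0..1} (\<lambda>s. f' (x + s *\<^sub>R v) v)"
proof -
  have "((\<lambda>s. f' (x + s *\<^sub>R v) v) has_integral (f (x + 1 *\<^sub>R v) - f (x + 0 *\<^sub>R v))) {0..1}"
    by (rule fundamental_theorem_of_calculus)
      (auto intro: has_vector_derivative_at_within has_vector_derivative_along assms)
  then show ?thesis by (simp add: integral_unique)
qed

lemma param_integral_has_vector_derivative:
  fixes f :: "real \<times> real \<Rightarrow> 'b::banach"
  assumes "\<And>s h. ((\<lambda>h. f (s, h)) has_vector_derivative g (s, h)) (at h)"
    and "continuous_on UNIV f" "continuous_on UNIV g"
  shows "((\<lambda>h. integral {a..b} (\<lambda>s. f (s, h))) has_vector_derivative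
    integral {a..b} (\<lambda>s. g (s, h))) (at h)"
proof -
  have "((\<lambda>h. integral (cbox a b) (\<lambda>s. f (s, h))) has_vector_derivative
    integral (cbox a b) (\<lambda>s. g (s, h))) (at h within UNIV)"
  proof (rule leibniz_rule_vector_derivative)
    show "(\<lambda>s. f (s, x)) integrable_on cbox a b" for x
      by (intro integrable_continuous continuous_on_compose2[OF assms(2)] continuous_intros) auto
    show "continuous_on (UNIV \<times> cbox a b) (\<lambda>(x, t). g (t, x))"
      by (auto simp: split_beta intro!: continuous_on_compose2[OF assms(3)] continuous_intros)
  qed (use assms(1) in auto)
  then show ?thesis by (simp add: cbox_interval)
qed

text \<open>Each partial derivative in \<open>x\<close> is again a parameter integral, with an
  integrand of one class lower, so the induction on \<open>k\<close> runs over all integrands at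
  once.\<close>

lemma Ck_param_integral:
  fixes f :: "real \<times> 'a::euclidean_space \<Rightarrow> 'b::banach"
  shows "Ck k f \<Longrightarrow> Ck k (\<lambda>x. integral {a..b} (\<lambda>s. f (s, x)))"
proof (induction k arbitrary: f)
  case 0
  then show ?case by (simp add: continuous_on_param_integral)
next
  case (Suc k)
  note df = Ck_SucD[OF Suc.prems]
  define g where "g b z = frechet_derivative f (at z) (0, b)" for b z
  show ?case
  proof (rule Ck_Suc_partialsI[of _ "\<lambda>c x. integral {a..b} (\<lambda>s. g c (s, x))"])
    fix c :: 'a and x
    show "Ck k (\<lambda>x. integral {a..b} (\<lambda>s. g c (s, x)))"
      by (rule Suc.IH) (simp add: g_def df(2))
    show "((\<lambda>h. integral {a..b} (\<lambda>s. f (s, x + h *\<^sub>R c))) has_vector_derivative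
       integral {a..b} (\<lambda>s. g c (s, x))) (at 0)"
    proof -
      have "((\<lambda>h. integral {a..b} (\<lambda>s. (\<lambda>(s, h). f (s, x + h *\<^sub>R c)) (s, h))) has_vector_derivative
         integral {a..b} (\<lambda>s. (\<lambda>(s, h). g c (s, x + h *\<^sub>R c)) (s, 0))) (at 0)"
      proof (rule param_integral_has_vector_derivative)
        show "((\<lambda>h. case (s, h) of (s, h) \<Rightarrow> f (s, x + h *\<^sub>R c)) has_vector_derivative
            (case (s, h) of (s, h) \<Rightarrow> g c (s, x + h *\<^sub>R c))) (at h)" for s h
          using has_vector_derivative_along[OF df(1), where x="(s, x)" and s=h and v="(0, c)"] by (simp add: g_def)
        show "continuous_on UNIV (\<lambda>(s, h). f (s, x + h *\<^sub>R c))"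
          by (auto simp: split_beta intro!: continuous_intros
              continuous_on_compose2[OF Ck_continuous_on[OF Suc.prems]])
        show "continuous_on UNIV (\<lambda>(s, h). g c (s, x + h *\<^sub>R c))"
          unfolding g_def
          by (auto simp: split_beta intro!: continuous_intros
              continuous_on_compose2[OF Ck_continuous_on[OF df(2)]])
      qed
      then show ?thesis by simp
    qed
  qed
qed

lemma smooth_param_integral:
  fixes f :: "real \<times> 'a::euclidean_space \<Rightarrow> 'b::banach"
  shows "smooth f \<Longrightarrow> smooth (\<lambda>x. integral {a..b} (\<lambda>s. f (s, x)))"
  by (simp add: smooth_def Ck_param_integral)

lemma frechet_param_integral:
  fixes f :: "real \<times> 'a::euclidean_space \<Rightarrow> 'b::banach"
  assumes "smooth f"
  shows "frechet_derivative (\<lambda>x. integral {a..b} (\<lambda>s. f (s, x))) (at x) v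
     = integral {a..b} (\<lambda>s. frechet_derivative f (at (s, x)) (0, v))"
proof -
  have c: "continuous_on UNIV (\<lambda>z. frechet_derivative f (at z) (0, v))"
    by (intro smooth_continuous_on smooth_intros assms)
  have 1: "((\<lambda>h. integral {a..b} (\<lambda>s. f (s, x + h *\<^sub>R v))) has_vector_derivative
    frechet_derivative (\<lambda>x. integral {a..b} (\<lambda>s. f (s, x))) (at x) v) (at 0)"
    using has_vector_derivative_along[where s=0 and x=x, of "\<lambda>x. integral {a..b} (\<lambda>s. f (s, x))"]
      smooth_has_derivative[OF smooth_param_integral[OF assms]] by simp
  have "((\<lambda>h. integral {a..b} (\<lambda>s. (\<lambda>(s, h). f (s, x + h *\<^sub>R v)) (s, h))) has_vector_derivative
     integral {a..b} (\<lambda>s. (\<lambda>(s, h). frechet_derivative f (at (s, x + h *\<^sub>R v)) (0, v)) (s, 0))) (at 0)"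
  proof (rule param_integral_has_vector_derivative)
    show "((\<lambda>h. case (s, h) of (s, h) \<Rightarrow> f (s, x + h *\<^sub>R v)) has_vector_derivative
        (case (s, h) of (s, h) \<Rightarrow> frechet_derivative f (at (s, x + h *\<^sub>R v)) (0, v))) (at h)" for s h
      using has_vector_derivative_along[OF smooth_has_derivative[OF assms], where x="(s, x)" and s=h and v="(0, v)"] by simp
  qed (auto simp: split_beta intro!: continuous_intros continuous_on_compose2[OF c]
        continuous_on_compose2[OF smooth_continuous_on[OF assms]])
  then have 2: "((\<lambda>h. integral {a..b} (\<lambda>s. f (s, x + h *\<^sub>R v))) has_vector_derivative
     integral {a..b} (\<lambda>s. frechet_derivative f (at (s, x)) (0, v))) (at 0)" by simp
  show ?thesis using vector_derivative_unique_at[OF 1 2] .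
qed

text \<open>The increment of the derivative in direction \<open>w\<close> along
  \<open>h *\<^sub>R v\<close> is \<open>h\<close> times an average of mixed derivatives over the
  segment, by the segment formula and differentiation under the integral. Letting \<open>h\<close>
  tend to zero identifies the two orders.\<close>

lemma frechet_derivative_commute:
  fixes f :: "'a::euclidean_space \<Rightarrow> 'b::banach"
  assumes "smooth f"
  shows "frechet_derivative (\<lambda>y. frechet_derivative f (at y) v) (at x) w
       = frechet_derivative (\<lambda>y. frechet_derivative f (at y) w) (at x) v"
proof -
  define A where "A h s = frechet_derivative (\<lambda>y. frechet_derivative f (at y) v) (at (x + (s * h) *\<^sub>R v)) w" for h s
  have sv: "smooth (\<lambda>y. frechet_derivative f (at y) v)" for v
    by (intro smooth_intros assms)
  have quot: "frechet_derivative f (at (x + h *\<^sub>R v)) w - frechet_derivative f (at x) w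
      = h *\<^sub>R integral {0..1} (A h)" for h
  proof -
    have "(\<lambda>x. f (x + h *\<^sub>R v) - f x) = (\<lambda>x. integral {0..1} (\<lambda>s. (\<lambda>(s, x). frechet_derivative f (at (x + (s * h) *\<^sub>R v)) (h *\<^sub>R v)) (s, x)))"
      using hadamard_integral[OF smooth_has_derivative[OF assms], of _ "h *\<^sub>R v"]
      by (simp add: fun_eq_iff)
    moreover have "frechet_derivative (\<lambda>x. f (x + h *\<^sub>R v) - f x) (at x) w
      = frechet_derivative f (at (x + h *\<^sub>R v)) w - frechet_derivative f (at x) w"
    proof -
      have "((\<lambda>x. f (x + h *\<^sub>R v)) has_derivative frechet_derivative f (at (x + h *\<^sub>R v))) (at x)"
        by (rule has_derivative_eq_rhs[OF has_derivative_compose[OF _ smooth_has_derivative[OF assms]]])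
          (auto intro!: derivative_eq_intros)
      from frechet_derivative_at[OF has_derivative_diff[OF this smooth_has_derivative[OF assms]]]
      show ?thesis by metis
    qed
    moreover have "smooth (\<lambda>(s, x). frechet_derivative f (at (x + (s * h) *\<^sub>R v)) (h *\<^sub>R v))"
      unfolding split_beta by (intro smooth_intros assms)
    from frechet_param_integral[OF this]
    have "frechet_derivative (\<lambda>x. integral {0..1} (\<lambda>s. (\<lambda>(s, x). frechet_derivative f (at (x + (s * h) *\<^sub>R v)) (h *\<^sub>R v)) (s, x))) (at x) w
       = integral {0..1} (\<lambda>s. h *\<^sub>R A h s)"
    proof (rule trans, intro integral_cong)
      fix s :: real
      have "((\<lambda>z. frechet_derivative f (at (snd z + (fst z * h) *\<^sub>R v)) (h *\<^sub>R v)) has_derivative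
         (\<lambda>u. h *\<^sub>R frechet_derivative (\<lambda>y. frechet_derivative f (at y) v) (at (snd (s, x) + (fst (s, x) * h) *\<^sub>R v)) (snd u + (fst u * h) *\<^sub>R v))) (at (s, x))"
        unfolding linear_scale[OF smooth_frechet_linear[OF assms]]
        by (intro has_derivative_scaleR_right has_derivative_compose[OF _ smooth_has_derivative[OF sv],
             of "\<lambda>z. snd z + (fst z * h) *\<^sub>R v"])
          (auto intro!: derivative_eq_intros)
      from fun_cong[OF frechet_derivative_at[OF this], of "(0, w)"]
      show "frechet_derivative (\<lambda>(s, x). frechet_derivative f (at (x + (s * h) *\<^sub>R v)) (h *\<^sub>R v)) (at (s, x)) (0, w)
         = h *\<^sub>R A h s"
        unfolding split_beta A_def by simp
    qed
    ultimately show ?thesis by simp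
  qed
  have "((\<lambda>h. frechet_derivative f (at (x + h *\<^sub>R v)) w) has_vector_derivative
       frechet_derivative (\<lambda>y. frechet_derivative f (at y) w) (at x) v) (at 0)"
    using has_vector_derivative_along[of "\<lambda>y. frechet_derivative f (at y) w" _ x 0 v]
      smooth_has_derivative[OF sv] by simp
  moreover have "((\<lambda>h. frechet_derivative f (at (x + h *\<^sub>R v)) w) has_vector_derivative
       frechet_derivative (\<lambda>y. frechet_derivative f (at y) v) (at x) w) (at 0)"
  proof -
    have c: "continuous_on UNIV (\<lambda>y. frechet_derivative (\<lambda>y. frechet_derivative f (at y) v) (at y) w)"
      by (intro smooth_continuous_on smooth_intros sv)
    have "continuous_on UNIV (\<lambda>(s, h). A h s)"
      unfolding A_def split_beta
      by (intro continuous_on_compose2[OF c] continuous_intros) auto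
    from continuous_on_param_integral[OF this, of 0 1]
    have "((\<lambda>h. integral {0..1} (A h)) \<longlongrightarrow> integral {0..1} (A 0)) (at 0)"
      by (simp add: continuous_on_eq_continuous_at continuous_at)
    moreover have "integral {0..1} (A 0) = frechet_derivative (\<lambda>y. frechet_derivative f (at y) v) (at x) w"
    proof -
      have "A 0 = (\<lambda>s. frechet_derivative (\<lambda>y. frechet_derivative f (at y) v) (at x) w)"
        by (simp add: A_def fun_eq_iff)
      then show ?thesis by simp
    qed
    ultimately show ?thesis
      using has_vector_derivative_quotient[of "\<lambda>h. frechet_derivative f (at (x + h *\<^sub>R v)) w"
          "\<lambda>h. integral {0..1} (A h)"] by (simp add: quot)
  qed
  ultimately show ?thesis by (rule vector_derivative_unique_at[symmetric])
qed

section \<open>Ordinary differential equations\<close>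

subsection \<open>Global existence\<close>

lemma antiderivative_exists:
  fixes f :: "real \<Rightarrow> 'a::banach"
  assumes "continuous_on UNIV f"
  shows "\<exists>G. G 0 = 0 \<and> (\<forall>t. (G has_vector_derivative f t) (at t))"
proof -
  define G where "G t = (if 0 \<le> t then integral {0..t} f else - integral {t..0} f)" for t
  have "(G has_vector_derivative f t) (at t)" for t
  proof -
    \<comment> \<open>On an interval with \<open>t\<close> in its interior, \<open>G\<close> differs
      by a constant from the integral starting at \<open>-n\<close>; one formula thus covers both
      signs of \<open>t\<close>.\<close>
    define n where "n = \<bar>t\<bar> + 1"
    have int: "f integrable_on {a..b}" for a b
      by (intro integrable_continuous_interval continuous_on_subset[OF assms]) auto
    have "((\<lambda>u. integral {-n..u} f - integral {-n..0} f) has_vector_derivative f t) (at t within {-n..n})"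
      by (rule has_vector_derivative_eq_rhs, rule has_vector_derivative_diff,
          rule integral_has_vector_derivative)
        (auto simp: n_def intro!: continuous_on_subset[OF assms] has_vector_derivative_const)
    then have "((\<lambda>u. integral {-n..u} f - integral {-n..0} f) has_vector_derivative f t) (at t within {-n<..<n})"
      by (rule has_vector_derivative_within_subset) auto
    then have "(G has_vector_derivative f t) (at t within {-n<..<n})"
    proof (rule has_vector_derivative_transform[rotated 2])
      show "t \<in> {-n<..<n}" by (auto simp: n_def)
      fix u assume u: "u \<in> {-n<..<n}"
      show "G u = integral {-n..u} f - integral {-n..0} f"
      proof (cases "0 \<le> u")
        case True
        then have "integral {-n..0} f + integral {0..u} f = integral {-n..u} f"
          by (intro Henstock_Kurzweil_Integration.integral_combine int) (auto simp: n_def)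
        then show ?thesis using True by (simp add: G_def algebra_simps)
      next
        case False
        then have "integral {-n..u} f + integral {u..0} f = integral {-n..0} f"
          using u by (intro Henstock_Kurzweil_Integration.integral_combine int) auto
        then show ?thesis using False by (simp add: G_def algebra_simps)
      qed
    qed
    moreover have "t \<in> {-n<..<n}" by (auto simp: n_def)
    ultimately show ?thesis
      by (metis at_within_open open_greaterThanLessThan)
  qed
  moreover have "G 0 = 0" by (simp add: G_def)
  ultimately show ?thesis by blast
qed

text \<open>Mean value inequality against a scalar majorant; the absolute value is there because
  \<open>H\<close> is nonpositive at negative times.\<close>

lemma norm_antiderivative_le:
  fixes G :: "real \<Rightarrow> 'a::real_normed_vector" and H :: "real \<Rightarrow> real"
  assumes G: "\<And>t. (G has_vector_derivative g t) (at t)" "G 0 = 0"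
    and H: "\<And>t. (H has_vector_derivative h t) (at t)" "H 0 = 0"
    and le: "\<And>t. norm (g t) \<le> h t"
  shows "norm (G t) \<le> \<bar>H t\<bar>"
proof -
  have c: "continuous_on A G" "continuous_on A H" for A
    using G(1) H(1) by (meson continuous_on_vector_derivative has_vector_derivative_at_within)+
  consider "t = 0" | "0 < t" | "t < 0" by linarith
  then show ?thesis
  proof cases
    case 2
    from differentiable_bound_general[OF this c G(1) H(1) le] show ?thesis
      using G H by simp
  next
    case 3
    from differentiable_bound_general[OF this c G(1) H(1) le] show ?thesis
      using G H by simp
  qed (simp add: G H)
qed

text \<open>Picard iteration contracts the norm weighted by \<^term>\<open>inverse \<omega>\<close> with \<^term>\<open>\<omega> = 2 * cosh K\<close>,
  where \<^term>\<open>K\<close> is an antiderivative of twice the Lipschitz constant; this gives the solution on the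
  whole line in one step.\<close>

lemma ode_global_solution:
  fixes F :: "real \<Rightarrow> 'a::euclidean_space \<Rightarrow> 'a"
  assumes cont: "continuous_on UNIV (\<lambda>(t, y). F t y)"
    and L: "continuous_on UNIV L"
    and lip: "\<And>t y z. norm (F t y - F t z) \<le> L t * norm (y - z)"
  shows "\<exists>y. y 0 = y0 \<and> (\<forall>t. (y has_vector_derivative F t (y t)) (at t))"
proof -
  \<comment> \<open>The factor 2 becomes the contraction constant \<open>1/2\<close>; the summand
    \<open>norm (F t y0)\<close> lets the iteration map bounded functions to bounded
    functions.\<close>
  define \<kappa> where "\<kappa> t = 2 * (\<bar>L t\<bar> + norm (F t y0))" for t
  have contF: "continuous_on UNIV (\<lambda>t. F t (w t))" if "continuous_on UNIV w" for w
    using continuous_on_compose2[OF cont continuous_on_Pair[OF continuous_on_id that]] by simp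
  have "continuous_on UNIV \<kappa>"
    unfolding \<kappa>_def by (intro continuous_intros L contF)
  then obtain K where K: "K 0 = 0" "\<And>t. (K has_vector_derivative \<kappa> t) (at t)"
    using antiderivative_exists by metis
  define \<omega> where "\<omega> t = exp (K t) + exp (- K t)" for t
  define \<Omega> where "\<Omega> t = exp (K t) - exp (- K t)" for t
  have K': "(K has_real_derivative \<kappa> t) (at t)" for t
    using K(2) by (simp add: has_real_derivative_iff_has_vector_derivative)
  have \<Omega>': "(\<Omega> has_vector_derivative \<kappa> t * \<omega> t) (at t)" for t
    unfolding \<Omega>_def \<omega>_def has_real_derivative_iff_has_vector_derivative[symmetric]
    by (auto intro!: derivative_eq_intros K' simp: algebra_simps)
  have \<omega>: "\<omega> t \<ge> 1" "\<bar>\<Omega> t\<bar> \<le> \<omega> t" "\<omega> t > 0" for t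
  proof -
    have "exp (K t) \<ge> 1 \<or> exp (- K t) \<ge> 1" by (cases "K t \<ge> 0") auto
    then show "\<omega> t \<ge> 1" unfolding \<omega>_def using exp_gt_zero[of "K t"] exp_gt_zero[of "- K t"] by linarith
    then show "\<omega> t > 0" by linarith
    show "\<bar>\<Omega> t\<bar> \<le> \<omega> t" unfolding \<omega>_def \<Omega>_def
      using exp_gt_zero[of "K t"] exp_gt_zero[of "- K t"] by linarith
  qed
  have \<Omega>0: "\<Omega> 0 = 0" by (simp add: \<Omega>_def K)
  have c\<omega>: "continuous_on UNIV \<omega>"
    unfolding \<omega>_def
    by (intro continuous_intros continuous_on_vector_derivative[OF has_vector_derivative_at_within[OF K(2)]])
  \<comment> \<open>The solution is sought as \<open>y0 + \<omega> t *\<^sub>R u t\<close> with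
    \<open>u\<close> bounded, so that the supremum norm of \<open>u\<close> is the weighted
    norm.\<close>
  define f where "f u s = F s (y0 + \<omega> s *\<^sub>R apply_bcontfun u s)" for u s
  have cf: "continuous_on UNIV (f u)" for u
    unfolding f_def by (intro contF continuous_intros c\<omega>) auto
  define G where "G u = (SOME G. G 0 = 0 \<and> (\<forall>t. (G has_vector_derivative f u t) (at t)))" for u
  have G: "G u 0 = 0" "(G u has_vector_derivative f u t) (at t)" for u t
    unfolding G_def using someI_ex[OF antiderivative_exists[OF cf, of u]] by blast+
  have bound: "norm (G u t) \<le> ((1 + norm u) / 2) * \<omega> t" for u t
  proof -
    have "norm (G u t) \<le> \<bar>((1 + norm u) / 2) * \<Omega> t\<bar>"
    proof (rule norm_antiderivative_le[OF G(2,1)])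
      show "((\<lambda>t. ((1 + norm u) / 2) * \<Omega> t) has_vector_derivative ((1 + norm u) / 2) * (\<kappa> t * \<omega> t)) (at t)" for t
        by (rule has_vector_derivative_mult_right[OF \<Omega>'])
      show "norm (f u t) \<le> ((1 + norm u) / 2) * (\<kappa> t * \<omega> t)" for t
      proof -
        have "norm (f u t) \<le> norm (F t y0) + norm (f u t - F t y0)" by norm
        also have "norm (f u t - F t y0) \<le> L t * (\<omega> t * norm (apply_bcontfun u t))"
          unfolding f_def using lip[of t "y0 + \<omega> t *\<^sub>R apply_bcontfun u t" y0] \<omega>(3)[of t] by simp
        also have "\<dots> \<le> \<bar>L t\<bar> * (\<omega> t * norm u)"
          using \<omega>(3)[of t] norm_bounded[of u t] by (intro mult_mono) auto
        also have "norm (F t y0) + \<bar>L t\<bar> * (\<omega> t * norm u)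
            \<le> (\<kappa> t / 2) * \<omega> t + (\<kappa> t / 2) * (\<omega> t * norm u)"
          using \<omega>(1,3)[of t] mult_mono[of "norm (F t y0)" "\<kappa> t / 2" 1 "\<omega> t"]
          by (intro add_mono mult_right_mono) (auto simp: \<kappa>_def)
        finally show ?thesis by (simp add: algebra_simps)
      qed
    qed (simp add: \<Omega>0)
    also have "\<dots> \<le> ((1 + norm u) / 2) * \<omega> t"
      using \<omega>(2)[of t] by (simp add: abs_mult mult_left_mono)
    finally show ?thesis .
  qed
  define T where "T u = Bcontfun (\<lambda>t. G u t /\<^sub>R \<omega> t)" for u
  have T: "apply_bcontfun (T u) t = G u t /\<^sub>R \<omega> t" for u t
  proof -
    have "(\<lambda>t. G u t /\<^sub>R \<omega> t) \<in> bcontfun"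
    proof (rule bcontfun_normI)
      show "continuous_on UNIV (\<lambda>t. G u t /\<^sub>R \<omega> t)"
        using \<omega>(3)
        by (intro continuous_intros c\<omega>
            continuous_on_vector_derivative[OF has_vector_derivative_at_within[OF G(2)]])
          (simp add: less_imp_neq[symmetric])
      show "norm (G u t /\<^sub>R \<omega> t) \<le> (1 + norm u) / 2" for t
        using bound[of u t] \<omega>(3)[of t] by (simp add: field_simps)
    qed
    then show ?thesis by (simp add: T_def Bcontfun_inverse)
  qed
  have "\<exists>!u. T u = u"
  proof (rule banach_fix_type[of "1/2"])
    have "dist (T u) (T v) \<le> 1/2 * dist u v" for u v
    proof (rule dist_bound)
      fix t
      have "norm (G u t - G v t) \<le> \<bar>(dist u v / 2) * \<Omega> t\<bar>"
      proof (rule norm_antiderivative_le[of "\<lambda>t. G u t - G v t"])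
        show "((\<lambda>t. G u t - G v t) has_vector_derivative f u t - f v t) (at t)" for t
          by (intro has_vector_derivative_diff G)
        show "((\<lambda>t. (dist u v / 2) * \<Omega> t) has_vector_derivative (dist u v / 2) * (\<kappa> t * \<omega> t)) (at t)" for t
          by (rule has_vector_derivative_mult_right[OF \<Omega>'])
        show "norm (f u t - f v t) \<le> (dist u v / 2) * (\<kappa> t * \<omega> t)" for t
        proof -
          have "norm (f u t - f v t) \<le> L t * norm (\<omega> t *\<^sub>R (apply_bcontfun u t - apply_bcontfun v t))"
            using lip[of t "y0 + \<omega> t *\<^sub>R apply_bcontfun u t" "y0 + \<omega> t *\<^sub>R apply_bcontfun v t"]
            by (simp add: f_def scaleR_diff_right)
          also have "\<dots> \<le> (\<kappa> t / 2) * (\<omega> t * dist u v)"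
          proof (rule mult_mono)
            show "L t \<le> \<kappa> t / 2"
              by (rule order_trans[OF abs_ge_self]) (simp add: \<kappa>_def)
            show "norm (\<omega> t *\<^sub>R (apply_bcontfun u t - apply_bcontfun v t)) \<le> \<omega> t * dist u v"
              using \<omega>(3)[of t] dist_bounded[of u t v] by (simp add: dist_norm del: minus_bcontfun.rep_eq)
          qed (simp_all add: \<kappa>_def)
          finally show ?thesis by (simp add: algebra_simps)
        qed
      qed (simp_all add: G \<Omega>0)
      also have "\<dots> \<le> (dist u v / 2) * \<omega> t"
        using \<omega>(2)[of t] by (simp add: abs_mult mult_left_mono)
      finally have "norm (G u t - G v t) / \<omega> t \<le> dist u v / 2"
        using \<omega>(3)[of t] by (simp add: pos_divide_le_eq)
      moreover have "dist (apply_bcontfun (T u) t) (apply_bcontfun (T v) t) = norm ((G u t - G v t) /\<^sub>R \<omega> t)"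
        by (simp only: T dist_norm scaleR_diff_right)
      moreover have "norm ((G u t - G v t) /\<^sub>R \<omega> t) = norm (G u t - G v t) / \<omega> t"
        using \<omega>(3)[of t] by (simp only: norm_scaleR abs_inverse divide_inverse abs_of_pos mult.commute)
      ultimately show "dist (apply_bcontfun (T u) t) (apply_bcontfun (T v) t) \<le> 1/2 * dist u v"
        by linarith
    qed
    then show "\<forall>u v. dist (T u) (T v) \<le> 1/2 * dist u v" by simp
  qed simp_all
  then obtain u where u: "T u = u" by blast
  have eq: "\<omega> t *\<^sub>R apply_bcontfun u t = G u t" for t
    using T[of u t] \<omega>(3)[of t] by (simp add: u)
  show ?thesis
  proof (intro exI[of _ "\<lambda>t. y0 + G u t"] conjI allI)
    show "((\<lambda>t. y0 + G u t) has_vector_derivative F t (y0 + G u t)) (at t)" for t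
      using G(2)[of u t] unfolding f_def eq
      by (auto intro: has_vector_derivative_eq_rhs[OF has_vector_derivative_add[OF has_vector_derivative_const]])
  qed (simp add: G)
qed

subsection \<open>Gronwall estimates\<close>

text \<open>Squaring avoids differentiating the norm where it vanishes. The mixed term
  \<open>2 * norm (e s) * d\<close> is absorbed by \<open>(norm (e s))\<^sup>2 + d\<^sup>2\<close>,
  which accounts for the extra 1 in the exponent.\<close>

lemma gronwall_forward:
  fixes e :: "real \<Rightarrow> 'a::real_inner"
  assumes der: "\<And>s. 0 \<le> s \<Longrightarrow> s \<le> t \<Longrightarrow> (e has_vector_derivative e' s) (at s)"
    and bnd: "\<And>s. 0 \<le> s \<Longrightarrow> s \<le> t \<Longrightarrow> norm (e' s) \<le> L * norm (e s) + d"
    and "0 \<le> t" "0 \<le> d" "0 \<le> L"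
  shows "(norm (e t))\<^sup>2 \<le> ((norm (e 0))\<^sup>2 + d\<^sup>2) * exp ((2 * L + 1) * t)"
proof -
  define n where "n s = (e s \<bullet> e s + d\<^sup>2) * exp (- ((2 * L + 1) * s))" for s
  have "n t \<le> n 0"
  proof (rule DERIV_nonpos_imp_nonincreasing[OF \<open>0 \<le> t\<close>])
    fix s assume s: "0 \<le> s" "s \<le> t"
    have e: "(e has_derivative (\<lambda>h. h *\<^sub>R e' s)) (at s)"
      using der[OF s] by (simp add: has_vector_derivative_def)
    have "((\<lambda>s. e s \<bullet> e s) has_real_derivative 2 * (e s \<bullet> e' s)) (at s)"
      unfolding has_field_derivative_def
      by (rule has_derivative_eq_rhs[OF has_derivative_inner[OF e e]])
        (auto simp: fun_eq_iff inner_commute)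
    then have "(n has_real_derivative (2 * (e s \<bullet> e' s) - (2 * L + 1) * (e s \<bullet> e s + d\<^sup>2))
        * exp (- ((2 * L + 1) * s))) (at s)"
      unfolding n_def by (auto intro!: derivative_eq_intros simp: algebra_simps)
    moreover have "2 * (e s \<bullet> e' s) - (2 * L + 1) * (e s \<bullet> e s + d\<^sup>2) \<le> 0"
    proof -
      have "e s \<bullet> e' s \<le> norm (e s) * norm (e' s)" by (rule norm_cauchy_schwarz)
      also have "\<dots> \<le> norm (e s) * (L * norm (e s) + d)" by (intro mult_left_mono bnd s) auto
      finally have "2 * (e s \<bullet> e' s) \<le> 2 * L * (norm (e s))\<^sup>2 + 2 * norm (e s) * d"
        by (simp add: algebra_simps power2_eq_square)
      moreover have "2 * norm (e s) * d \<le> (norm (e s))\<^sup>2 + d\<^sup>2" by (rule sum_squares_bound)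
      moreover have "0 \<le> 2 * L * d\<^sup>2" using \<open>0 \<le> L\<close> by simp
      ultimately show ?thesis by (simp add: power2_norm_eq_inner[symmetric] algebra_simps)
    qed
    ultimately show "\<exists>y. (n has_real_derivative y) (at s) \<and> y \<le> 0"
      by (intro exI conjI) (auto intro: mult_nonpos_nonneg)
  qed
  then have "n t * exp ((2 * L + 1) * t) \<le> n 0 * exp ((2 * L + 1) * t)"
    by (rule mult_right_mono) simp
  then have "e t \<bullet> e t + d\<^sup>2 \<le> (e 0 \<bullet> e 0 + d\<^sup>2) * exp ((2 * L + 1) * t)"
    by (simp add: n_def exp_minus mult.assoc del: mult_le_cancel_right)
  moreover have "0 \<le> d\<^sup>2" by simp
  ultimately show ?thesis unfolding power2_norm_eq_inner by linarith
qed

lemma gronwall: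
  fixes e :: "real \<Rightarrow> 'a::real_inner"
  assumes der: "\<And>s. \<bar>s\<bar> \<le> T \<Longrightarrow> (e has_vector_derivative e' s) (at s)"
    and bnd: "\<And>s. \<bar>s\<bar> \<le> T \<Longrightarrow> norm (e' s) \<le> L * norm (e s) + d"
    and "\<bar>t\<bar> \<le> T" "0 \<le> d" "0 \<le> L"
  shows "(norm (e t))\<^sup>2 \<le> ((norm (e 0))\<^sup>2 + d\<^sup>2) * exp ((2 * L + 1) * \<bar>t\<bar>)"
proof (cases "0 \<le> t")
  case True
  then show ?thesis
    using gronwall_forward[of t e e' L d] assms by auto
next
  case False
  have "((\<lambda>s. e (- s)) has_vector_derivative - e' (- s)) (at s)" if "0 \<le> s" "s \<le> - t" for s
  proof -
    have "(uminus has_vector_derivative (- 1 :: real)) (at s)"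
      unfolding has_real_derivative_iff_has_vector_derivative[symmetric]
    by (auto intro!: derivative_eq_intros)
    from vector_diff_chain_at[OF this, of e] show ?thesis
      using der[of "- s"] that False assms(3) by (simp add: o_def)
  qed
  then show ?thesis
    using gronwall_forward[of "- t" "\<lambda>s. e (- s)" "\<lambda>s. - e' (- s)" L d] bnd assms(3-5) False by auto
qed

lemma continuous_bounded_abs:
  fixes L :: "real \<Rightarrow> real"
  assumes "continuous_on UNIV L"
  obtains B where "0 \<le> B" "\<And>s. \<bar>s\<bar> \<le> T \<Longrightarrow> L s \<le> B"
proof -
  have "bounded (L ` {-T..T})"
    by (intro compact_imp_bounded compact_continuous_image continuous_on_subset[OF assms]) auto
  then obtain B where "\<forall>s\<in>{-T..T}. \<bar>L s\<bar> \<le> B" by (auto simp: bounded_iff)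
  then have "L s \<le> max 0 B" if "\<bar>s\<bar> \<le> T" for s using that by (fastforce simp: abs_le_iff le_max_iff_disj)
  then show ?thesis using that[of "max 0 B"] by auto
qed

text \<open>Gronwall without forcing, after bounding the continuous rate on a compact time
  interval.\<close>

lemma ode_zero_unique:
  fixes e :: "real \<Rightarrow> 'a::real_inner"
  assumes "e 0 = 0" "\<And>s. (e has_vector_derivative e' s) (at s)"
    and "continuous_on UNIV L" "\<And>s. norm (e' s) \<le> L s * norm (e s)"
  shows "e t = 0"
proof -
  obtain B where B: "0 \<le> B" "\<And>s. \<bar>s\<bar> \<le> \<bar>t\<bar> \<Longrightarrow> L s \<le> B"
    using continuous_bounded_abs[OF assms(3), of "\<bar>t\<bar>"] by blast
  have "norm (e' s) \<le> B * norm (e s) + 0" if "\<bar>s\<bar> \<le> \<bar>t\<bar>" for s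
    using assms(4)[of s] mult_right_mono[OF B(2)[OF that], of "norm (e s)"] by simp
  from gronwall[where T="\<bar>t\<bar>", OF assms(2) this, of t] have "(norm (e t))\<^sup>2 \<le> 0"
    using B assms(1) by simp
  then show ?thesis by simp
qed

subsection \<open>Linear equations with parameters\<close>

text \<open>The sum over the basis serves as an operator norm bound that is visibly continuous in
  parameters.\<close>

lemma norm_linear_le:
  fixes L :: "'a::euclidean_space \<Rightarrow> 'b::real_normed_vector"
  assumes "linear L"
  shows "norm (L w) \<le> (\<Sum>b\<in>Basis. norm (L b)) * norm w"
  unfolding linear_on_basis[OF assms, of w] sum_distrib_right
  by (intro norm_sum[THEN order_trans] sum_mono) (auto simp: Basis_le_norm mult.commute[of _ "norm w"] intro!: mult_right_mono)

lemma linear_ode_unique: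
  fixes A :: "real \<Rightarrow> 'a::euclidean_space \<Rightarrow> 'a"
  assumes "\<And>t. linear (A t)" "\<And>w. continuous_on UNIV (\<lambda>t. A t w)"
    and "\<And>t. (u has_vector_derivative A t (u t) + b t) (at t)"
    and "\<And>t. (v has_vector_derivative A t (v t) + b t) (at t)" "u 0 = v 0"
  shows "u t = v t"
proof -
  have "(\<lambda>t. u t - v t) t = 0"
  proof (rule ode_zero_unique[where L="\<lambda>t. \<Sum>b\<in>Basis. norm (A t b)"])
    show "((\<lambda>t. u t - v t) has_vector_derivative A t (u t - v t)) (at t)" for t
      using has_vector_derivative_diff[OF assms(3,4)] by (simp add: linear_diff[OF assms(1)])
  qed (auto intro!: continuous_intros assms norm_linear_le)
  then show ?thesis by simp
qed

lemma continuous_linear_family: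
  fixes h :: "'a::real_normed_vector \<Rightarrow> 'b::euclidean_space"
    and L :: "'a \<Rightarrow> 'b \<Rightarrow> 'c::real_normed_vector"
  assumes "\<And>x. linear (L x)" "\<And>b. continuous_on UNIV (\<lambda>x. L x b)" "continuous_on UNIV h"
  shows "continuous_on UNIV (\<lambda>x. L x (h x))"
  using Ck_linear_family[of L 0 h] assms by simp

lemma linear_ode_solution:
  fixes A :: "real \<Rightarrow> 'a::euclidean_space \<Rightarrow> 'a"
  assumes "\<And>t. linear (A t)" "\<And>w. continuous_on UNIV (\<lambda>t. A t w)" "continuous_on UNIV b"
  shows "\<exists>u. u 0 = u0 \<and> (\<forall>t. (u has_vector_derivative A t (u t) + b t) (at t))"
proof (rule ode_global_solution[of "\<lambda>t u. A t u + b t"])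
  have "continuous_on UNIV (\<lambda>z. A (fst z) w)" for w
    by (rule continuous_on_compose2[OF assms(2)]) (auto intro: continuous_intros)
  from continuous_linear_family[OF assms(1) this continuous_on_snd[OF continuous_on_id]]
  have "continuous_on UNIV (\<lambda>z. A (fst z) (snd z))" .
  moreover have "continuous_on UNIV (\<lambda>z. b (fst z))"
    by (rule continuous_on_compose2[OF assms(3)]) (auto intro: continuous_intros)
  ultimately show "continuous_on UNIV (\<lambda>(t, u). A t u + b t)"
    unfolding split_beta by (rule continuous_on_add)
  show "norm ((A t y + b t) - (A t z + b t)) \<le> (\<Sum>b\<in>Basis. norm (A t b)) * norm (y - z)" for t y z
    using norm_linear_le[OF assms(1), of t "y - z"] by (simp add: linear_diff[OF assms(1)])
qed (intro continuous_intros assms)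

lemma uniform_small:
  fixes G :: "real \<times> 'p::euclidean_space \<Rightarrow> 'c::real_normed_vector"
  assumes "continuous_on UNIV G" "\<And>t. G (t, x0) = 0" "0 < (\<epsilon> :: real)"
  obtains d where "0 < d" "d \<le> 1" "\<And>t x. \<bar>t\<bar> \<le> T \<Longrightarrow> dist x x0 < d \<Longrightarrow> norm (G (t, x)) < \<epsilon>"
proof -
  have "uniformly_continuous_on ({-T..T} \<times> cball x0 1) G"
    by (intro compact_uniformly_continuous continuous_on_subset[OF assms(1)] compact_Times) auto
  then obtain d where d: "d > 0" "\<And>z z'. z \<in> {-T..T} \<times> cball x0 1 \<Longrightarrow> z' \<in> {-T..T} \<times> cball x0 1
      \<Longrightarrow> dist z' z < d \<Longrightarrow> dist (G z') (G z) < \<epsilon>"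
    using assms(3) by (elim uniformly_continuous_onE) auto
  show ?thesis
  proof (rule that[of "min d 1"])
    fix t x assume "\<bar>t\<bar> \<le> T" "dist x x0 < min d 1"
    then show "norm (G (t, x)) < \<epsilon>"
      using d(2)[of "(t, x0)" "(t, x)"]
      by (simp add: dist_Pair_Pair assms(2) abs_le_iff dist_commute[of x0 x])
  qed (use d in auto)
qed

text \<open>The difference of the solutions for \<open>x\<close> and \<open>x0\<close> solves the
  same linear equation with a forcing that is uniformly small on compact time intervals; Gronwall
  makes the difference small.\<close>

lemma linear_ode_continuous:
  fixes A :: "real \<times> 'p::euclidean_space \<Rightarrow> 'a::euclidean_space \<Rightarrow> 'a"
  assumes lin: "\<And>z. linear (A z)" and cA: "\<And>w. continuous_on UNIV (\<lambda>z. A z w)"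
    and cb: "continuous_on UNIV b"
    and W0: "\<And>x. W (0, x) = w0"
    and W: "\<And>t x. ((\<lambda>t. W (t, x)) has_vector_derivative A (t, x) (W (t, x)) + b (t, x)) (at t)"
  shows "continuous_on UNIV W"
  unfolding continuous_on_eq_continuous_at[OF open_UNIV]
proof (intro ballI)
  fix z0 :: "real \<times> 'p"
  obtain t0 x0 where z0: "z0 = (t0, x0)" by (cases z0)
  define T where "T = \<bar>t0\<bar> + 1"
  have cW: "continuous_on S (\<lambda>t. W (t, x))" for S x
    by (rule continuous_on_vector_derivative[OF has_vector_derivative_at_within[OF W]])
  \<comment> \<open>The forcing involves only the solution for \<open>x0\<close>, which is
    continuous in time by itself, so its continuity does not presuppose the claim.\<close>
  define G where "G z = A z (W (fst z, x0)) - A (fst z, x0) (W (fst z, x0)) + b z - b (fst z, x0)" for z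
  have p: "continuous_on UNIV (\<lambda>z::real \<times> 'p. (fst z, x0))" by (intro continuous_intros)
  have cW0: "continuous_on UNIV (\<lambda>z::real \<times> 'p. W (fst z, x0))"
    using continuous_on_compose2[OF cW[of UNIV x0] continuous_on_fst[OF continuous_on_id]] by simp
  have cA0: "continuous_on UNIV (\<lambda>z::real \<times> 'p. A (fst z, x0) w)" for w
    using continuous_on_compose2[OF cA p] by simp
  have cb0: "continuous_on UNIV (\<lambda>z::real \<times> 'p. b (fst z, x0))"
    using continuous_on_compose2[OF cb p] by simp
  have cG: "continuous_on UNIV G"
    unfolding G_def
    by (intro continuous_on_add continuous_on_diff cb cb0 continuous_linear_family[OF lin cA cW0]
        continuous_linear_family[OF lin cA0 cW0])
  define K where "K z = (\<Sum>b\<in>Basis. norm (A z b))" for z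
  have "continuous_on UNIV K" unfolding K_def by (intro continuous_intros cA)
  then have "bounded (K ` ({-T..T} \<times> cball x0 1))"
    by (intro compact_imp_bounded compact_continuous_image compact_Times) (auto intro: continuous_on_subset)
  then obtain L0 where L0: "\<forall>z\<in>{-T..T} \<times> cball x0 1. \<bar>K z\<bar> \<le> L0" by (auto simp: bounded_iff)
  define L where "L = max 0 L0"
  have L1: "0 \<le> L" by (simp add: L_def)
  have L2: "K (t, x) \<le> L" if "\<bar>t\<bar> \<le> T" "dist x x0 \<le> 1" for t x
  proof -
    have "(t, x) \<in> {-T..T} \<times> cball x0 1"
      using that by (simp add: dist_commute[of x0 x] abs_le_iff)
    then have "\<bar>K (t, x)\<bar> \<le> L0" using L0 by blast
    then show ?thesis by (simp add: L_def)
  qed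
  show "isCont W z0"
    unfolding continuous_at_eps_delta
  proof (intro allI impI)
    fix \<epsilon> :: real assume "0 < \<epsilon>"
    define c where "c = exp ((2 * L + 1) * T)"
    have c: "c > 0" by (simp add: c_def)
    \<comment> \<open>Half of \<open>\<epsilon>\<close> pays for the change of parameter, half for
      the change of time at \<open>x0\<close>; adding 1 to \<open>sqrt c\<close> makes the
      inequality strict.\<close>
    define \<delta> where "\<delta> = \<epsilon> / 2 / (sqrt c + 1)"
    have \<delta>: "\<delta> > 0" "\<delta> * sqrt c < \<epsilon> / 2"
      using \<open>0 < \<epsilon>\<close> c by (auto simp: \<delta>_def field_simps add_pos_pos)
    have G0: "G (t, x0) = 0" for t by (simp add: G_def)
    obtain d where d: "0 < d" "d \<le> 1"
      "\<And>t x. \<bar>t\<bar> \<le> T \<Longrightarrow> dist x x0 < d \<Longrightarrow> norm (G (t, x)) < \<delta>"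
      using uniform_small[OF cG G0 \<delta>(1), of T] by blast
    have near: "norm (W (t, x) - W (t, x0)) < \<epsilon> / 2" if "\<bar>t\<bar> \<le> T" "dist x x0 < d" for t x
    proof -
      define e where "e t = W (t, x) - W (t, x0)" for t
      have "(norm (e t))\<^sup>2 \<le> ((norm (e 0))\<^sup>2 + \<delta>\<^sup>2) * exp ((2 * L + 1) * \<bar>t\<bar>)"
      proof (rule gronwall[where T=T and e'="\<lambda>t. A (t, x) (e t) + G (t, x)"])
        fix s assume s: "\<bar>s\<bar> \<le> T"
        show "(e has_vector_derivative A (s, x) (e s) + G (s, x)) (at s)"
          unfolding e_def
          by (rule has_vector_derivative_eq_rhs[OF has_vector_derivative_diff[OF W W]])
            (simp add: G_def linear_diff[OF lin])
        have "norm (A (s, x) (e s)) \<le> L * norm (e s)"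
          using norm_linear_le[OF lin, of "(s, x)" "e s"] that(2) d(2)
            mult_right_mono[OF L2[OF s, of x], of "norm (e s)"] by (simp add: K_def)
        then show "norm (A (s, x) (e s) + G (s, x)) \<le> L * norm (e s) + \<delta>"
          using d(3)[OF s that(2)] by (intro norm_triangle_le add_mono) auto
      qed (use that L1 \<delta> in auto)
      also have "(norm (e 0))\<^sup>2 + \<delta>\<^sup>2 = \<delta>\<^sup>2" by (simp add: e_def W0)
      also have "\<delta>\<^sup>2 * exp ((2 * L + 1) * \<bar>t\<bar>) \<le> \<delta>\<^sup>2 * c"
        unfolding c_def using that(1) L1
        by (intro mult_left_mono exp_le_cancel_iff[THEN iffD2]) auto
      also have "\<delta>\<^sup>2 * c = (\<delta> * sqrt c)\<^sup>2"
        by (simp only: power_mult_distrib real_sqrt_pow2[OF less_imp_le[OF c]])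
      finally have "(norm (e t))\<^sup>2 \<le> (\<delta> * sqrt c)\<^sup>2" .
      then have "norm (e t) \<le> \<delta> * sqrt c"
        by (rule power2_le_imp_le)
          (rule mult_nonneg_nonneg[OF less_imp_le[OF \<delta>(1)] real_sqrt_ge_zero[OF less_imp_le[OF c]]])
      then show ?thesis using \<delta>(2) by (simp add: e_def)
    qed
    have "isCont (\<lambda>t. W (t, x0)) t0"
      using cW[of UNIV] by (simp add: continuous_on_eq_continuous_at)
    from this[unfolded continuous_at_eps_delta, rule_format, OF half_gt_zero[OF \<open>0 < \<epsilon>\<close>]]
    obtain d' where d': "d' > 0" "\<And>t. dist t t0 < d' \<Longrightarrow> dist (W (t, x0)) (W (t0, x0)) < \<epsilon> / 2"
      by auto
    show "\<exists>d>0. \<forall>z'. dist z' z0 < d \<longrightarrow> dist (W z') (W z0) < \<epsilon>"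
    proof (intro exI[of _ "min d (min d' 1)"] conjI allI impI)
      fix z' assume z': "dist z' z0 < min d (min d' 1)"
      obtain t x where tx: "z' = (t, x)" by (cases z')
      have "dist t t0 \<le> dist z' z0" "dist x x0 \<le> dist z' z0"
        using dist_fst_le[of z' z0] dist_snd_le[of z' z0] by (auto simp: tx z0)
      then have t: "dist t t0 < d'" "\<bar>t\<bar> \<le> T" "dist x x0 < d"
        using z' by (auto simp: T_def dist_real_def)
      show "dist (W z') (W z0) < \<epsilon>"
        using near[OF t(2,3)] d'(2)[OF t(1)] dist_triangle[of "W (t, x)" "W (t0, x0)" "W (t, x0)"]
        unfolding tx z0 by (simp add: dist_norm)
    qed (use d d' in auto)
  qed
qed

lemma has_vector_derivative_shift:
  assumes "(f has_vector_derivative d) (at (a + s))"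
  shows "((\<lambda>h. f (a + h)) has_vector_derivative d) (at s)"
proof -
  have "((\<lambda>h. a + h) has_vector_derivative 1) (at s)"
    unfolding has_real_derivative_iff_has_vector_derivative[symmetric]
    by (auto intro!: derivative_eq_intros)
  from vector_diff_chain_at[OF this assms] show ?thesis by (simp add: o_def)
qed

lemma continuous_on_UNIV_tendsto:
  "continuous_on UNIV f \<Longrightarrow> (f \<longlongrightarrow> f x) (at x)"
  by (simp add: continuous_on_def)

text \<open>The difference quotients in the parameter solve a linear equation depending continuously on the
  step \<^term>\<open>h\<close>, including \<^term>\<open>h = (0::real)\<close>; hence they converge.\<close>

lemma linear_ode_Ck:
  fixes A :: "real \<times> 'p::euclidean_space \<Rightarrow> 'a::euclidean_space \<Rightarrow> 'a"
  assumes lin: "\<And>z. linear (A z)"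
  shows "(\<And>w. Ck k (\<lambda>z. A z w)) \<Longrightarrow> Ck k b \<Longrightarrow> (\<And>x. W (0, x) = w0)
    \<Longrightarrow> (\<And>t x. ((\<lambda>t. W (t, x)) has_vector_derivative A (t, x) (W (t, x)) + b (t, x)) (at t))
    \<Longrightarrow> Ck k W"
proof (induction k arbitrary: b W w0)
  case 0
  then show ?case
    using linear_ode_continuous[where A=A and b=b and W=W and ?w0.0=w0] lin by simp
next
  case (Suc k)
  note CA = Suc.prems(1) and Cb = Suc.prems(2) and W0 = Suc.prems(3) and W = Suc.prems(4)
  note dA = Ck_SucD[OF CA] and db = Ck_SucD[OF Cb]
  have CAk: "Ck k (\<lambda>z. A z w)" and Cbk: "Ck k b" for w
    using Ck_Suc_imp_Ck[OF CA] Ck_Suc_imp_Ck[OF Cb] by auto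
  have CW: "Ck k W" by (rule Suc.IH[OF CAk Cbk W0 W])
  define dAc where "dAc c z w = frechet_derivative (\<lambda>z. A z w) (at z) (0, c)" for c z w
  have lin_dA: "linear (dAc c z)" for c z
  proof (rule linearI)
    fix u v and r :: real
    have "frechet_derivative (\<lambda>z. A z u + A z v) (at z) = (\<lambda>w. frechet_derivative (\<lambda>z. A z u) (at z) w + frechet_derivative (\<lambda>z. A z v) (at z) w)"
      using frechet_derivative_at[OF has_derivative_add[OF dA(1) dA(1)]] by metis
    then show "dAc c z (u + v) = dAc c z u + dAc c z v"
      by (simp add: dAc_def linear_add[OF lin])
    have "frechet_derivative (\<lambda>z. r *\<^sub>R A z u) (at z) = (\<lambda>w. r *\<^sub>R frechet_derivative (\<lambda>z. A z u) (at z) w)"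
      using frechet_derivative_at[OF has_derivative_scaleR_right[OF dA(1)]] by metis
    then show "dAc c z (r *\<^sub>R u) = r *\<^sub>R dAc c z u"
      by (simp add: dAc_def linear_scale[OF lin])
  qed
  have CdA: "Ck k (\<lambda>z. dAc c z w)" for c w unfolding dAc_def by (rule dA(2))
  \<comment> \<open>The forcing in the equation for the derivative of \<open>W\<close> in direction
    \<open>c\<close>: the parameter derivatives of \<open>A\<close> and \<open>b\<close> along the
    solution.\<close>
  define dW where "dW c z = dAc c z (W z) + frechet_derivative b (at z) (0, c)" for c z
  have CdW: "Ck k (dW c)" for c
    unfolding dW_def by (rule Ck_add[OF Ck_linear_family[OF lin_dA CdA CW] db(2)])
  have "\<exists>u. u 0 = 0 \<and> (\<forall>t. (u has_vector_derivative A (t, x) (u t) + dW c (t, x)) (at t))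
      \<and> (\<forall>t. ((\<lambda>h. W (t, x + h *\<^sub>R c)) has_vector_derivative u t) (at 0))" for x c
  proof -
    define q :: "real \<times> real \<Rightarrow> real \<times> 'p" where "q z = (fst z, x + snd z *\<^sub>R c)" for z
    \<comment> \<open>When the equations at \<open>x + h *\<^sub>R c\<close> and \<open>x\<close>
      are subtracted, \<open>A\<close> at the moved parameter acts on the difference, and in the
      remaining term \<open>W\<close> is frozen at \<open>x\<close>. The segment formula writes that
      term as \<open>h\<close> times \<open>B\<close>.\<close>
    define r where "r y = (\<lambda>z. dAc c z (W (fst z, x)) + frechet_derivative b (at z) (0, c)) y" for y
    define B where "B z = integral {0..1} (\<lambda>s. r (fst z, x + (s * snd z) *\<^sub>R c))" for z :: "real \<times> real"
    have cq: "continuous_on UNIV q" unfolding q_def by (intro continuous_intros)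
    have cWx: "continuous_on UNIV (\<lambda>z::real \<times> 'p. W (fst z, x))"
      using continuous_on_compose2[OF Ck_continuous_on[OF CW, of UNIV]
          continuous_on_Pair[OF continuous_on_fst[OF continuous_on_id] continuous_on_const]] by simp
    have cr: "continuous_on UNIV r"
      unfolding r_def
      by (rule continuous_on_add[OF continuous_linear_family[OF lin_dA Ck_continuous_on[OF CdA] cWx]
            Ck_continuous_on[OF db(2)]])
    have cB: "continuous_on UNIV B"
    proof -
      have "continuous_on UNIV (\<lambda>y::real \<times> (real \<times> real). r (fst (snd y), x + (fst y * snd (snd y)) *\<^sub>R c))"
        by (rule continuous_on_compose2[OF cr]) (auto intro!: continuous_intros)
      from continuous_on_param_integral[OF this, of 0 1] show ?thesis by (simp add: B_def[abs_def])
    qed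
    have cAq: "continuous_on UNIV (\<lambda>z. A (q z) w)" for w
      using continuous_on_compose2[OF Ck_continuous_on[OF CAk, of UNIV] cq] by simp
    have c1: "continuous_on UNIV (\<lambda>t. f (t, h))" if "continuous_on UNIV f" for f :: "real \<times> real \<Rightarrow> 'a" and h
      using continuous_on_compose2[OF that continuous_on_Pair[OF continuous_on_id continuous_on_const]] by simp
    have "\<exists>Q. \<forall>h. Q h 0 = 0 \<and> (\<forall>t. (Q h has_vector_derivative A (q (t, h)) (Q h t) + B (t, h)) (at t))"
      by (intro choice allI linear_ode_solution lin c1[OF cAq] c1[OF cB])
    then obtain Q where Q: "\<And>h. Q h 0 = 0"
      "\<And>h t. (Q h has_vector_derivative A (q (t, h)) (Q h t) + B (t, h)) (at t)" by blast
    have cQ: "continuous_on UNIV (\<lambda>(t, h). Q h t)"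
      by (rule linear_ode_continuous[where A="\<lambda>z. A (q z)" and b=B and ?w0.0=0])
        (simp_all add: lin cAq cB Q)
    have quot: "W (t, x + h *\<^sub>R c) - W (t, x) = h *\<^sub>R Q h t" for t h
    proof (rule linear_ode_unique[where A="\<lambda>t. A (q (t, h))" and b="\<lambda>t. h *\<^sub>R B (t, h)"])
      fix t
      have had: "A (t, x + h *\<^sub>R c) w - A (t, x) w + (b (t, x + h *\<^sub>R c) - b (t, x)) = h *\<^sub>R B (t, h)"
        if w: "w = W (t, x)" for w
      proof -
        define g where "g z = A z w + b z" for z
        define g' where "g' z v = frechet_derivative (\<lambda>z. A z w) (at z) v + frechet_derivative b (at z) v" for z v
        have g: "(g has_derivative g' z) (at z)" for z
          unfolding g_def g'_def by (intro has_derivative_add dA db)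
        have "g ((t, x) + (0, h *\<^sub>R c)) - g (t, x) = integral {0..1} (\<lambda>s. g' ((t, x) + s *\<^sub>R (0, h *\<^sub>R c)) (0, h *\<^sub>R c))"
          by (rule hadamard_integral[OF g])
        also have "\<dots> = integral {0..1} (\<lambda>s. h *\<^sub>R r (t, x + (s * h) *\<^sub>R c))"
        proof (rule integral_cong)
          fix s :: real
          have "g' ((t, x) + s *\<^sub>R (0, h *\<^sub>R c)) (h *\<^sub>R (0, c)) = h *\<^sub>R g' ((t, x) + s *\<^sub>R (0, h *\<^sub>R c)) (0, c)"
            by (rule linear_scale[OF has_derivative_linear[OF g]])
          then show "g' ((t, x) + s *\<^sub>R (0, h *\<^sub>R c)) (0, h *\<^sub>R c) = h *\<^sub>R r (t, x + (s * h) *\<^sub>R c)"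
            by (simp add: g'_def r_def dAc_def w)
        qed
        finally show ?thesis by (simp add: g_def B_def add_diff_add)
      qed
      show "((\<lambda>t. W (t, x + h *\<^sub>R c) - W (t, x)) has_vector_derivative
          A (q (t, h)) (W (t, x + h *\<^sub>R c) - W (t, x)) + h *\<^sub>R B (t, h)) (at t)"
        by (rule has_vector_derivative_eq_rhs[OF has_vector_derivative_diff[OF W[of "x + h *\<^sub>R c" t] W[of x t]]])
          (simp add: q_def linear_diff[OF lin] had[OF refl, symmetric] algebra_simps)
      show "((\<lambda>t. h *\<^sub>R Q h t) has_vector_derivative A (q (t, h)) (h *\<^sub>R Q h t) + h *\<^sub>R B (t, h)) (at t)"
        using has_vector_derivative_scaleR[OF DERIV_const Q(2), of h h t]
        by (simp add: linear_scale[OF lin] scaleR_add_right)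
    qed (simp_all add: lin c1[OF cAq] W0 Q)
    show ?thesis
    proof (intro exI[of _ "Q 0"] conjI allI)
      fix t
      have "B (t, 0) = dW c (t, x)"
        by (simp add: B_def r_def dW_def)
      then show "(Q 0 has_vector_derivative A (t, x) (Q 0 t) + dW c (t, x)) (at t)"
        using Q(2)[of 0 t] by (simp add: q_def)
      have "continuous_on UNIV (\<lambda>h. (t, h))" for t :: real by (intro continuous_intros)
      from continuous_on_compose2[OF cQ this] have "continuous_on UNIV (\<lambda>h. Q h t)" by simp
      from continuous_on_UNIV_tendsto[OF this, of 0] show "((\<lambda>h. W (t, x + h *\<^sub>R c)) has_vector_derivative Q 0 t) (at 0)"
        by (intro has_vector_derivative_quotient[where q="\<lambda>h. Q h t"])
          (simp_all add: quot)
    qed (simp add: Q)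
  qed
  then obtain U where U: "\<And>x c. U x c 0 = 0"
    "\<And>x c t. (U x c has_vector_derivative A (t, x) (U x c t) + dW c (t, x)) (at t)"
    "\<And>x c t. ((\<lambda>h. W (t, x + h *\<^sub>R c)) has_vector_derivative U x c t) (at 0)"
    by metis
  have CU: "Ck k (\<lambda>z. U (snd z) c (fst z))" for c
    by (rule Suc.IH[OF CAk CdW[of c], of _ 0]) (simp_all add: U)
  show ?case
  proof (rule Ck_Suc_partialsI)
    fix e :: "real \<times> 'p" assume e: "e \<in> Basis"
    \<comment> \<open>A basis vector of the product is either the time direction, where the
      derivative is the right-hand side itself, or a parameter direction.\<close>
    show "Ck k (if snd e = 0 then (\<lambda>z. A z (W z) + b z) else (\<lambda>z. U (snd z) (snd e) (fst z)))"
      using CU Ck_add[OF Ck_linear_family[OF lin CAk CW] Cbk] by auto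
    fix z :: "real \<times> 'p"
    obtain t x where z: "z = (t, x)" by (cases z)
    show "((\<lambda>h. W (z + h *\<^sub>R e)) has_vector_derivative
       (if snd e = 0 then (\<lambda>z. A z (W z) + b z) else (\<lambda>z. U (snd z) (snd e) (fst z))) z) (at 0)"
    proof (cases "snd e = 0")
      case True
      then have "e = (1, 0)" using e by (auto simp: Basis_prod_def)
      then show ?thesis
        using has_vector_derivative_shift[of "\<lambda>t. W (t, x)" _ t 0] W[of x t] by (simp add: z)
    next
      case False
      then have "fst e = 0" using e by (auto simp: Basis_prod_def)
      then have "z + h *\<^sub>R e = (t, x + h *\<^sub>R snd e)" for h by (simp add: z prod_eq_iff)
      then show ?thesis using False U(3)[where c="snd e" and x=x and t=t] by (simp add: z)
    qed
  qed
qed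

subsection \<open>Smoothness of flows\<close>

text \<open>The Lipschitz bound is asked for along trajectories starting in a ball rather than on a
  ball, because the fields in use control only a projection of the trajectory.\<close>

lemma continuous_flow:
  fixes \<phi> :: "real \<times> 'a::euclidean_space \<Rightarrow> 'a"
  assumes init: "\<And>x. \<phi> (0, x) = x"
    and der: "\<And>t x. ((\<lambda>t. \<phi> (t, x)) has_vector_derivative Z (t, \<phi> (t, x))) (at t)"
    and lip: "\<And>R. \<exists>L\<ge>0. \<forall>t x y. norm x \<le> R \<longrightarrow> norm y \<le> R \<longrightarrow>
        norm (Z (t, \<phi> (t, x)) - Z (t, \<phi> (t, y))) \<le> L * norm (\<phi> (t, x) - \<phi> (t, y))"
  shows "continuous_on UNIV \<phi>"
  unfolding continuous_on_eq_continuous_at[OF open_UNIV]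
proof (intro ballI)
  fix z0 :: "real \<times> 'a"
  obtain t0 x0 where z0: "z0 = (t0, x0)" by (cases z0)
  define T where "T = \<bar>t0\<bar> + 1"
  obtain L where L: "0 \<le> L" "\<And>t x y. norm x \<le> norm x0 + 1 \<Longrightarrow> norm y \<le> norm x0 + 1 \<Longrightarrow>
      norm (Z (t, \<phi> (t, x)) - Z (t, \<phi> (t, y))) \<le> L * norm (\<phi> (t, x) - \<phi> (t, y))"
    using lip[of "norm x0 + 1"] by blast
  define c where "c = exp ((2 * L + 1) * T)"
  have near: "norm (\<phi> (t, x) - \<phi> (t, x0)) \<le> norm (x - x0) * sqrt c"
    if t: "\<bar>t\<bar> \<le> T" and x: "norm x \<le> norm x0 + 1" for t x
  proof (rule power2_le_imp_le)
    have "(norm ((\<lambda>t. \<phi> (t, x) - \<phi> (t, x0)) t))\<^sup>2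
      \<le> ((norm ((\<lambda>t. \<phi> (t, x) - \<phi> (t, x0)) 0))\<^sup>2 + 0\<^sup>2) * exp ((2 * L + 1) * \<bar>t\<bar>)"
      by (rule gronwall[where T="\<bar>t\<bar>" and e'="\<lambda>t. Z (t, \<phi> (t, x)) - Z (t, \<phi> (t, x0))"])
        (use L(2)[OF x, of x0] L(1) in \<open>simp_all add: has_vector_derivative_diff[OF der der]\<close>)
    also have "\<dots> \<le> (norm (x - x0))\<^sup>2 * c"
      using t L(1) by (auto simp: init c_def intro!: mult_left_mono)
    also have "\<dots> = (norm (x - x0) * sqrt c)\<^sup>2"
      by (simp only: power_mult_distrib real_sqrt_pow2[OF less_imp_le[OF exp_gt_zero]] c_def)
    finally show "(norm (\<phi> (t, x) - \<phi> (t, x0)))\<^sup>2 \<le> (norm (x - x0) * sqrt c)\<^sup>2" .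
  qed (simp add: c_def)
  have c1: "continuous_on UNIV (\<lambda>t. \<phi> (t, x0))"
    by (rule continuous_on_vector_derivative[OF has_vector_derivative_at_within[OF der]])
  have lim: "((\<lambda>z. norm (snd z - x0) * sqrt c + norm (\<phi> (fst z, x0) - \<phi> (t0, x0))) \<longlongrightarrow> 0) (at z0)"
  proof -
    have "continuous_on UNIV (\<lambda>z::real \<times> 'a. norm (snd z - x0) * sqrt c + norm (\<phi> (fst z, x0) - \<phi> (t0, x0)))"
      by (intro continuous_intros continuous_on_compose2[OF c1]) auto
    from continuous_on_UNIV_tendsto[OF this, of z0] show ?thesis by (simp add: z0)
  qed
  have "((\<lambda>z. \<phi> z - \<phi> z0) \<longlongrightarrow> 0) (at z0)"
  proof (rule Lim_null_comparison[OF _ lim])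
    have "\<forall>\<^sub>F z in at z0. dist z z0 < 1" by (auto simp: eventually_at intro: exI[of _ 1])
    then show "\<forall>\<^sub>F z in at z0. norm (\<phi> z - \<phi> z0) \<le> norm (snd z - x0) * sqrt c + norm (\<phi> (fst z, x0) - \<phi> (t0, x0))"
    proof eventually_elim
      case (elim z)
      obtain t x where tx: "z = (t, x)" by (cases z)
      have "dist t t0 < 1" "dist x x0 < 1"
        using dist_fst_le[of z z0] dist_snd_le[of z z0] elim by (auto simp: tx z0)
      then have "\<bar>t\<bar> \<le> T" "norm x \<le> norm x0 + 1"
        using norm_triangle_ineq2[of x x0] by (auto simp: T_def dist_norm)
      from near[OF this] show ?case
        using norm_triangle_ineq[of "\<phi> (t, x) - \<phi> (t, x0)" "\<phi> (t, x0) - \<phi> (t0, x0)"]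
        by (simp add: tx z0)
    qed
  qed
  then show "isCont \<phi> z0" by (simp add: isCont_def LIM_zero_iff)
qed

text \<open>Bootstrapping: the derivative in the initial value solves the linearised equation, whose
  coefficients involve \<open>\<phi>\<close> and so are C^k by induction. The parameter theorem for
  linear equations makes this derivative C^k, and \<open>\<phi>\<close> gains one order.\<close>

lemma Ck_flow:
  fixes \<phi> :: "real \<times> 'a::euclidean_space \<Rightarrow> 'a"
  assumes Z: "smooth Z" and cont: "continuous_on UNIV \<phi>"
    and init: "\<And>x. \<phi> (0, x) = x"
    and der: "\<And>t x. ((\<lambda>t. \<phi> (t, x)) has_vector_derivative Z (t, \<phi> (t, x))) (at t)"
  shows "Ck k \<phi>"
proof (induction k)
  case 0
  show ?case using cont by simp
next
  case (Suc k)
  note dZ = smooth_has_derivative[OF Z]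
  define A where "A z w = frechet_derivative Z (at z) (0, w)" for z and w :: 'a
  have linA: "linear (A z)" for z
  proof -
    have "linear (\<lambda>w::'a. (0::real, w))" by (rule linearI) auto
    from linear_compose[OF this smooth_frechet_linear[OF Z]] show ?thesis
      by (simp add: A_def[abs_def] o_def)
  qed
  have CA: "smooth (\<lambda>z. A z w)" for w
    unfolding A_def by (intro smooth_intros Z)
  define A\<phi> where "A\<phi> z = A (fst z, \<phi> z)" for z
  have linA\<phi>: "linear (A\<phi> z)" for z by (simp add: A\<phi>_def linA)
  have Ct: "Ck k (\<lambda>z. (fst z, \<phi> z))"
    by (intro Ck_Pair Ck_linear bounded_linear_fst Suc.IH)
  have CA\<phi>: "Ck k (\<lambda>z. A\<phi> z w)" for w
    using Ck_compose[OF CA[unfolded smooth_def, rule_format] Ct] by (simp add: A\<phi>_def)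
  define sol where "sol x c u \<longleftrightarrow> u 0 = c \<and> (\<forall>t. (u has_vector_derivative A\<phi> (t, x) (u t)) (at t))
      \<and> (\<forall>t. ((\<lambda>h. \<phi> (t, x + h *\<^sub>R c)) has_vector_derivative u t) (at 0))" for x c u
  have "\<exists>u. sol x c u" for x c
  proof -
    define d where "d z = \<phi> (fst z, x + snd z *\<^sub>R c) - \<phi> (fst z, x)" for z :: "real \<times> real"
    \<comment> \<open>The derivative of \<open>Z\<close> averaged over the segment between two
      trajectories. With it the difference quotient solves an exact linear equation, which at
      \<open>h = 0\<close> is the linearised one.\<close>
    define B where "B z w = integral {0..1} (\<lambda>s. A (fst z, \<phi> (fst z, x) + s *\<^sub>R d z) w)" for z :: "real \<times> real" and w
    have c\<phi>x: "continuous_on UNIV (\<lambda>z::real \<times> real. \<phi> (fst z, x))"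
      by (rule continuous_on_compose2[OF cont]) (auto intro!: continuous_intros)
    have cd: "continuous_on UNIV d"
      unfolding d_def
      by (intro continuous_on_diff c\<phi>x continuous_on_compose2[OF cont]) (auto intro!: continuous_intros)
    have cBs: "continuous_on UNIV (\<lambda>y::real \<times> (real \<times> real). A (fst (snd y), \<phi> (fst (snd y), x) + fst y *\<^sub>R d (snd y)) w)" for w
    proof (rule continuous_on_compose2[OF smooth_continuous_on[OF CA, of UNIV]])
      show "continuous_on UNIV (\<lambda>y::real \<times> (real \<times> real). (fst (snd y), \<phi> (fst (snd y), x) + fst y *\<^sub>R d (snd y)))"
        by (intro continuous_intros continuous_on_compose2[OF c\<phi>x] continuous_on_compose2[OF cd]) auto
    qed auto
    have cB: "continuous_on UNIV (\<lambda>z. B z w)" for w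
      using continuous_on_param_integral[OF cBs, of 0 1] by (simp add: B_def)
    have int: "(\<lambda>s. A (fst z, \<phi> (fst z, x) + s *\<^sub>R d z) w) integrable_on {0..1}" for z w
    proof (rule integrable_continuous_interval)
      show "continuous_on {0..1} (\<lambda>s. A (fst z, \<phi> (fst z, x) + s *\<^sub>R d z) w)"
        by (rule continuous_on_compose2[OF smooth_continuous_on[OF CA, of UNIV]]) (auto intro!: continuous_intros)
    qed
    have linB: "linear (B z)" for z
      unfolding B_def
      by (rule linearI)
        (simp_all add: linear_add[OF linA] linear_scale[OF linA] integral_add[OF int int])
    have c1: "continuous_on UNIV (\<lambda>t. B (t, h) w)" for h w
      using continuous_on_compose2[OF cB continuous_on_Pair[OF continuous_on_id continuous_on_const]] by simp
    have "\<exists>Q. \<forall>h. Q h 0 = c \<and> (\<forall>t. (Q h has_vector_derivative B (t, h) (Q h t) + 0) (at t))"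
      by (intro choice allI linear_ode_solution linB c1 continuous_on_const)
    then obtain Q where Q: "\<And>h. Q h 0 = c"
      "\<And>h t. (Q h has_vector_derivative B (t, h) (Q h t) + 0) (at t)" by blast
    have cQ: "continuous_on UNIV (\<lambda>(t, h). Q h t)"
      by (rule linear_ode_continuous[where A=B and b="\<lambda>_. 0" and ?w0.0=c])
        (use Q in \<open>simp_all add: linB cB\<close>)
    have quot: "\<phi> (t, x + h *\<^sub>R c) - \<phi> (t, x) = h *\<^sub>R Q h t" for t h
    proof (rule linear_ode_unique[where A="\<lambda>t. B (t, h)" and b="\<lambda>t. 0"])
      fix t
      have "Z ((t, \<phi> (t, x)) + (0, d (t, h))) - Z (t, \<phi> (t, x))
         = integral {0..1} (\<lambda>s. frechet_derivative Z (at ((t, \<phi> (t, x)) + s *\<^sub>R (0, d (t, h)))) (0, d (t, h)))"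
        by (rule hadamard_integral[OF dZ])
      then have "Z (t, \<phi> (t, x + h *\<^sub>R c)) - Z (t, \<phi> (t, x)) = B (t, h) (d (t, h))"
        by (simp add: B_def A_def) (simp add: d_def)
      then show "((\<lambda>t. \<phi> (t, x + h *\<^sub>R c) - \<phi> (t, x)) has_vector_derivative
          B (t, h) (\<phi> (t, x + h *\<^sub>R c) - \<phi> (t, x)) + 0) (at t)"
        using has_vector_derivative_diff[OF der[of "x + h *\<^sub>R c" t] der[of x t]] by (simp add: d_def)
      show "((\<lambda>t. h *\<^sub>R Q h t) has_vector_derivative B (t, h) (h *\<^sub>R Q h t) + 0) (at t)"
        using has_vector_derivative_scaleR[OF DERIV_const Q(2), of h h t]
        by (simp add: linear_scale[OF linB])
    qed (simp_all add: linB c1 init Q)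
    show ?thesis
      unfolding sol_def
    proof (intro exI[of _ "Q 0"] conjI allI)
      fix t
      have "B (t, 0) w = A\<phi> (t, x) w" for w
        by (simp add: B_def A\<phi>_def d_def)
      then show "(Q 0 has_vector_derivative A\<phi> (t, x) (Q 0 t)) (at t)"
        using Q(2)[of 0 t] by simp
      have "continuous_on UNIV (\<lambda>h. (t, h))" for t :: real by (intro continuous_intros)
      from continuous_on_compose2[OF cQ this] have "continuous_on UNIV (\<lambda>h. Q h t)" by simp
      from continuous_on_UNIV_tendsto[OF this, of 0] show "((\<lambda>h. \<phi> (t, x + h *\<^sub>R c)) has_vector_derivative Q 0 t) (at 0)"
        by (intro has_vector_derivative_quotient[where q="\<lambda>h. Q h t"])
          (simp_all add: quot)
    qed (simp add: Q)
  qed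
  then obtain U where "\<And>x c. sol x c (U x c)" by metis
  then have U: "\<And>x c. U x c 0 = c"
    "\<And>x c t. (U x c has_vector_derivative A\<phi> (t, x) (U x c t)) (at t)"
    "\<And>x c t. ((\<lambda>h. \<phi> (t, x + h *\<^sub>R c)) has_vector_derivative U x c t) (at 0)"
    by (simp_all add: sol_def)
  have CU: "Ck k (\<lambda>z. U (snd z) c (fst z))" for c
    by (rule linear_ode_Ck[OF linA\<phi> CA\<phi> Ck_const, of _ c 0]) (simp_all add: U)
  show ?case
  proof (rule Ck_Suc_partialsI)
    fix e :: "real \<times> 'a" assume e: "e \<in> Basis"
    show "Ck k (if snd e = 0 then (\<lambda>z. Z (fst z, \<phi> z)) else (\<lambda>z. U (snd z) (snd e) (fst z)))"
      using CU Ck_compose[OF Z[unfolded smooth_def, rule_format] Ct] by auto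
    fix z :: "real \<times> 'a"
    obtain t x where z: "z = (t, x)" by (cases z)
    show "((\<lambda>h. \<phi> (z + h *\<^sub>R e)) has_vector_derivative
       (if snd e = 0 then (\<lambda>z. Z (fst z, \<phi> z)) else (\<lambda>z. U (snd z) (snd e) (fst z))) z) (at 0)"
    proof (cases "snd e = 0")
      case True
      then have "e = (1, 0)" using e by (auto simp: Basis_prod_def)
      then show ?thesis
        using has_vector_derivative_shift[of "\<lambda>t. \<phi> (t, x)" _ t 0] der[of x t] by (simp add: z)
    next
      case False
      then have "fst e = 0" using e by (auto simp: Basis_prod_def)
      then have "z + h *\<^sub>R e = (t, x + h *\<^sub>R snd e)" for h by (simp add: z prod_eq_iff)
      then show ?thesis using False U(3)[where c="snd e" and x=x and t=t] by (simp add: z)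
    qed
  qed
qed

subsection \<open>Flows that preserve a seminorm\<close>

text \<open>The field depends on the position only through the orthogonal projection \<^term>\<open>P\<close> and is orthogonal to
  it, so \<^term>\<open>norm (P x)\<close> is constant along solutions and no solution escapes in finite time.\<close>

locale seminorm_preserving =
  fixes P :: "'a::euclidean_space \<Rightarrow> 'a"
  assumes linP: "linear P" and idemP: "\<And>u. P (P u) = P u" and symP: "\<And>u v. P u \<bullet> v = u \<bullet> P v"
begin

lemma norm_P_le: "norm (P u) \<le> norm u"
proof -
  have "(norm (P u))\<^sup>2 = u \<bullet> P u" by (simp add: power2_norm_eq_inner symP idemP)
  also have "\<dots> \<le> norm u * norm (P u)" by (rule norm_cauchy_schwarz)
  finally have "norm (P u) * norm (P u) \<le> norm u * norm (P u)" by (simp add: power2_eq_square)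
  then show ?thesis by (cases "norm (P u) = 0") auto
qed

text \<open>The nearest point projection moves \<open>q\<close> only along its ray, so truncating a
  field with it preserves orthogonality to the position.\<close>

lemma closest_point_cball:
  fixes q :: 'a
  assumes "0 < R"
  shows "\<exists>c>0. closest_point (cball 0 R) q = c *\<^sub>R q"
proof (cases "norm q \<le> R")
  case True
  then show ?thesis by (intro exI[of _ 1]) (simp add: closest_point_self)
next
  case False
  then have q: "norm q > 0" using assms by linarith
  have "closest_point (cball 0 R) q = (R / norm q) *\<^sub>R q"
  proof (rule closest_point_unique[symmetric])
    show "\<forall>z\<in>cball 0 R. dist q ((R / norm q) *\<^sub>R q) \<le> dist q z"
    proof
      fix z :: 'a assume "z \<in> cball 0 R"
      then have z: "norm z \<le> R" by simp
      have "q - (R / norm q) *\<^sub>R q = (1 - R / norm q) *\<^sub>R q" by (simp add: algebra_simps)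
      then have "dist q ((R / norm q) *\<^sub>R q) = \<bar>1 - R / norm q\<bar> * norm q" by (simp add: dist_norm)
      also have "\<dots> = norm q - R" using q False by (simp add: field_simps)
      also have "\<dots> \<le> dist q z" using z norm_triangle_ineq2[of q z] by (simp add: dist_norm)
      finally show "dist q ((R / norm q) *\<^sub>R q) \<le> dist q z" .
    qed
  qed (use q assms in \<open>auto simp: closed_cball\<close>)
  then show ?thesis using q assms by (intro exI[of _ "R / norm q"]) simp
qed

lemma norm_P_const:
  assumes "\<And>t. (y has_vector_derivative d t) (at t)" "\<And>t. P (y t) \<bullet> d t = 0"
  shows "norm (P (y t)) = norm (P (y s))"
proof -
  have "((\<lambda>t. P (y t) \<bullet> P (y t)) has_derivative (\<lambda>h. 0)) (at t within UNIV)" for t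
  proof -
    have "((\<lambda>t. P (y t)) has_derivative (\<lambda>h. h *\<^sub>R P (d t))) (at t)"
      using bounded_linear.has_vector_derivative[OF linear_conv_bounded_linear[THEN iffD1, OF linP] assms(1)]
      by (simp add: has_vector_derivative_def)
    from has_derivative_inner[OF this this] show ?thesis
      using assms(2)[of t] symP[of "y t" "P (d t)"] symP[of "y t" "d t"] by (simp add: idemP inner_commute)
  qed
  then have "(\<lambda>t. P (y t) \<bullet> P (y t)) t = (\<lambda>t. P (y t) \<bullet> P (y t)) s"
    by (intro has_derivative_zero_unique[of UNIV]) auto
  then show ?thesis by (simp add: norm_eq_sqrt_inner)
qed

end

locale seminorm_preserving_field = seminorm_preserving P for P :: "'a::euclidean_space \<Rightarrow> 'a" +
  fixes Z :: "real \<times> 'a \<Rightarrow> 'a"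
  assumes smoothZ: "smooth Z" and ZP: "\<And>t p. Z (t, P p) = Z (t, p)"
    and orth: "\<And>t p. P p \<bullet> Z (t, p) = 0"
    and lipZ: "\<And>R. \<exists>L\<ge>0. \<forall>t p q. norm p \<le> R \<longrightarrow> norm q \<le> R \<longrightarrow> norm (Z (t, p) - Z (t, q)) \<le> L * norm (p - q)"
begin

text \<open>Composing the field with the nearest point projection onto a ball makes it globally
  Lipschitz. The truncated solution keeps \<open>norm (P (y t))\<close> constant, hence stays where
  the truncation is the identity and solves the original equation.\<close>

lemma solution_exists:
  "\<exists>y. y 0 = x \<and> (\<forall>t. (y has_vector_derivative Z (t, y t)) (at t))"
proof -
  \<comment> \<open>Adding 1 keeps the radius positive when \<open>P x = 0\<close>.\<close>
  define R where "R = norm (P x) + 1"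
  have R: "R > 0" by (simp add: R_def add_nonneg_pos)
  define \<tau> where "\<tau> = closest_point (cball (0::'a) R)"
  have lip\<tau>: "norm (\<tau> p - \<tau> q) \<le> norm (p - q)" for p q
    using closest_point_lipschitz[of "cball 0 R" p q] R by (simp add: \<tau>_def dist_norm)
  have n\<tau>: "norm (\<tau> p) \<le> R" for p
    using closest_point_in_set[of "cball 0 R" p] R by (auto simp: \<tau>_def)
  obtain L where L: "0 \<le> L" "\<And>t p q. norm p \<le> R \<Longrightarrow> norm q \<le> R \<Longrightarrow> norm (Z (t, p) - Z (t, q)) \<le> L * norm (p - q)"
    using lipZ[of R] by blast
  have "\<exists>y. y 0 = x \<and> (\<forall>t. (y has_vector_derivative Z (t, \<tau> (P (y t)))) (at t))"
  proof (rule ode_global_solution[where L="\<lambda>t. L"])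
    have "continuous_on UNIV \<tau>"
      unfolding \<tau>_def by (rule continuous_on_closest_point) (use R in auto)
    moreover have "continuous_on UNIV (\<lambda>z::real \<times> 'a. P (snd z))"
      by (rule smooth_continuous_on[OF smooth_linear_compose[OF _ smooth_snd[OF smooth_ident]]])
        (simp add: linear_conv_bounded_linear[symmetric] linP)
    ultimately have "continuous_on UNIV (\<lambda>z::real \<times> 'a. \<tau> (P (snd z)))"
      by (rule continuous_on_compose2) simp
    then have "continuous_on UNIV (\<lambda>z::real \<times> 'a. (fst z, \<tau> (P (snd z))))"
      by (intro continuous_on_Pair continuous_on_fst continuous_on_id)
    from continuous_on_compose2[OF smooth_continuous_on[OF smoothZ, of UNIV] this]
    show "continuous_on UNIV (\<lambda>(t, y). Z (t, \<tau> (P y)))" by (simp add: split_beta)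
    show "norm (Z (t, \<tau> (P y)) - Z (t, \<tau> (P z))) \<le> L * norm (y - z)" for t y z
    proof -
      have "norm (Z (t, \<tau> (P y)) - Z (t, \<tau> (P z))) \<le> L * norm (\<tau> (P y) - \<tau> (P z))"
        by (rule L(2)[OF n\<tau> n\<tau>])
      also have "\<dots> \<le> L * norm (y - z)"
        using order_trans[OF lip\<tau> norm_P_le[of "y - z", unfolded linear_diff[OF linP]]] L(1)
        by (rule mult_left_mono)
      finally show ?thesis .
    qed
  qed auto
  then obtain y where y: "y 0 = x" "\<And>t. (y has_vector_derivative Z (t, \<tau> (P (y t)))) (at t)" by blast
  have "P (y t) \<bullet> Z (t, \<tau> (P (y t))) = 0" for t
  proof -
    obtain c where c: "c > 0" "\<tau> (P (y t)) = c *\<^sub>R P (y t)"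
      using closest_point_cball[OF R] unfolding \<tau>_def by blast
    have "P (c *\<^sub>R P (y t)) \<bullet> Z (t, c *\<^sub>R P (y t)) = 0" by (rule orth)
    then show ?thesis using c by (simp add: linear_scale[OF linP] idemP)
  qed
  from norm_P_const[OF y(2) this] have "norm (P (y t)) = norm (P x)" for t
    using y(1) by metis
  then have "\<tau> (P (y t)) = P (y t)" for t
    unfolding \<tau>_def by (intro closest_point_self) (simp add: R_def)
  then show ?thesis using y ZP by auto
qed

lemma solution_unique:
  assumes "\<And>t. (y has_vector_derivative Z (t, y t)) (at t)"
    and "\<And>t. (z has_vector_derivative Z (t, z t)) (at t)" "y 0 = z 0"
  shows "y t = z t"
proof -
  define R where "R = norm (P (y 0))"
  have nP: "norm (P (y t)) = R" "norm (P (z t)) = R" for t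
    using norm_P_const[OF assms(1) orth] norm_P_const[OF assms(2) orth] assms(3) unfolding R_def by metis+
  obtain L where L: "0 \<le> L" "\<And>t p q. norm p \<le> R \<Longrightarrow> norm q \<le> R \<Longrightarrow> norm (Z (t, p) - Z (t, q)) \<le> L * norm (p - q)"
    using lipZ[of R] by blast
  have "(\<lambda>t. y t - z t) t = 0"
  proof (rule ode_zero_unique[where L="\<lambda>t. L"])
    show "((\<lambda>t. y t - z t) has_vector_derivative Z (s, y s) - Z (s, z s)) (at s)" for s
      by (intro has_vector_derivative_diff assms)
    show "norm (Z (s, y s) - Z (s, z s)) \<le> L * norm (y s - z s)" for s
    proof -
      have "norm (Z (s, P (y s)) - Z (s, P (z s))) \<le> L * norm (P (y s) - P (z s))"
        by (rule L(2)) (simp_all add: nP)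
      also have "\<dots> \<le> L * norm (y s - z s)"
        using norm_P_le[of "y s - z s"] L(1) by (auto simp: linear_diff[OF linP] intro: mult_left_mono)
      finally show ?thesis by (simp add: ZP)
    qed
  qed (simp_all add: assms)
  then show ?thesis by simp
qed

lemma flow_exists:
  obtains \<phi> where "smooth \<phi>" "\<And>x. \<phi> (0, x) = x"
    "\<And>t x. ((\<lambda>t. \<phi> (t, x)) has_vector_derivative Z (t, \<phi> (t, x))) (at t)"
proof -
  have "\<exists>y. \<forall>x. y x 0 = x \<and> (\<forall>t. (y x has_vector_derivative Z (t, y x t)) (at t))"
    by (intro choice allI solution_exists)
  then obtain y where y: "\<And>x. y x 0 = x" "\<And>x t. (y x has_vector_derivative Z (t, y x t)) (at t)"
    by blast
  define \<phi> where "\<phi> z = y (snd z) (fst z)" for z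
  have \<phi>: "\<phi> (0, x) = x" "((\<lambda>t. \<phi> (t, x)) has_vector_derivative Z (t, \<phi> (t, x))) (at t)" for x t
    using y by (simp_all add: \<phi>_def)
  have nP: "norm (P (\<phi> (t, x))) = norm (P x)" for t x
    using norm_P_const[of "\<lambda>t. \<phi> (t, x)" "\<lambda>t. Z (t, \<phi> (t, x))" t 0, OF \<phi>(2) orth] by (simp add: \<phi>(1))
  have "continuous_on UNIV \<phi>"
  proof (rule continuous_flow[OF \<phi>])
    fix R
    obtain L where L: "0 \<le> L" "\<And>t p q. norm p \<le> R \<Longrightarrow> norm q \<le> R \<Longrightarrow> norm (Z (t, p) - Z (t, q)) \<le> L * norm (p - q)"
      using lipZ[of R] by blast
    have "norm (Z (t, \<phi> (t, x)) - Z (t, \<phi> (t, y))) \<le> L * norm (\<phi> (t, x) - \<phi> (t, y))"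
      if "norm x \<le> R" "norm y \<le> R" for t x y
    proof -
      have "norm (Z (t, P (\<phi> (t, x))) - Z (t, P (\<phi> (t, y)))) \<le> L * norm (P (\<phi> (t, x)) - P (\<phi> (t, y)))"
        by (rule L(2)) (use that norm_P_le order_trans in \<open>auto simp: nP\<close>)
      also have "\<dots> \<le> L * norm (\<phi> (t, x) - \<phi> (t, y))"
        using norm_P_le[of "\<phi> (t, x) - \<phi> (t, y)"] L(1) by (auto simp: linear_diff[OF linP] intro: mult_left_mono)
      finally show ?thesis by (simp add: ZP)
    qed
    with L(1) show "\<exists>L\<ge>0. \<forall>t x y. norm x \<le> R \<longrightarrow> norm y \<le> R \<longrightarrow>
        norm (Z (t, \<phi> (t, x)) - Z (t, \<phi> (t, y))) \<le> L * norm (\<phi> (t, x) - \<phi> (t, y))" by blast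
  qed
  then have "smooth \<phi>"
    unfolding smooth_def using Ck_flow[OF smoothZ _ \<phi>] by blast
  then show thesis using that \<phi> by blast
qed

text \<open>Running time backwards from 1 to 0 stays within the same class of fields, so the inverse
  of the time-one map is also the end of a smooth flow.\<close>

lemma reversed_field: "seminorm_preserving_field P (\<lambda>z. - Z (1 - fst z, snd z))"
proof
  show "smooth (\<lambda>z. - Z (1 - fst z, snd z))"
    by (intro smooth_minus smooth_compose[OF smoothZ] smooth_intros)
  fix R
  obtain L where L: "0 \<le> L" "\<And>t p q. norm p \<le> R \<Longrightarrow> norm q \<le> R \<Longrightarrow> norm (Z (t, p) - Z (t, q)) \<le> L * norm (p - q)"
    using lipZ[of R] by blast
  then show "\<exists>L\<ge>0. \<forall>t p q. norm p \<le> R \<longrightarrow> norm q \<le> R \<longrightarrow>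
      norm (- Z (1 - fst (t, p), snd (t, p)) - - Z (1 - fst (t, q), snd (t, q))) \<le> L * norm (p - q)"
    by (intro exI[of _ L]) (simp add: norm_minus_commute)
qed (simp_all add: ZP orth)

lemma reversed_solution:
  assumes "\<And>t. (y has_vector_derivative Z (t, y t)) (at t)"
  shows "((\<lambda>t. y (1 - t)) has_vector_derivative - Z (1 - t, y (1 - t))) (at t)"
proof -
  have "((\<lambda>t. 1 - t) has_vector_derivative (- 1 :: real)) (at t)"
    unfolding has_real_derivative_iff_has_vector_derivative[symmetric]
    by (auto intro!: derivative_eq_intros)
  from vector_diff_chain_at[OF this assms] show ?thesis by (simp add: o_def)
qed

lemma time_one_diffeomorphism:
  assumes "smooth \<phi>" "\<And>x. \<phi> (0, x) = x"
    "\<And>t x. ((\<lambda>t. \<phi> (t, x)) has_vector_derivative Z (t, \<phi> (t, x))) (at t)"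
  obtains \<psi> where "smooth \<psi>" "\<And>x. \<psi> (\<phi> (1, x)) = x" "\<And>x. \<phi> (1, \<psi> x) = x"
proof -
  interpret rev: seminorm_preserving_field P "\<lambda>z. - Z (1 - fst z, snd z)" by (rule reversed_field)
  obtain \<theta> where \<theta>: "smooth \<theta>" "\<And>x. \<theta> (0, x) = x"
    "\<And>t x. ((\<lambda>t. \<theta> (t, x)) has_vector_derivative - Z (1 - t, \<theta> (t, x))) (at t)"
    using rev.flow_exists by auto
  have 1: "\<theta> (1, \<phi> (1, x)) = x" for x
    using rev.solution_unique[of "\<lambda>t. \<theta> (t, \<phi> (1, x))" "\<lambda>t. \<phi> (1 - t, x)" 1]
      \<theta> reversed_solution[OF assms(3)] by (simp add: assms)
  have 2: "\<phi> (1, \<theta> (1, x)) = x" for x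
    using solution_unique[of "\<lambda>t. \<phi> (t, \<theta> (1, x))" "\<lambda>t. \<theta> (1 - t, x)" 1]
      rev.reversed_solution[of "\<lambda>t. \<theta> (t, x)"] assms \<theta> by simp
  have "smooth (\<lambda>x. \<theta> (1, x))"
    by (intro smooth_compose[OF \<theta>(1)] smooth_intros)
  then show thesis using that[of "\<lambda>x. \<theta> (1, x)"] 1 2 by simp
qed

end

text \<open>One period and a ball form a compact set, on which the derivative is bounded; the ball
  is convex, so this bound is a Lipschitz constant. Any other time is reduced to that
  period.\<close>

lemma smooth_lipschitz_periodic:
  fixes Z :: "real \<times> 'a::euclidean_space \<Rightarrow> 'b::real_normed_vector"
  assumes "smooth Z" and per: "\<And>t p. Z (t + 2, p) = Z (t, p)"
  shows "\<exists>L\<ge>0. \<forall>t p q. norm p \<le> R \<longrightarrow> norm q \<le> R \<longrightarrow> norm (Z (t, p) - Z (t, q)) \<le> L * norm (p - q)"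
proof -
  define K where "K z = (\<Sum>b\<in>Basis. norm (frechet_derivative Z (at z) (0, b :: 'a)))" for z
  have "continuous_on UNIV K"
    unfolding K_def
    by (intro continuous_on_sum continuous_on_norm smooth_continuous_on smooth_intros assms(1))
  then have "bounded (K ` ({0..2} \<times> cball 0 R))"
    by (intro compact_imp_bounded compact_continuous_image compact_Times) (auto intro: continuous_on_subset)
  then obtain L0 where "\<forall>z\<in>{0..2} \<times> cball 0 R. \<bar>K z\<bar> \<le> L0"
    by (auto simp: bounded_iff)
  then have L0: "\<bar>K (t, p)\<bar> \<le> L0" if "t \<in> {0..2}" "norm p \<le> R" for t p
    using that by simp
  define L where "L = max 0 L0"
  have KL: "K (t, p) \<le> L" if "t \<in> {0..2}" "norm p \<le> R" for t p
    using L0[OF that] by (simp add: L_def)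
  have base: "norm (Z (t, p) - Z (t, q)) \<le> L * norm (p - q)"
    if t: "t \<in> {0..2}" and "norm p \<le> R" "norm q \<le> R" for t p q
  proof (rule differentiable_bound[where S="cball 0 R" and f="\<lambda>p. Z (t, p)"
        and f'="\<lambda>p w. frechet_derivative Z (at (t, p)) (0, w)"])
    fix p :: 'a assume p: "p \<in> cball 0 R"
    have 1: "((\<lambda>p. (t, p)) has_derivative (\<lambda>w. (0, w))) (at p within cball 0 R)"
      by (auto intro!: derivative_eq_intros)
    from has_derivative_compose[OF 1 smooth_has_derivative[OF assms(1)]]
    show d: "((\<lambda>p. Z (t, p)) has_derivative (\<lambda>w. frechet_derivative Z (at (t, p)) (0, w))) (at p within cball 0 R)" .
    have "norm (frechet_derivative Z (at (t, p)) (0, w)) \<le> L * norm w" for w :: 'a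
      using norm_linear_le[OF has_derivative_linear[OF d], of w]
        mult_right_mono[OF KL[OF t, of p], of "norm w"] p by (simp add: K_def)
    then show "onorm (\<lambda>w. frechet_derivative Z (at (t, p)) (0, w)) \<le> L"
      by (intro onorm_bound) (simp_all add: L_def)
  qed (use that in auto)
  have pern: "Z (t + 2 * real n, p) = Z (t, p)" for t p and n :: nat
  proof (induction n)
    case (Suc n)
    have "t + 2 * real (Suc n) = (t + 2 * real n) + 2" by simp
    then have "Z (t + 2 * real (Suc n), p) = Z (t + 2 * real n, p)" using per by metis
    then show ?case using Suc by simp
  qed simp
  have red: "\<exists>t'\<in>{0..2}. \<forall>p. Z (t, p) = Z (t', p)" for t
  proof -
    define n where "n = \<lfloor>t / 2\<rfloor>"
    define t' where "t' = t - 2 * real_of_int n"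
    have "t' \<in> {0..2}" unfolding t'_def n_def atLeastAtMost_iff
      using of_int_floor_le[of "t / 2"] real_of_int_floor_add_one_ge[of "t / 2"] by linarith
    moreover have "Z (t, p) = Z (t', p)" for p
    proof (cases "0 \<le> n")
      case True
      then show ?thesis using pern[of t' "nat n" p] by (simp add: t'_def)
    next
      case False
      then show ?thesis using pern[of t "nat (- n)" p] by (simp add: t'_def)
    qed
    ultimately show ?thesis by blast
  qed
  have "norm (Z (t, p) - Z (t, q)) \<le> L * norm (p - q)" if "norm p \<le> R" "norm q \<le> R" for t p q
    using red[of t] base[OF _ that] by auto
  moreover have "0 \<le> L" by (simp add: L_def)
  ultimately show ?thesis by blast
qed

text \<open>A smooth time scale running from 0 to 1 and back; it makes the fields below periodic in time,
  hence uniformly Lipschitz on bounded sets.\<close>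

definition pulse :: "real \<Rightarrow> real" where "pulse t = (1 - cos (pi * t)) / 2"

definition pulse' :: "real \<Rightarrow> real" where "pulse' t = pi * sin (pi * t) / 2"

lemma pulse_simps [simp]: "pulse 0 = 0" "pulse 1 = 1" "pulse (t + 2) = pulse t" "pulse' (t + 2) = pulse' t"
  using cos_periodic[of "pi * t"] sin_periodic[of "pi * t"]
  by (simp_all add: pulse_def pulse'_def ring_distribs mult.commute)

lemma pulse_bounds: "0 \<le> pulse t" "pulse t \<le> 1"
  using cos_le_one[of "pi * t"] cos_ge_minus_one[of "pi * t"] by (simp_all add: pulse_def)

lemma DERIV_pulse: "(pulse has_real_derivative pulse' t) (at t)"
  unfolding pulse_def[abs_def] pulse'_def by (auto intro!: derivative_eq_intros)

lemma smooth_pulse: "smooth f \<Longrightarrow> smooth (\<lambda>x. pulse (f x))" "smooth f \<Longrightarrow> smooth (\<lambda>x. pulse' (f x))"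
  unfolding pulse_def pulse'_def
  by (intro smooth_divide smooth_intros | simp)+

section \<open>Contact maps\<close>

definition contact_map :: "(real^3 \<Rightarrow> real^3) \<Rightarrow> (real^3 \<Rightarrow> real^3) \<Rightarrow> (real^3 \<Rightarrow> real^3) \<Rightarrow> bool" where
  "contact_map \<phi> a b \<longleftrightarrow> diffeomorphism \<phi> \<and>
    (\<exists>\<mu>. \<forall>p. \<mu> p \<noteq> 0 \<and> (\<forall>w. a (\<phi> p) \<bullet> frechet_derivative \<phi> (at p) w = \<mu> p * (b p \<bullet> w)))"

lemma frechet_derivative_chain:
  fixes g :: "'a::real_normed_vector \<Rightarrow> 'b::real_normed_vector"
  assumes "smooth f" "smooth g"
  shows "frechet_derivative (\<lambda>x. f (g x)) (at p) w = frechet_derivative f (at (g p)) (frechet_derivative g (at p) w)"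
  using frechet_derivative_at[OF has_derivative_compose[OF smooth_has_derivative[OF assms(2)] smooth_has_derivative[OF assms(1)]]]
  by metis

lemma contact_map_compose:
  assumes "contact_map \<phi> a b" "contact_map \<psi> b c"
  shows "contact_map (\<lambda>x. \<phi> (\<psi> x)) a c"
proof -
  obtain \<mu> \<phi>' where 1: "smooth \<phi>" "smooth \<phi>'" "\<And>x. \<phi>' (\<phi> x) = x" "\<And>x. \<phi> (\<phi>' x) = x"
    "\<And>p. \<mu> p \<noteq> 0" "\<And>p w. a (\<phi> p) \<bullet> frechet_derivative \<phi> (at p) w = \<mu> p * (b p \<bullet> w)"
    using assms(1) unfolding contact_map_def diffeomorphism_def by blast
  obtain \<nu> \<psi>' where 2: "smooth \<psi>" "smooth \<psi>'" "\<And>x. \<psi>' (\<psi> x) = x" "\<And>x. \<psi> (\<psi>' x) = x"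
    "\<And>p. \<nu> p \<noteq> 0" "\<And>p w. b (\<psi> p) \<bullet> frechet_derivative \<psi> (at p) w = \<nu> p * (c p \<bullet> w)"
    using assms(2) unfolding contact_map_def diffeomorphism_def by blast
  show ?thesis unfolding contact_map_def diffeomorphism_def
  proof (intro conjI exI[of _ "\<lambda>x. \<psi>' (\<phi>' x)"] exI[of _ "\<lambda>p. \<mu> (\<psi> p) * \<nu> p"] allI)
    show "smooth (\<lambda>x. \<phi> (\<psi> x))" "smooth (\<lambda>x. \<psi>' (\<phi>' x))"
      by (rule smooth_compose[OF 1(1) 2(1)], rule smooth_compose[OF 2(2) 1(2)])
    show "\<mu> (\<psi> p) * \<nu> p \<noteq> 0" for p using 1(5) 2(5) by simp
    show "\<psi>' (\<phi>' (\<phi> (\<psi> p))) = p" "\<phi> (\<psi> (\<psi>' (\<phi>' p))) = p" for p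
      by (simp_all only: 1 2)
    show "a (\<phi> (\<psi> p)) \<bullet> frechet_derivative (\<lambda>x. \<phi> (\<psi> x)) (at p) w = \<mu> (\<psi> p) * \<nu> p * (c p \<bullet> w)" for p w
      unfolding frechet_derivative_chain[OF 1(1) 2(1)] 1(6) 2(6) by (rule mult.assoc[symmetric])
  qed
qed

lemma contact_map_inverse:
  assumes "contact_map \<phi> a b"
  shows "\<exists>\<psi>. contact_map \<psi> b a"
proof -
  obtain \<mu> \<psi> where 1: "smooth \<phi>" "smooth \<psi>" "\<And>x. \<psi> (\<phi> x) = x" "\<And>x. \<phi> (\<psi> x) = x"
    "\<And>p. \<mu> p \<noteq> 0" "\<And>p w. a (\<phi> p) \<bullet> frechet_derivative \<phi> (at p) w = \<mu> p * (b p \<bullet> w)"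
    using assms unfolding contact_map_def diffeomorphism_def by blast
  have inv: "frechet_derivative \<phi> (at (\<psi> p)) (frechet_derivative \<psi> (at p) w) = w" for p w
    using frechet_derivative_chain[OF 1(1,2), of p w] by (simp add: 1(4))
  have "contact_map \<psi> b a" unfolding contact_map_def diffeomorphism_def
  proof (intro conjI exI[of _ \<phi>] exI[of _ "\<lambda>p. 1 / \<mu> (\<psi> p)"] allI)
    show "b (\<psi> p) \<bullet> frechet_derivative \<psi> (at p) w = 1 / \<mu> (\<psi> p) * (a p \<bullet> w)" for p w
      using 1(6)[of "\<psi> p" "frechet_derivative \<psi> (at p) w"] 1(5)[of "\<psi> p"] by (simp add: inv 1(4))
  qed (simp_all add: 1)
  then show ?thesis by blast
qed

section \<open>Line fibrations\<close>

locale contact_line_fibration =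
  fixes V :: "real^3 \<Rightarrow> real^3"
  assumes smooth_V: "smooth V" and norm_V: "\<And>p. norm (V p) = 1"
    and fibration: "defines_line_fibration V" and contact: "contact_form V"
begin

abbreviation DV where "DV p w \<equiv> frechet_derivative V (at p) w"

lemma VV [simp]: "V p \<bullet> V p = 1"
  using norm_V[of p] by (simp add: norm_eq_1)

lemma linear_DV: "linear (frechet_derivative V (at p))"
  by (rule smooth_frechet_linear[OF smooth_V])

text \<open>Coinciding lines have parallel directions, and unit length leaves only a sign. The sign
  is continuous along the line, so it cannot jump from the value 1 that it has at
  \<open>p\<close>.\<close>

lemma V_const_on_line: "V (p + t *\<^sub>R V p) = V p"
proof -
  define c where "c t = V (p + t *\<^sub>R V p) \<bullet> V p" for t
  have par: "V (p + t *\<^sub>R V p) = c t *\<^sub>R V p" "\<bar>c t\<bar> = 1" for t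
  proof -
    define q where "q = p + t *\<^sub>R V p"
    have "q \<in> fibre_line V p" by (auto simp: q_def fibre_line_def)
    then have "fibre_line V q = fibre_line V p" using fibration by (auto simp: defines_line_fibration_def)
    moreover have "q + 1 *\<^sub>R V q \<in> fibre_line V q" unfolding fibre_line_def by blast
    ultimately obtain s where "q + V q = p + s *\<^sub>R V p" by (auto simp: fibre_line_def)
    then have "V q = (s - t) *\<^sub>R V p" by (simp add: q_def algebra_simps)
    moreover from this have "c t = s - t" by (simp add: c_def q_def[symmetric])
    ultimately show "V (p + t *\<^sub>R V p) = c t *\<^sub>R V p" by (simp add: q_def)
    then have "norm (V q) = \<bar>c t\<bar> * norm (V p)" by (simp add: q_def)
    then show "\<bar>c t\<bar> = 1" by (simp add: norm_V)
  qed
  have "continuous_on UNIV c"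
    unfolding c_def by (intro smooth_continuous_on smooth_intros smooth_compose[OF smooth_V])
  then have "connected (c ` UNIV)" by (intro connected_continuous_image) auto
  then have conn: "x \<in> c ` UNIV" if "a \<in> c ` UNIV" "b \<in> c ` UNIV" "a \<le> x" "x \<le> b" for a b x
    using that unfolding connected_iff_interval by blast
  have "c t \<noteq> -1"
  proof
    assume "c t = -1"
    moreover have "c 0 = 1" by (simp add: c_def)
    ultimately have "0 \<in> c ` UNIV" using conn[of "-1" 1 0] by (metis rangeI neg_le_0_iff_le zero_le_one)
    then obtain s where "c s = 0" by auto
    then show False using par(2)[of s] by simp
  qed
  then have "c t = 1" using par(2)[of t] by linarith
  then show ?thesis using par(1)[of t] by simp
qed

lemma DV_V: "DV p (V p) = 0"
proof -
  have "((\<lambda>t. V (p + t *\<^sub>R V p)) has_vector_derivative DV p (V p)) (at 0)"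
    using has_vector_derivative_along[where s=0 and x=p, of V] smooth_has_derivative[OF smooth_V] by simp
  moreover have "((\<lambda>t. V (p + t *\<^sub>R V p)) has_vector_derivative 0) (at 0)"
    by (simp add: V_const_on_line)
  ultimately show ?thesis by (rule vector_derivative_unique_at)
qed

lemma V_DV: "V p \<bullet> DV p w = 0"
proof -
  have "((\<lambda>p. V p \<bullet> V p) has_derivative (\<lambda>w. V p \<bullet> DV p w + DV p w \<bullet> V p)) (at p)"
    by (intro has_derivative_inner smooth_has_derivative smooth_V)
  moreover have "((\<lambda>p. V p \<bullet> V p) has_derivative (\<lambda>w. 0)) (at p)" by simp
  ultimately have "(\<lambda>w. V p \<bullet> DV p w + DV p w \<bullet> V p) = (\<lambda>w. 0)" by (rule has_derivative_unique)
  then have "V p \<bullet> DV p w + DV p w \<bullet> V p = 0" by metis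
  then show ?thesis by (simp add: inner_commute)
qed

text \<open>Cyclic invariance of the triple product makes \<open>cross3 c v\<close> orthogonal to
  everything; the double product expansion then recovers \<open>c\<close>.\<close>

lemma parallel_to_unit:
  fixes c v :: "real^3"
  assumes "\<And>u. c \<bullet> cross3 v u = 0" "v \<bullet> v = 1"
  shows "c = (v \<bullet> c) *\<^sub>R v"
proof -
  have "cross3 c v = 0"
    using assms(1) cross_triple[of c v] by (metis inner_commute inner_eq_zero_iff)
  then have "cross3 v (cross3 c v) = 0" by simp
  then show ?thesis using assms(2) by (simp add: Lagrange inner_commute)
qed

text \<open>The curl of \<^term>\<open>V\<close> is parallel to \<^term>\<open>V\<close>: this says that \<^term>\<open>V\<close> is the Reeb field of its dual form.\<close>

lemma exterior_derivative_V:
  "DV p w \<bullet> u - DV p u \<bullet> w = wedge_d_coeff V p * (V p \<bullet> cross3 w u)"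
proof -
  define c where "c = (vector [pd V 2 3 p - pd V 3 2 p, pd V 3 1 p - pd V 1 3 p, pd V 1 2 p - pd V 2 1 p] :: real^3)"
  have comp: "DV p w $ j = w$1 * pd V 1 j p + w$2 * pd V 2 j p + w$3 * pd V 3 j p" for w j
  proof -
    have "w = w$1 *\<^sub>R axis 1 1 + w$2 *\<^sub>R axis 2 1 + w$3 *\<^sub>R axis 3 1"
      by (simp add: vec_eq_iff forall_3 axis_def)
    then have "DV p w = DV p (w$1 *\<^sub>R axis 1 1 + w$2 *\<^sub>R axis 2 1 + w$3 *\<^sub>R axis 3 1)"
      by (rule arg_cong)
    also have "\<dots> = w$1 *\<^sub>R DV p (axis 1 1) + w$2 *\<^sub>R DV p (axis 2 1) + w$3 *\<^sub>R DV p (axis 3 1)"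
      by (simp only: linear_add[OF linear_DV] linear_scale[OF linear_DV])
    finally show ?thesis by (simp only: pd_def vector_add_component vector_scaleR_component real_scaleR_def)
  qed
  have curl: "DV p w \<bullet> u - DV p u \<bullet> w = c \<bullet> cross3 w u" for w u
    unfolding inner_vec_def sum_3 comp c_def cross_components
    by (simp add: algebra_simps)
  \<comment> \<open>The derivative of \<open>V\<close> along its own line is zero, and derivatives
    of a unit field are orthogonal to it, so both terms of the exterior derivative vanish when one
    argument is \<open>V p\<close>.\<close>
  have "c \<bullet> cross3 (V p) u = 0" for u
    using curl[of "V p" u] V_DV[of p u] by (simp add: DV_V inner_commute)
  from parallel_to_unit[OF this VV] have c: "c = (V p \<bullet> c) *\<^sub>R V p" .
  have "V p \<bullet> c = wedge_d_coeff V p"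
    by (simp add: wedge_d_coeff_def c_def inner_vec_def sum_3)
  then have "c \<bullet> cross3 w u = (wedge_d_coeff V p *\<^sub>R V p) \<bullet> cross3 w u" by (subst c) (rule arg_cong)
  then show ?thesis unfolding curl inner_scaleR_left .
qed

end

section \<open>Derivatives along curves, translation-invariant functions, and linear algebra in
  R^3\<close>

lemma has_vector_derivative_smooth_compose:
  assumes "smooth f" "(c has_vector_derivative c') (at t)"
  shows "((\<lambda>t. f (c t)) has_vector_derivative frechet_derivative f (at (c t)) c') (at t)"
proof -
  from has_derivative_compose[OF assms(2)[unfolded has_vector_derivative_def] smooth_has_derivative[OF assms(1)]]
  show ?thesis
    by (simp add: has_vector_derivative_def linear_scale[OF smooth_frechet_linear[OF assms(1)]])
qed

lemmas has_vector_derivative_inner = bounded_bilinear.has_vector_derivative[OF bounded_bilinear_inner]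

lemma frechet_derivative_translate:
  fixes f :: "'a::real_normed_vector \<Rightarrow> 'b::real_normed_vector"
  assumes "smooth f" "\<And>q. f (q + a) = f q"
  shows "frechet_derivative f (at (q + a)) = frechet_derivative f (at q)"
proof -
  have "((\<lambda>q. q + a) has_derivative (\<lambda>w. w)) (at q)" by (auto intro!: derivative_eq_intros)
  from has_derivative_compose[OF this smooth_has_derivative[OF assms(1)]]
  have "(f has_derivative frechet_derivative f (at (q + a))) (at q)" by (simp add: assms(2))
  then show ?thesis by (rule frechet_derivative_at)
qed

lemma frechet_derivative_zero_along:
  fixes f :: "'a::real_normed_vector \<Rightarrow> 'b::real_normed_vector"
  assumes "smooth f" "\<And>q t. f (q + t *\<^sub>R v) = f q"
  shows "frechet_derivative f (at q) v = 0"
proof -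
  have "((\<lambda>t. f (q + t *\<^sub>R v)) has_vector_derivative frechet_derivative f (at (q + 0 *\<^sub>R v)) v) (at 0)"
    by (rule has_vector_derivative_along[OF smooth_has_derivative[OF assms(1)]])
  moreover have "((\<lambda>t. f (q + t *\<^sub>R v)) has_vector_derivative 0) (at 0)" by (simp add: assms(2))
  ultimately show ?thesis by (metis vector_derivative_unique_at scale_zero_left add.right_neutral)
qed

lemma vec3_axis: "(w :: real^3) = w$1 *\<^sub>R axis 1 1 + w$2 *\<^sub>R axis 2 1 + w$3 *\<^sub>R axis 3 1"
  by (simp add: vec_eq_iff forall_3 axis_def)

lemma linear_vec3:
  assumes "linear (L :: real^3 \<Rightarrow> 'b::real_vector)"
  shows "L w = w$1 *\<^sub>R L (axis 1 1) + w$2 *\<^sub>R L (axis 2 1) + w$3 *\<^sub>R L (axis 3 1)"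
proof -
  have "L w = L (w$1 *\<^sub>R axis 1 1 + w$2 *\<^sub>R axis 2 1 + w$3 *\<^sub>R axis 3 1)"
    by (rule arg_cong[OF vec3_axis])
  then show ?thesis by (simp only: linear_add[OF assms] linear_scale[OF assms])
qed

text \<open>A vanishing triple product makes the cross product of the first two columns orthogonal
  to the whole image. By surjectivity it is zero, so these columns are dependent, against
  injectivity.\<close>

lemma triple_product_nonzero:
  assumes "linear (L :: real^3 \<Rightarrow> real^3)" "inj L" "surj L"
  shows "L (axis 3 1) \<bullet> cross3 (L (axis 1 1)) (L (axis 2 1)) \<noteq> 0"
proof
  define c where "c = cross3 (L (axis 1 1)) (L (axis 2 1))"
  assume "L (axis 3 1) \<bullet> cross3 (L (axis 1 1)) (L (axis 2 1)) = 0"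
  then have "c \<bullet> L w = 0" for w
    unfolding linear_vec3[OF assms(1), of w]
    by (simp add: c_def inner_add_right dot_cross_self inner_commute)
  then have "c \<bullet> c = 0" using assms(3) by (metis surjD)
  then have "collinear {0, L (axis 1 1), L (axis 2 1)}" by (simp add: c_def cross_eq_0)
  then have "L (axis 1 1) = 0 \<or> L (axis 2 1) = 0 \<or> (\<exists>r. L (axis 2 1) = r *\<^sub>R L (axis 1 1))"
    by (simp add: collinear_lemma)
  then consider "L (axis 1 1) = L 0" | "L (axis 2 1) = L 0" | r where "L (axis 2 1) = L (r *\<^sub>R axis 1 1)"
    using linear_0[OF assms(1)] linear_scale[OF assms(1)] by metis
  then have "axis 1 1 = (0::real^3) \<or> axis 2 1 = (0::real^3) \<or> (\<exists>r. axis 2 1 = r *\<^sub>R (axis 1 1 :: real^3))"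
    using injD[OF assms(2)] by cases blast+
  then show False by (auto simp: vec_eq_iff forall_3 axis_def)
qed

context contact_line_fibration
begin

subsection \<open>The leaf space is a plane\<close>

text \<open>The points closest to the origin on the lines of the rescaled field \<^term>\<open>\<lambda>p. V (s *\<^sub>R p)\<close> form the
  surface \<^term>\<open>p \<bullet> V (s *\<^sub>R p) = 0\<close>; for \<^term>\<open>s = (0::real)\<close> it is the plane orthogonal to \<^term>\<open>V 0\<close>.
  The field rotating each position with angular velocity \<^term>\<open>cross3 v v'\<close>, where \<^term>\<open>v = V (s *\<^sub>R p)\<close> and
  \<^term>\<open>v'\<close> is its derivative in \<^term>\<open>s\<close>, carries these surfaces into each other.\<close>

definition spin :: "real \<times> (real^3) \<Rightarrow> real^3" where
  "spin z = (let s = pulse (fst z); p = snd z; v = V (s *\<^sub>R p); d = DV (s *\<^sub>R p) p in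
     pulse' (fst z) *\<^sub>R ((v \<bullet> p) *\<^sub>R d - (p \<bullet> d) *\<^sub>R v))"

lemma smooth_spin: "smooth spin"
  unfolding spin_def Let_def
  by (intro smooth_intros smooth_pulse smooth_V smooth_compose[OF smooth_V])

lemma spin_field: "seminorm_preserving_field (\<lambda>u. u) spin"
proof (unfold_locales)
  show "\<exists>L\<ge>0. \<forall>t p q. norm p \<le> R \<longrightarrow> norm q \<le> R \<longrightarrow> norm (spin (t, p) - spin (t, q)) \<le> L * norm (p - q)" for R
    by (rule smooth_lipschitz_periodic[OF smooth_spin]) (simp add: spin_def Let_def)
  show "p \<bullet> spin (t, p) = 0" for t p
    by (simp add: spin_def Let_def inner_diff_right inner_commute)
qed (simp_all add: smooth_spin)

text \<open>The defining function of the surfaces obeys a homogeneous linear equation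
  \<open>f' = k * f\<close> along the flow, so a trajectory is on its surface at time 1 exactly when
  it is at time 0.\<close>

lemma leaf_space:
  obtains \<Psi> \<psi> where "smooth \<Psi>" "smooth \<psi>" "\<And>x. \<psi> (\<Psi> x) = x" "\<And>x. \<Psi> (\<psi> x) = x"
    "\<And>x. \<Psi> x \<bullet> V (\<Psi> x) = 0 \<longleftrightarrow> x \<bullet> V 0 = 0"
proof -
  interpret seminorm_preserving_field "\<lambda>u. u" spin by (rule spin_field)
  obtain \<phi> where \<phi>: "smooth \<phi>" "\<And>x. \<phi> (0, x) = x"
    "\<And>t x. ((\<lambda>t. \<phi> (t, x)) has_vector_derivative spin (t, \<phi> (t, x))) (at t)"
    using flow_exists by blast
  obtain \<psi> where \<psi>: "smooth \<psi>" "\<And>x. \<psi> (\<phi> (1, x)) = x" "\<And>x. \<phi> (1, \<psi> x) = x"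
    using time_one_diffeomorphism[OF \<phi>] by blast
  have "\<phi> (1, x) \<bullet> V (\<phi> (1, x)) = 0 \<longleftrightarrow> x \<bullet> V 0 = 0" for x
  proof -
    define p where "p t = \<phi> (t, x)" for t
    define f where "f t = p t \<bullet> V (pulse t *\<^sub>R p t)" for t
    \<comment> \<open>The term coming from the growth of the scale \<open>pulse\<close> cancels
      against the one coming from the velocity of \<open>p\<close>; only the twofold application of
      the derivative of \<open>V\<close> survives.\<close>
    define k where "k t = pulse' t * pulse t * (p t \<bullet> DV (pulse t *\<^sub>R p t) (DV (pulse t *\<^sub>R p t) (p t)))" for t
    have p: "(p has_vector_derivative spin (t, p t)) (at t)" for t
      using \<phi>(3) by (simp add: p_def[abs_def])
    have f: "(f has_vector_derivative k t * f t) (at t)" for t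
    proof -
      define d where "d = spin (t, p t)"
      define W where "W = (\<lambda>w. DV (pulse t *\<^sub>R p t) w)"
      define v where "v = V (pulse t *\<^sub>R p t)"
      have d: "d = pulse' t *\<^sub>R ((v \<bullet> p t) *\<^sub>R W (p t) - (p t \<bullet> W (p t)) *\<^sub>R v)"
        by (simp add: d_def spin_def Let_def v_def W_def)
      have W: "linear W" "W v = 0" "v \<bullet> W w = 0" "v \<bullet> v = 1" for w
        by (simp_all add: W_def v_def linear_DV DV_V V_DV)
      have sp: "((\<lambda>t. pulse t *\<^sub>R p t) has_vector_derivative (pulse t *\<^sub>R d + pulse' t *\<^sub>R p t)) (at t)"
        unfolding d_def by (rule has_vector_derivative_scaleR[OF DERIV_pulse p])
      have "(f has_vector_derivative p t \<bullet> W (pulse t *\<^sub>R d + pulse' t *\<^sub>R p t) + d \<bullet> v) (at t)"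
        unfolding f_def[abs_def] d_def W_def v_def
        by (rule has_vector_derivative_inner[OF p has_vector_derivative_smooth_compose[OF smooth_V sp[unfolded d_def]]])
      moreover have "p t \<bullet> W (pulse t *\<^sub>R d + pulse' t *\<^sub>R p t) + d \<bullet> v = k t * f t"
      proof -
        have "W d = (pulse' t * (v \<bullet> p t)) *\<^sub>R W (W (p t))"
          unfolding d by (simp add: linear_scale[OF W(1)] linear_diff[OF W(1)] W(2))
        moreover have "v \<bullet> d = - pulse' t * (p t \<bullet> W (p t))"
          unfolding d using W(3,4) by (simp add: inner_diff_right)
        then have "d \<bullet> v = - pulse' t * (p t \<bullet> W (p t))" by (simp add: inner_commute)
        moreover have "k t * f t = pulse' t * pulse t * (p t \<bullet> W (W (p t))) * (v \<bullet> p t)"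
          by (simp add: k_def f_def W_def v_def inner_commute)
        ultimately show ?thesis
          by (simp add: linear_add[OF W(1)] linear_scale[OF W(1)] inner_add_right)
      qed
      ultimately show ?thesis by simp
    qed
    have "smooth k"
      unfolding k_def p_def
      by (intro smooth_intros smooth_pulse smooth_V smooth_compose[OF \<phi>(1)])
    then have ck: "continuous_on UNIV k" by (rule smooth_continuous_on)
    have 1: "f 1 = 0" if "f 0 = 0"
      by (rule ode_zero_unique[where e=f and L="\<lambda>t. \<bar>k t\<bar>", OF that f])
        (simp_all add: abs_mult continuous_on_rabs[OF ck])
    have 0: "f 0 = 0" if "f 1 = 0"
    proof -
      have "(\<lambda>t. f (1 + t)) (- 1) = 0"
      proof (rule ode_zero_unique[where e="\<lambda>t. f (1 + t)" and e'="\<lambda>t. k (1 + t) * f (1 + t)" and L="\<lambda>t. \<bar>k (1 + t)\<bar>"])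
        show "((\<lambda>t. f (1 + t)) has_vector_derivative k (1 + s) * f (1 + s)) (at s)" for s
          by (rule has_vector_derivative_shift[OF f])
        show "continuous_on UNIV (\<lambda>t. \<bar>k (1 + t)\<bar>)"
          by (intro continuous_intros continuous_on_compose2[OF ck]) auto
      qed (simp_all add: that abs_mult)
      then show ?thesis by simp
    qed
    have "f 0 = x \<bullet> V 0" "f 1 = \<phi> (1, x) \<bullet> V (\<phi> (1, x))"
      by (simp_all add: f_def p_def \<phi>(2))
    then show ?thesis using 0 1 by metis
  qed
  moreover have "smooth (\<lambda>x. \<phi> (1, x))"
    by (intro smooth_compose[OF \<phi>(1)] smooth_intros)
  ultimately show thesis using that[of "\<lambda>x. \<phi> (1, x)" \<psi>] \<psi> by blast
qed

subsection \<open>Reeb coordinates\<close>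

text \<open>\<open>M\<close> follows the line through the foot point \<open>\<sigma> q\<close> for
  the signed length \<open>q$3\<close>. Since \<open>V\<close> is constant on lines and orthogonal
  to its derivatives, the pulled back form has vertical coefficient 1 and is independent of height.
  Its curl is the contact density times the Jacobian of \<open>\<sigma>\<close> transverse to
  \<open>V\<close>.\<close>

lemma reeb_coordinates:
  obtains M l1 l2 where "contact_map M V (\<lambda>q. vector [l1 q, l2 q, 1])"
    "smooth l1" "smooth l2" "\<And>q t. l1 (q + t *\<^sub>R axis 3 1) = l1 q" "\<And>q t. l2 (q + t *\<^sub>R axis 3 1) = l2 q"
    "\<And>q. frechet_derivative l2 (at q) (axis 1 1) - frechet_derivative l1 (at q) (axis 2 1) \<noteq> 0"
proof -
  obtain \<Psi> \<psi> where \<Psi>: "smooth \<Psi>" "smooth \<psi>" "\<And>x. \<psi> (\<Psi> x) = x" "\<And>x. \<Psi> (\<psi> x) = x"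
    "\<And>x. \<Psi> x \<bullet> V (\<Psi> x) = 0 \<longleftrightarrow> x \<bullet> V 0 = 0"
    using leaf_space by blast
  \<comment> \<open>An orthogonal \<open>Q\<close> turns the horizontal plane into the plane
    orthogonal to \<open>V 0\<close>, on which \<open>\<Psi>\<close> parametrises the foot
    points.\<close>
  have "norm (axis 3 1 :: real^3) = norm (V 0)" by (simp add: norm_V)
  then obtain Q where Q: "orthogonal_transformation Q" "Q (axis 3 1 :: real^3) = V 0"
    by (rule orthogonal_transformation_exists)
  define Q' where "Q' = inv Q"
  have Q': "Q (Q' x) = x" "Q' (Q x) = x" "linear Q" "linear Q'" for x
    using orthogonal_transformation_bij[OF Q(1)] orthogonal_transformation_linear[OF Q(1)]
      orthogonal_transformation_linear[OF orthogonal_transformation_inv[OF Q(1)]]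
    by (simp_all add: Q'_def bij_is_surj surj_f_inv_f bij_is_inj)
  have Qdot: "Q a \<bullet> Q b = a \<bullet> b" for a b using Q(1) by (simp add: orthogonal_transformation_def)
  have smQ: "smooth Q" "smooth Q'"
    using Q' by (auto intro: smooth_linear simp: linear_conv_bounded_linear[symmetric])
  define pr where "pr q = q - q$3 *\<^sub>R axis 3 1" for q :: "real^3"
  have pr3: "pr q $ 3 = 0" "pr (pr q) = pr q" "pr (q + t *\<^sub>R axis 3 1) = pr q" "pr q + q$3 *\<^sub>R axis 3 1 = q"
    "q$3 = 0 \<Longrightarrow> pr q = q" for q t
    by (simp_all add: pr_def algebra_simps)
  have smpr: "smooth pr" unfolding pr_def by (intro smooth_intros)
  define \<sigma> where "\<sigma> q = \<Psi> (Q (pr q))" for q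
  have sm\<sigma>: "smooth \<sigma>"
    unfolding \<sigma>_def by (rule smooth_compose[OF \<Psi>(1) smooth_compose[OF smQ(1) smpr]])
  have \<sigma>z: "\<sigma> (q + t *\<^sub>R axis 3 1) = \<sigma> q" for q t by (simp add: \<sigma>_def pr3)
  have \<sigma>V: "\<sigma> q \<bullet> V (\<sigma> q) = 0" for q
    using Qdot[of "pr q" "axis 3 1"] by (simp add: \<sigma>_def \<Psi>(5) Q(2) inner_axis pr3)
  define M where "M q = \<sigma> q + q$3 *\<^sub>R V (\<sigma> q)" for q
  \<comment> \<open>The inverse of \<open>M\<close>: \<open>p \<bullet> V p\<close> is the height of
    \<open>p\<close> over the foot point of its line, and removing that multiple of
    \<open>V p\<close> yields the foot point.\<close>
  define N where "N p = Q' (\<psi> (p - (p \<bullet> V p) *\<^sub>R V p)) + (p \<bullet> V p) *\<^sub>R axis 3 1" for p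
  have smVs: "smooth (\<lambda>q. V (\<sigma> q))" by (rule smooth_compose[OF smooth_V sm\<sigma>])
  have smM: "smooth M" unfolding M_def by (intro smooth_intros sm\<sigma> smVs)
  have smN: "smooth N"
    unfolding N_def
    by (intro smooth_intros smooth_compose[OF smQ(2)] smooth_compose[OF \<Psi>(2)] smooth_V)
  have VM: "V (M q) = V (\<sigma> q)" for q unfolding M_def by (rule V_const_on_line)
  have NM: "N (M q) = q" for q
  proof -
    have "M q \<bullet> V (M q) = q$3" unfolding VM by (simp add: M_def inner_add_left \<sigma>V)
    then have "N (M q) = Q' (\<psi> (\<sigma> q)) + q$3 *\<^sub>R axis 3 1" by (simp add: N_def VM) (simp add: M_def)
    then show ?thesis by (simp add: \<sigma>_def \<Psi>(3) Q'(2) pr3)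
  qed
  have MN: "M (N p) = p" for p
  proof -
    define s where "s = p - (p \<bullet> V p) *\<^sub>R V p"
    have Vs: "V s = V p" using V_const_on_line[of p "- (p \<bullet> V p)"] by (simp add: s_def)
    have "s \<bullet> V s = 0" unfolding Vs by (simp add: s_def inner_diff_left)
    then have "\<psi> s \<bullet> V 0 = 0" using \<Psi>(5)[of "\<psi> s"] by (simp add: \<Psi>(4))
    moreover have "Q' (\<psi> s) $ 3 = Q' (\<psi> s) \<bullet> axis 3 1" by (simp add: inner_axis)
    ultimately have "Q' (\<psi> s) $ 3 = 0" using Qdot[of "Q' (\<psi> s)" "axis 3 1"] by (simp add: Q' Q(2))
    moreover have "N p = Q' (\<psi> s) + (p \<bullet> V p) *\<^sub>R axis 3 1" by (simp add: N_def s_def)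
    ultimately have "pr (N p) = Q' (\<psi> s)" "N p $ 3 = p \<bullet> V p" by (simp_all add: pr3)
    then have "M (N p) = s + (p \<bullet> V p) *\<^sub>R V s" by (simp add: M_def \<sigma>_def Q' \<Psi>(4))
    then show ?thesis by (simp add: Vs) (simp add: s_def)
  qed
  have diff: "diffeomorphism M" unfolding diffeomorphism_def using smM smN NM MN by blast
  define D where "D q w = frechet_derivative \<sigma> (at q) w" for q w
  have linD: "linear (D q)" for q unfolding D_def[abs_def] by (rule smooth_frechet_linear[OF sm\<sigma>])
  have De3: "D q (axis 3 1) = 0" for q unfolding D_def by (rule frechet_derivative_zero_along[OF sm\<sigma> \<sigma>z])
  have DM: "frechet_derivative M (at q) w = D q w + w$3 *\<^sub>R V (\<sigma> q) + q$3 *\<^sub>R DV (\<sigma> q) (D q w)" for q w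
  proof -
    have "((\<lambda>q. \<sigma> q + q$3 *\<^sub>R V (\<sigma> q)) has_derivative
       (\<lambda>w. D q w + (q$3 *\<^sub>R DV (\<sigma> q) (D q w) + w$3 *\<^sub>R V (\<sigma> q)))) (at q)"
      unfolding D_def
      by (intro has_derivative_add smooth_has_derivative sm\<sigma> has_derivative_scaleR
          bounded_linear_imp_has_derivative bounded_linear_vec_nth
          has_derivative_compose[OF smooth_has_derivative[OF sm\<sigma>] smooth_has_derivative[OF smooth_V]])
    then have "(\<lambda>w. D q w + (q$3 *\<^sub>R DV (\<sigma> q) (D q w) + w$3 *\<^sub>R V (\<sigma> q))) = frechet_derivative M (at q)"
      unfolding M_def by (rule frechet_derivative_at)
    from fun_cong[OF this, of w] show ?thesis by (simp add: algebra_simps)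
  qed
  define l where "l i q = V (\<sigma> q) \<bullet> D q (axis i 1)" for i q
  have sml: "smooth (l i)" for i
    unfolding l_def D_def by (intro smooth_intros smVs sm\<sigma>)
  have lz: "l i (q + t *\<^sub>R axis 3 1) = l i q" for i q t
    unfolding l_def D_def \<sigma>z frechet_derivative_translate[OF sm\<sigma> \<sigma>z] ..
  have "contact_map M V (\<lambda>q. vector [l 1 q, l 2 q, 1])"
    unfolding contact_map_def
  proof (intro conjI diff exI[of _ "\<lambda>_. 1"] allI)
    fix q w
    have "V (M q) \<bullet> frechet_derivative M (at q) w = V (\<sigma> q) \<bullet> D q w + w$3"
      unfolding VM DM by (simp add: inner_add_right V_DV)
    also have "V (\<sigma> q) \<bullet> D q w = w$1 * l 1 q + w$2 * l 2 q"
      unfolding linear_vec3[OF linD, of q w] by (simp add: inner_add_right l_def De3)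
    finally show "V (M q) \<bullet> frechet_derivative M (at q) w = 1 * (vector [l 1 q, l 2 q, 1] \<bullet> w)"
      by (simp add: inner_vec_def sum_3)
  qed simp
  moreover have "frechet_derivative (l 2) (at q) (axis 1 1) - frechet_derivative (l 1) (at q) (axis 2 1) \<noteq> 0" for q
  proof -
    have dl: "frechet_derivative (l i) (at q) w = V (\<sigma> q) \<bullet> frechet_derivative (\<lambda>q. D q (axis i 1)) (at q) w
        + DV (\<sigma> q) (D q w) \<bullet> D q (axis i 1)" for i w
    proof -
      have smD: "smooth (\<lambda>q. D q (axis i 1))" unfolding D_def by (intro smooth_intros sm\<sigma>)
      have "(l i has_derivative (\<lambda>w. V (\<sigma> q) \<bullet> frechet_derivative (\<lambda>q. D q (axis i 1)) (at q) w
        + DV (\<sigma> q) (D q w) \<bullet> D q (axis i 1))) (at q)"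
        unfolding l_def D_def
        by (intro has_derivative_inner
            has_derivative_compose[OF smooth_has_derivative[OF sm\<sigma>] smooth_has_derivative[OF smooth_V]]
            smooth_has_derivative[OF smD[unfolded D_def]])
      from fun_cong[OF frechet_derivative_at[OF this], of w] show ?thesis by simp
    qed
    \<comment> \<open>Symmetry of second derivatives removes the terms in which \<open>V\<close> is
      not differentiated.\<close>
    have sym: "frechet_derivative (\<lambda>q. D q (axis 2 1)) (at q) (axis 1 1) = frechet_derivative (\<lambda>q. D q (axis 1 1)) (at q) (axis 2 1)"
      unfolding D_def by (rule frechet_derivative_commute[OF sm\<sigma>])
    have "frechet_derivative (l 2) (at q) (axis 1 1) - frechet_derivative (l 1) (at q) (axis 2 1)
       = wedge_d_coeff V (\<sigma> q) * (V (\<sigma> q) \<bullet> cross3 (D q (axis 1 1)) (D q (axis 2 1)))"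
      unfolding dl sym exterior_derivative_V[symmetric] by simp
    moreover have "V (\<sigma> q) \<bullet> cross3 (D q (axis 1 1)) (D q (axis 2 1)) \<noteq> 0"
    proof -
      \<comment> \<open>At height zero the derivative of \<open>M\<close> sends the vertical axis
        vector to \<open>V\<close> and agrees with that of \<open>\<sigma>\<close> on the horizontal
        ones, so invertibility gives the claim there; \<open>\<sigma>\<close> is the same at all
        heights.\<close>
      define q0 where "q0 = pr q"
      have 1: "frechet_derivative N (at (M q0)) (frechet_derivative M (at q0) w) = w" for w
        using frechet_derivative_chain[OF smN smM, of q0 w] by (simp add: NM)
      have 2: "frechet_derivative M (at q0) (frechet_derivative N (at (M q0)) w) = w" for w
        using frechet_derivative_chain[OF smM smN, of "M q0" w] by (simp add: NM MN)
      have "q = q0 + q$3 *\<^sub>R axis 3 1" by (simp add: q0_def pr3)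
      then have same: "\<sigma> q = \<sigma> q0" "D q = D q0"
        using \<sigma>z frechet_derivative_translate[OF sm\<sigma> \<sigma>z] unfolding D_def[abs_def] by metis+
      have "q0$3 = 0" by (simp add: q0_def pr3)
      moreover have e3: "(axis 1 1 :: real^3)$3 = 0" "(axis 2 1 :: real^3)$3 = 0" "(axis 3 1 :: real^3)$3 = 1"
        by (simp_all add: axis_def)
      ultimately have L: "frechet_derivative M (at q0) (axis 3 1) = V (\<sigma> q0)"
        "frechet_derivative M (at q0) (axis 1 1) = D q0 (axis 1 1)"
        "frechet_derivative M (at q0) (axis 2 1) = D q0 (axis 2 1)"
        unfolding DM by (simp_all add: De3 e3)
      have "inj (frechet_derivative M (at q0))" "surj (frechet_derivative M (at q0))"
        using 1 2 by (metis injI, metis surjI)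
      from triple_product_nonzero[OF smooth_frechet_linear[OF smM] this]
      show ?thesis unfolding L same .
    qed
    ultimately show ?thesis using contact by (simp add: contact_form_def)
  qed
  ultimately show thesis
    by (intro that[of M "l 1" "l 2"] sml lz)
qed

end

section \<open>Contact forms invariant under vertical translation\<close>

definition vertical_invariant :: "(real^3 \<Rightarrow> 'b) \<Rightarrow> bool" where
  "vertical_invariant f \<longleftrightarrow> (\<forall>q t. f (q + t *\<^sub>R axis 3 1) = f q)"

text \<open>The one-form dz + h (x dy - y dx).\<close>

definition rotational_form :: "(real^3 \<Rightarrow> real) \<Rightarrow> real^3 \<Rightarrow> real^3" where
  "rotational_form h q = vector [- (q$2 * h q), q$1 * h q, 1]"

definition rot :: "real \<Rightarrow> real^3 \<Rightarrow> real^3" where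
  "rot s q = vector [cos s * q$1 - sin s * q$2, sin s * q$1 + cos s * q$2, q$3]"

definition turn :: "real^3 \<Rightarrow> real^3" where
  "turn q = vector [- q$2, q$1, 0]"

section \<open>Vertically invariant functions and integrals along rays\<close>

lemma inner_vector_3: "vector [a, b, c] \<bullet> (w :: real^3) = a * w$1 + b * w$2 + c * w$3"
  by (simp add: inner_vec_def sum_3)

lemma axis_3_components [simp]:
  "(axis 1 1 :: real^3)$1 = 1" "(axis 1 1 :: real^3)$2 = 0" "(axis 1 1 :: real^3)$3 = 0"
  "(axis 2 1 :: real^3)$1 = 0" "(axis 2 1 :: real^3)$2 = 1" "(axis 2 1 :: real^3)$3 = 0"
  "(axis 3 1 :: real^3)$1 = 0" "(axis 3 1 :: real^3)$2 = 0" "(axis 3 1 :: real^3)$3 = 1"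
  by (simp_all add: axis_def)

lemma vertical_invariantD: "vertical_invariant f \<Longrightarrow> f (q + t *\<^sub>R axis 3 1) = f q"
  by (simp add: vertical_invariant_def)

lemma frechet_vertical_invariant:
  fixes f :: "real^3 \<Rightarrow> real"
  assumes "smooth f" "vertical_invariant f"
  shows "frechet_derivative f (at q) w = w$1 * frechet_derivative f (at q) (axis 1 1) + w$2 * frechet_derivative f (at q) (axis 2 1)"
    and "frechet_derivative f (at (q + t *\<^sub>R axis 3 1)) = frechet_derivative f (at q)"
proof -
  have "frechet_derivative f (at q) (axis 3 1) = 0"
    by (rule frechet_derivative_zero_along[OF assms(1) vertical_invariantD[OF assms(2)]])
  then show "frechet_derivative f (at q) w = w$1 * frechet_derivative f (at q) (axis 1 1) + w$2 * frechet_derivative f (at q) (axis 2 1)"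
    using linear_vec3[OF smooth_frechet_linear[OF assms(1)], of q w] by simp
  show "frechet_derivative f (at (q + t *\<^sub>R axis 3 1)) = frechet_derivative f (at q)"
    by (rule frechet_derivative_translate[OF assms(1) vertical_invariantD[OF assms(2)]])
qed

lemma frechet_param_integral':
  fixes f :: "real \<times> 'a::euclidean_space \<Rightarrow> 'b::banach"
  assumes "smooth f" "\<And>s. ((\<lambda>x. f (s, x)) has_derivative F s) (at x)"
  shows "frechet_derivative (\<lambda>x. integral {a..b} (\<lambda>s. f (s, x))) (at x) v = integral {a..b} (\<lambda>s. F s v)"
proof -
  have "frechet_derivative f (at (s, x)) (0, v) = F s v" for s
  proof -
    have 1: "((\<lambda>x. (s, x)) has_derivative (\<lambda>w. (0, w))) (at x)"
      by (auto intro!: derivative_eq_intros)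
    from has_derivative_unique[OF has_derivative_compose[OF 1 smooth_has_derivative[OF assms(1)]] assms(2)]
    show ?thesis by metis
  qed
  then show ?thesis using frechet_param_integral[OF assms(1), of a b x v] by simp
qed

lemma has_derivative_linear_arg:
  fixes g :: "'b::real_normed_vector \<Rightarrow> 'c::real_normed_vector"
  assumes "smooth g" "bounded_linear A"
  shows "((\<lambda>x. g (A x)) has_derivative (\<lambda>w. frechet_derivative g (at (A x)) (A w))) (at x)"
  by (rule has_derivative_compose[OF bounded_linear_imp_has_derivative[OF assms(2)] smooth_has_derivative[OF assms(1)]])

lemma has_vector_derivative_ray:
  fixes g :: "'a::real_normed_vector \<Rightarrow> 'b::real_normed_vector"
  assumes "smooth g"
  shows "((\<lambda>t. g (t *\<^sub>R q)) has_vector_derivative frechet_derivative g (at (t *\<^sub>R q)) q) (at t)"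
  using has_vector_derivative_along[where x=0 and s=t and v=q, of g] smooth_has_derivative[OF assms] by simp

lemma integral_pos:
  fixes f :: "real \<Rightarrow> real"
  assumes "continuous_on {a..b} f" "a < b" "\<And>x. x \<in> {a..b} \<Longrightarrow> 0 < f x"
  shows "0 < integral {a..b} f"
proof -
  have "0 \<le> integral {a..b} f"
    by (rule integral_nonneg[OF integrable_continuous_interval[OF assms(1)]]) (simp add: assms(3) less_imp_le)
  moreover have "integral {a..b} f \<noteq> 0"
    using integral_eq_0_iff[OF assms(1,2)] assms(2,3)
    by (metis atLeastAtMost_iff less_imp_le less_irrefl order_refl)
  ultimately show ?thesis by simp
qed

subsection \<open>Radial gauge\<close>

text \<open>The radial homotopy of the Poincare lemma: \<open>F\<close> integrates the horizontal
  part of the form along rays from the origin. Subtracting its differential leaves a form that kills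
  the radial direction, hence of the shape h (x dy - y dx), where \<open>h\<close> is a weighted
  radial mean of the curl \<open>g\<close>. The vertical shear \<open>G\<close> by
  \<open>- F\<close> realises the subtraction.\<close>

lemma radial_gauge:
  assumes sm: "smooth l1" "smooth l2" and inv: "vertical_invariant l1" "vertical_invariant l2"
    and g: "\<And>q. g q = frechet_derivative l2 (at q) (axis 1 1) - frechet_derivative l1 (at q) (axis 2 1)"
  obtains G h where "contact_map G (\<lambda>q. vector [l1 q, l2 q, 1]) (rotational_form h)"
    "smooth h" "vertical_invariant h" "\<And>q. 2 * h q + frechet_derivative h (at q) q = g q"
proof -
  have smg: "smooth g"
  proof -
    have "g = (\<lambda>q. frechet_derivative l2 (at q) (axis 1 1) - frechet_derivative l1 (at q) (axis 2 1))"
      by (simp add: fun_eq_iff g)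
    then show ?thesis by (simp add: smooth_intros sm)
  qed
  have cray: "continuous_on A (\<lambda>t. g (t *\<^sub>R q))" for A q
    by (intro smooth_continuous_on smooth_compose[OF smg] smooth_intros)
  define h where "h q = integral {0..1} (\<lambda>t. (\<lambda>z. fst z * g (fst z *\<^sub>R snd z)) (t, q))" for q
  have smh0: "smooth (\<lambda>z. fst z * g (fst z *\<^sub>R snd z))"
    by (intro smooth_intros smooth_compose[OF smg])
  have smh: "smooth h" unfolding h_def[abs_def] by (rule smooth_param_integral[OF smh0])
  define F where "F q = integral {0..1} (\<lambda>t. (\<lambda>z. l1 (fst z *\<^sub>R snd z) * snd z $ 1 + l2 (fst z *\<^sub>R snd z) * snd z $ 2) (t, q))" for q
  have smF0: "smooth (\<lambda>z::real \<times> (real^3). l1 (fst z *\<^sub>R snd z) * snd z $ 1 + l2 (fst z *\<^sub>R snd z) * snd z $ 2)"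
    by (intro smooth_intros smooth_compose[OF sm(1)] smooth_compose[OF sm(2)])
  have smF: "smooth F" unfolding F_def[abs_def] by (rule smooth_param_integral[OF smF0])
  have ginv: "vertical_invariant g"
    unfolding vertical_invariant_def g
    using frechet_vertical_invariant(2)[OF sm(1) inv(1)] frechet_vertical_invariant(2)[OF sm(2) inv(2)] by simp
  have ray: "f (t *\<^sub>R (q + s *\<^sub>R axis 3 1)) = f (t *\<^sub>R q)" if "vertical_invariant f" for f :: "real^3 \<Rightarrow> real" and t q s
    using vertical_invariantD[OF that, of "t *\<^sub>R q" "t * s"] by (simp add: scaleR_add_right)
  have hinv: "vertical_invariant h" unfolding vertical_invariant_def h_def by (simp add: ray[OF ginv])
  have Finv: "vertical_invariant F" unfolding vertical_invariant_def F_def by (simp add: ray[OF inv(1)] ray[OF inv(2)])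
  have euler: "2 * h q + frechet_derivative h (at q) q = g q" for q
  proof -
    have D: "frechet_derivative h (at q) q = integral {0..1} (\<lambda>t. t * frechet_derivative g (at (t *\<^sub>R q)) (t *\<^sub>R q))"
      unfolding h_def[abs_def]
    proof (rule frechet_param_integral'[OF smh0, where F="\<lambda>t w. t * frechet_derivative g (at (t *\<^sub>R q)) (t *\<^sub>R w)"])
      show "((\<lambda>x. (\<lambda>z. fst z * g (fst z *\<^sub>R snd z)) (t, x)) has_derivative
        (\<lambda>w. t * frechet_derivative g (at (t *\<^sub>R q)) (t *\<^sub>R w))) (at q)" for t
        unfolding fst_conv snd_conv
        by (rule has_derivative_mult_right[OF has_derivative_linear_arg[OF smg bounded_linear_scaleR_right]])
    qed
    \<comment> \<open>The primitive is \<open>t\<^sup>2 * g (t *\<^sub>R q)\<close>; the resulting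
      identity says that the curl of h (x dy - y dx) is again \<open>g\<close>.\<close>
    have "((\<lambda>t. 2 * (t * g (t *\<^sub>R q)) + t * frechet_derivative g (at (t *\<^sub>R q)) (t *\<^sub>R q))
        has_integral (1\<^sup>2 * g (1 *\<^sub>R q) - 0\<^sup>2 * g (0 *\<^sub>R q))) {0..1}"
    proof (rule fundamental_theorem_of_calculus)
      fix t :: real
      have "((\<lambda>t. g (t *\<^sub>R q)) has_real_derivative frechet_derivative g (at (t *\<^sub>R q)) q) (at t)"
        using has_vector_derivative_ray[OF smg] by (simp add: has_real_derivative_iff_has_vector_derivative)
      then have "((\<lambda>t. t\<^sup>2 * g (t *\<^sub>R q)) has_real_derivative
          2 * (t * g (t *\<^sub>R q)) + t * frechet_derivative g (at (t *\<^sub>R q)) (t *\<^sub>R q)) (at t)"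
        unfolding linear_scale[OF smooth_frechet_linear[OF smg]]
        by (auto intro!: derivative_eq_intros simp: algebra_simps power2_eq_square)
      then show "((\<lambda>t. t\<^sup>2 * g (t *\<^sub>R q)) has_vector_derivative
          2 * (t * g (t *\<^sub>R q)) + t * frechet_derivative g (at (t *\<^sub>R q)) (t *\<^sub>R q)) (at t within {0..1})"
        by (auto simp: has_real_derivative_iff_has_vector_derivative intro: has_vector_derivative_at_within)
    qed simp
    moreover have i1: "(\<lambda>t. t * g (t *\<^sub>R q)) integrable_on {0..1}"
      by (intro integrable_continuous_interval continuous_intros cray)
    moreover have i2: "(\<lambda>t. t * frechet_derivative g (at (t *\<^sub>R q)) (t *\<^sub>R q)) integrable_on {0..1}"
      by (intro integrable_continuous_interval smooth_continuous_on smooth_intros smg)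
    ultimately show ?thesis
      using has_integral_unique[OF has_integral_add[OF has_integral_mult_right[OF integrable_integral[OF i1], of 2]
            integrable_integral[OF i2]]]
      unfolding D by (simp add: h_def)
  qed
  have DF: "frechet_derivative F (at q) w = l1 q * w$1 + l2 q * w$2 - h q * (q$1 * w$2 - q$2 * w$1)" for q w
  proof -
    let ?D1 = "\<lambda>t. frechet_derivative l1 (at (t *\<^sub>R q))" and ?D2 = "\<lambda>t. frechet_derivative l2 (at (t *\<^sub>R q))"
    define c where "c = q$1 * w$2 - q$2 * w$1"
    have D: "frechet_derivative F (at q) w = integral {0..1} (\<lambda>t. l1 (t *\<^sub>R q) * w$1 + ?D1 t (t *\<^sub>R w) * q$1
        + (l2 (t *\<^sub>R q) * w$2 + ?D2 t (t *\<^sub>R w) * q$2))"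
      unfolding F_def[abs_def]
    proof (rule frechet_param_integral'[OF smF0, where F="\<lambda>t w. l1 (t *\<^sub>R q) * w$1 + ?D1 t (t *\<^sub>R w) * q$1
        + (l2 (t *\<^sub>R q) * w$2 + ?D2 t (t *\<^sub>R w) * q$2)"])
      show "((\<lambda>x. (\<lambda>z. l1 (fst z *\<^sub>R snd z) * snd z $ 1 + l2 (fst z *\<^sub>R snd z) * snd z $ 2) (t, x)) has_derivative
        (\<lambda>w. l1 (t *\<^sub>R q) * w$1 + ?D1 t (t *\<^sub>R w) * q$1 + (l2 (t *\<^sub>R q) * w$2 + ?D2 t (t *\<^sub>R w) * q$2))) (at q)" for t
        unfolding fst_conv snd_conv
        by (intro has_derivative_add has_derivative_mult has_derivative_linear_arg sm bounded_linear_scaleR_right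
            bounded_linear_imp_has_derivative bounded_linear_vec_nth)
    qed
    \<comment> \<open>Exchanging \<open>q\<close> and \<open>w\<close> in the derivatives of
      \<open>l1\<close> and \<open>l2\<close> costs the curl \<open>g\<close> times the signed area
      \<open>c\<close>. The exchanged expression is the total derivative of
      \<open>t * (l1 (t *\<^sub>R q) * w$1 + l2 (t *\<^sub>R q) * w$2)\<close>.\<close>
    have pt: "l1 (t *\<^sub>R q) * w$1 + ?D1 t (t *\<^sub>R w) * q$1 + (l2 (t *\<^sub>R q) * w$2 + ?D2 t (t *\<^sub>R w) * q$2)
        = (l1 (t *\<^sub>R q) * w$1 + l2 (t *\<^sub>R q) * w$2 + t * (?D1 t q * w$1 + ?D2 t q * w$2)) - t * g (t *\<^sub>R q) * c" for t
      unfolding g c_def linear_scale[OF smooth_frechet_linear[OF sm(1)]] linear_scale[OF smooth_frechet_linear[OF sm(2)]]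
        frechet_vertical_invariant(1)[OF sm(1) inv(1), of _ w] frechet_vertical_invariant(1)[OF sm(2) inv(2), of _ w]
        frechet_vertical_invariant(1)[OF sm(1) inv(1), of _ q] frechet_vertical_invariant(1)[OF sm(2) inv(2), of _ q]
      by (simp add: algebra_simps)
    have "((\<lambda>t. l1 (t *\<^sub>R q) * w$1 + l2 (t *\<^sub>R q) * w$2 + t * (?D1 t q * w$1 + ?D2 t q * w$2)) has_integral
        (1 * (l1 (1 *\<^sub>R q) * w$1 + l2 (1 *\<^sub>R q) * w$2) - 0 * (l1 (0 *\<^sub>R q) * w$1 + l2 (0 *\<^sub>R q) * w$2))) {0..1}"
    proof (rule fundamental_theorem_of_calculus)
      fix t :: real
      have "((\<lambda>t. l1 (t *\<^sub>R q)) has_real_derivative ?D1 t q) (at t)"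
        "((\<lambda>t. l2 (t *\<^sub>R q)) has_real_derivative ?D2 t q) (at t)"
        using has_vector_derivative_ray[OF sm(1)] has_vector_derivative_ray[OF sm(2)]
        by (simp_all add: has_real_derivative_iff_has_vector_derivative)
      then have "((\<lambda>t. t * (l1 (t *\<^sub>R q) * w$1 + l2 (t *\<^sub>R q) * w$2)) has_real_derivative
         l1 (t *\<^sub>R q) * w$1 + l2 (t *\<^sub>R q) * w$2 + t * (?D1 t q * w$1 + ?D2 t q * w$2)) (at t)"
        by (auto intro!: derivative_eq_intros simp: algebra_simps)
      then show "((\<lambda>t. t * (l1 (t *\<^sub>R q) * w$1 + l2 (t *\<^sub>R q) * w$2)) has_vector_derivative
         l1 (t *\<^sub>R q) * w$1 + l2 (t *\<^sub>R q) * w$2 + t * (?D1 t q * w$1 + ?D2 t q * w$2)) (at t within {0..1})"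
        by (auto simp: has_real_derivative_iff_has_vector_derivative intro: has_vector_derivative_at_within)
    qed simp
    moreover have "(\<lambda>t. t * g (t *\<^sub>R q)) integrable_on {0..1}"
      by (intro integrable_continuous_interval continuous_intros cray)
    from has_integral_mult_left[OF integrable_integral[OF this], of c]
    have "((\<lambda>t. t * g (t *\<^sub>R q) * c) has_integral h q * c) {0..1}" by (simp add: h_def)
    ultimately have "((\<lambda>t. l1 (t *\<^sub>R q) * w$1 + ?D1 t (t *\<^sub>R w) * q$1 + (l2 (t *\<^sub>R q) * w$2 + ?D2 t (t *\<^sub>R w) * q$2))
        has_integral (l1 q * w$1 + l2 q * w$2) - h q * c) {0..1}"
      unfolding pt by (simp add: has_integral_diff)
    from integral_unique[OF this] show ?thesis unfolding D c_def .
  qed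
  define G where "G q = q - F q *\<^sub>R axis 3 1" for q
  have smG: "smooth G" unfolding G_def by (intro smooth_intros smF)
  have DG: "frechet_derivative G (at q) w = w - frechet_derivative F (at q) w *\<^sub>R axis 3 1" for q w
  proof -
    have "(G has_derivative (\<lambda>w. w - frechet_derivative F (at q) w *\<^sub>R axis 3 1)) (at q)"
      unfolding G_def
      by (intro has_derivative_diff has_derivative_ident has_derivative_scaleR_left smooth_has_derivative smF)
    from fun_cong[OF frechet_derivative_at[OF this], of w] show ?thesis by simp
  qed
  have shift: "f (q - t *\<^sub>R axis 3 1) = f q" if "vertical_invariant f" for f :: "real^3 \<Rightarrow> real" and q t
    using vertical_invariantD[OF that, of q "- t"] by simp
  have "contact_map G (\<lambda>q. vector [l1 q, l2 q, 1]) (rotational_form h)"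
    unfolding contact_map_def diffeomorphism_def
  proof (intro conjI exI[of _ "\<lambda>q. q + F q *\<^sub>R axis 3 1"] exI[of _ "\<lambda>_. 1"] allI)
    show "smooth (\<lambda>q. q + F q *\<^sub>R axis 3 1)" by (intro smooth_intros smF)
    show "G q + F (G q) *\<^sub>R axis 3 1 = q" for q by (simp add: G_def shift[OF Finv])
    show "G (q + F q *\<^sub>R axis 3 1) = q" for q by (simp add: G_def vertical_invariantD[OF Finv])
    show "vector [l1 (G q), l2 (G q), 1] \<bullet> frechet_derivative G (at q) w = 1 * (rotational_form h q \<bullet> w)" for q w
      unfolding DG DF by (simp add: G_def shift[OF inv(1)] shift[OF inv(2)] inner_vector_3 rotational_form_def algebra_simps)
  qed (simp_all add: smG)
  then show thesis using that smh hinv euler by blast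
qed

subsection \<open>Averaging over rotations\<close>

lemma rot_simps [simp]: "rot s q $ 1 = cos s * q$1 - sin s * q$2" "rot s q $ 2 = sin s * q$1 + cos s * q$2"
    "rot s q $ 3 = q$3"
  by (simp_all add: rot_def)

lemma turn_simps [simp]: "turn q $ 1 = - q$2" "turn q $ 2 = q$1" "turn q $ 3 = 0"
  by (simp_all add: turn_def)

lemma rot_turn: "rot s (turn q) = turn (rot s q)"
  by (simp add: vec_eq_iff forall_3 algebra_simps)

lemma rot_0 [simp]: "rot 0 q = q" and rot_2pi [simp]: "rot (2 * pi) q = q"
  by (simp_all add: vec_eq_iff forall_3)

lemma rot_vertical: "rot s (q + t *\<^sub>R axis 3 1) = rot s q + t *\<^sub>R axis 3 1"
  by (simp add: vec_eq_iff forall_3)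

lemma rot_rot: "rot s (rot t q) = rot (s + t) q"
  by (simp add: vec_eq_iff forall_3 sin_add cos_add algebra_simps)

lemma bounded_linear_rot: "bounded_linear (rot s)"
  by (rule linear_conv_bounded_linear[THEN iffD1], rule linearI)
    (simp_all add: vec_eq_iff forall_3 algebra_simps)

lemma smooth_rot: "smooth f \<Longrightarrow> smooth g \<Longrightarrow> smooth (\<lambda>x. rot (f x) (g x))"
  unfolding rot_def by (intro smooth_intros)

lemma has_vector_derivative_rot: "((\<lambda>s. rot s q) has_vector_derivative turn (rot s q)) (at s)"
proof -
  define a b c where "a = (vector [q$1, q$2, 0] :: real^3)" and "b = turn q" and "c = (vector [0, 0, q$3] :: real^3)"
  have r: "rot s q = cos s *\<^sub>R a + sin s *\<^sub>R b + c" for s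
    by (simp add: vec_eq_iff forall_3 a_def b_def c_def)
  have "((\<lambda>s. cos s *\<^sub>R a + sin s *\<^sub>R b + c) has_vector_derivative
      (cos s *\<^sub>R 0 + (- sin s) *\<^sub>R a) + (sin s *\<^sub>R 0 + cos s *\<^sub>R b) + 0) (at s)"
    by (intro has_vector_derivative_add has_vector_derivative_scaleR has_vector_derivative_const DERIV_cos DERIV_sin)
  then show ?thesis
    unfolding r
    by (rule has_vector_derivative_eq_rhs) (simp add: vec_eq_iff forall_3 a_def b_def c_def)
qed

definition rot_average :: "(real^3 \<Rightarrow> real) \<Rightarrow> real^3 \<Rightarrow> real" where
  "rot_average f q = integral {0..2*pi} (\<lambda>s. f (rot s q)) / (2 * pi)"

text \<open>Sawtooth average: it inverts the derivative along \<^const>\<open>turn\<close> up to the mean value, and unlike an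
  integral over the polar angle it is visibly smooth at the axis.\<close>

definition rot_sawtooth :: "(real^3 \<Rightarrow> real) \<Rightarrow> real^3 \<Rightarrow> real" where
  "rot_sawtooth f q = integral {0..2*pi} (\<lambda>s. s * f (rot s q)) / (2 * pi)"

text \<open>One computation for both averages: the weight \<open>k\<close> is 1 for the mean and the
  identity for the sawtooth.\<close>

lemma weighted_rot_integral:
  fixes f :: "real^3 \<Rightarrow> real" and k :: "real \<Rightarrow> real"
  assumes "smooth f" "smooth k"
  shows "smooth (\<lambda>q. integral {0..2*pi} (\<lambda>s. k s * f (rot s q)) / (2 * pi))"
    and "frechet_derivative (\<lambda>q. integral {0..2*pi} (\<lambda>s. k s * f (rot s q)) / (2 * pi)) (at q) w
      = integral {0..2*pi} (\<lambda>s. k s * frechet_derivative f (at (rot s q)) (rot s w)) / (2 * pi)"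
proof -
  have sm: "smooth (\<lambda>z::real \<times> (real^3). k (fst z) * f (rot (fst z) (snd z)))"
    by (intro smooth_intros smooth_compose[OF assms(2)] smooth_compose[OF assms(1)] smooth_rot)
  have smi: "smooth (\<lambda>q. integral {0..2*pi} (\<lambda>s. k s * f (rot s q)))"
    using smooth_param_integral[OF sm, of 0 "2*pi"] by simp
  then show "smooth (\<lambda>q. integral {0..2*pi} (\<lambda>s. k s * f (rot s q)) / (2 * pi))"
    by (intro smooth_divide smooth_const) auto
  have "frechet_derivative (\<lambda>q. integral {0..2*pi} (\<lambda>s. (\<lambda>z. k (fst z) * f (rot (fst z) (snd z))) (s, q))) (at q) w
     = integral {0..2*pi} (\<lambda>s. k s * frechet_derivative f (at (rot s q)) (rot s w))"
  proof (rule frechet_param_integral'[OF sm, where F="\<lambda>s w. k s * frechet_derivative f (at (rot s q)) (rot s w)"])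
    show "((\<lambda>x. (\<lambda>z. k (fst z) * f (rot (fst z) (snd z))) (s, x)) has_derivative
        (\<lambda>w. k s * frechet_derivative f (at (rot s q)) (rot s w))) (at q)" for s
      unfolding fst_conv snd_conv
      by (rule has_derivative_mult_right[OF has_derivative_linear_arg[OF assms(1) bounded_linear_rot]])
  qed
  moreover have "((\<lambda>q. integral {0..2*pi} (\<lambda>s. k s * f (rot s q)) / (2 * pi)) has_derivative
      (\<lambda>w. frechet_derivative (\<lambda>q. integral {0..2*pi} (\<lambda>s. k s * f (rot s q))) (at q) w / (2 * pi))) (at q)"
    using has_derivative_mult_left[OF smooth_has_derivative[OF smi], of "1 / (2 * pi)" q] by simp
  from fun_cong[OF frechet_derivative_at[OF this], of w]
  have "frechet_derivative (\<lambda>q. integral {0..2*pi} (\<lambda>s. k s * f (rot s q)) / (2 * pi)) (at q) w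
     = frechet_derivative (\<lambda>q. integral {0..2*pi} (\<lambda>s. k s * f (rot s q))) (at q) w / (2 * pi)" by simp
  ultimately show "frechet_derivative (\<lambda>q. integral {0..2*pi} (\<lambda>s. k s * f (rot s q)) / (2 * pi)) (at q) w
      = integral {0..2*pi} (\<lambda>s. k s * frechet_derivative f (at (rot s q)) (rot s w)) / (2 * pi)" by simp
qed

lemma smooth_rot_average: "smooth f \<Longrightarrow> smooth (rot_average f)"
  using weighted_rot_integral(1)[OF _ smooth_const[of 1]] by (simp add: rot_average_def[abs_def])

lemma smooth_rot_sawtooth: "smooth f \<Longrightarrow> smooth (rot_sawtooth f)"
  using weighted_rot_integral(1)[OF _ smooth_ident] by (simp add: rot_sawtooth_def[abs_def])

lemma frechet_rot_average:
  "smooth f \<Longrightarrow> frechet_derivative (rot_average f) (at q) w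
     = integral {0..2*pi} (\<lambda>s. frechet_derivative f (at (rot s q)) (rot s w)) / (2 * pi)"
  using weighted_rot_integral(2)[OF _ smooth_const[of 1]] by (simp add: rot_average_def[abs_def])

lemma frechet_rot_sawtooth:
  "smooth f \<Longrightarrow> frechet_derivative (rot_sawtooth f) (at q) w
     = integral {0..2*pi} (\<lambda>s. s * frechet_derivative f (at (rot s q)) (rot s w)) / (2 * pi)"
  using weighted_rot_integral(2)[OF _ smooth_ident] by (simp add: rot_sawtooth_def[abs_def])

lemma vertical_invariant_rot_average: "vertical_invariant f \<Longrightarrow> vertical_invariant (rot_average f)"
  and vertical_invariant_rot_sawtooth: "vertical_invariant f \<Longrightarrow> vertical_invariant (rot_sawtooth f)"
  by (simp_all add: vertical_invariant_def rot_average_def rot_sawtooth_def rot_vertical)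

lemma DERIV_along_rot:
  fixes f :: "real^3 \<Rightarrow> real"
  assumes "smooth f"
  shows "((\<lambda>s. f (rot s q)) has_real_derivative frechet_derivative f (at (rot s q)) (turn (rot s q))) (at s)"
  using has_vector_derivative_smooth_compose[OF assms has_vector_derivative_rot]
  by (simp add: has_real_derivative_iff_has_vector_derivative)

text \<open>Under the integral stands the total derivative along the rotation orbit, which
  integrates to zero over a full turn.\<close>

lemma frechet_rot_average_turn:
  assumes "smooth f"
  shows "frechet_derivative (rot_average f) (at q) (turn q) = 0"
proof -
  have "((\<lambda>s. frechet_derivative f (at (rot s q)) (turn (rot s q))) has_integral (f (rot (2*pi) q) - f (rot 0 q))) {0..2*pi}"
    using DERIV_along_rot[OF assms]
    by (intro fundamental_theorem_of_calculus)
      (auto simp: has_real_derivative_iff_has_vector_derivative intro: has_vector_derivative_at_within)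
  then show ?thesis by (simp add: frechet_rot_average[OF assms] rot_turn integral_unique)
qed

text \<open>Integration by parts over a full turn: the weight grows by \<open>2 * pi\<close>, giving
  the boundary term \<open>f q\<close>, and its slope 1 gives minus the mean.\<close>

lemma frechet_rot_sawtooth_turn:
  assumes "smooth f"
  shows "frechet_derivative (rot_sawtooth f) (at q) (turn q) = f q - rot_average f q"
proof -
  have "((\<lambda>s. s * frechet_derivative f (at (rot s q)) (turn (rot s q)) + f (rot s q)) has_integral
      (2*pi * f (rot (2*pi) q) - 0 * f (rot 0 q))) {0..2*pi}"
  proof (rule fundamental_theorem_of_calculus)
    fix s
    have "((\<lambda>s. s * f (rot s q)) has_real_derivative
        s * frechet_derivative f (at (rot s q)) (turn (rot s q)) + f (rot s q)) (at s)"
      using DERIV_mult'[OF DERIV_ident DERIV_along_rot[OF assms]] by simp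
    then show "((\<lambda>s. s * f (rot s q)) has_vector_derivative
        s * frechet_derivative f (at (rot s q)) (turn (rot s q)) + f (rot s q)) (at s within {0..2*pi})"
      by (auto simp: has_real_derivative_iff_has_vector_derivative intro: has_vector_derivative_at_within)
  qed simp
  moreover have "(\<lambda>s. f (rot s q)) integrable_on {0..2*pi}"
    by (intro integrable_continuous_interval smooth_continuous_on smooth_compose[OF assms] smooth_rot smooth_intros)
  note has_integral_diff[OF calculation integrable_integral[OF this]]
  then have "integral {0..2*pi} (\<lambda>s. s * frechet_derivative f (at (rot s q)) (turn (rot s q)))
     = 2*pi * f q - integral {0..2*pi} (\<lambda>s. f (rot s q))"
    by (simp add: integral_unique)
  then show ?thesis
    by (simp add: frechet_rot_sawtooth[OF assms] rot_turn rot_average_def diff_divide_distrib)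
qed

text \<open>Invariance follows from the vanishing derivative along orbits, which avoids shifting the
  interval of integration.\<close>

lemma rot_average_rot:
  assumes "smooth f"
  shows "rot_average f (rot t q) = rot_average f q"
proof -
  have "((\<lambda>s. rot_average f (rot s q)) has_real_derivative 0) (at s)" for s
    using DERIV_along_rot[OF smooth_rot_average[OF assms], of q s] by (simp add: frechet_rot_average_turn[OF assms])
  then have "(\<lambda>s. rot_average f (rot s q)) t = (\<lambda>s. rot_average f (rot s q)) 0"
    using DERIV_const_ratio_const[of t 0 "\<lambda>s. rot_average f (rot s q)" 0] by (cases "t = 0") auto
  then show ?thesis by simp
qed

lemma rot_average_pos:
  assumes "smooth f" "\<And>q. 0 < f q"
  shows "0 < rot_average f q"
  unfolding rot_average_def
  by (intro divide_pos_pos integral_pos smooth_continuous_on smooth_compose[OF assms(1)] smooth_rot smooth_intros)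
    (simp_all add: assms(2))

text \<open>Rotations commute with dilations, so averaging commutes with the passage from
  \<open>f\<close> to its area density. Positivity of the density thus survives averaging.\<close>

lemma rot_average_euler:
  assumes "smooth f"
  shows "2 * rot_average f q + frechet_derivative (rot_average f) (at q) q
     = rot_average (\<lambda>q. 2 * f q + frechet_derivative f (at q) q) q"
proof -
  have "(\<lambda>s. f (rot s q)) integrable_on {0..2*pi}"
    by (intro integrable_continuous_interval smooth_continuous_on smooth_compose[OF assms] smooth_rot smooth_intros)
  moreover have "(\<lambda>s. frechet_derivative f (at (rot s q)) (rot s q)) integrable_on {0..2*pi}"
    by (intro integrable_continuous_interval smooth_continuous_on smooth_intros smooth_rot assms)
  ultimately show ?thesis
    unfolding frechet_rot_average[OF assms] unfolding rot_average_def
    by (simp add: integral_add add_divide_distrib)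
qed

subsection \<open>Moser isotopy to a rotationally invariant form\<close>

text \<open>The equation of variations: exchange the time derivative with the derivative in the
  initial value, and use that the former is \<open>Z\<close> along the flow.\<close>

lemma flow_variation:
  fixes \<phi> :: "real \<times> 'a::euclidean_space \<Rightarrow> 'a"
  assumes Z: "smooth Z" and \<phi>: "smooth \<phi>"
    and der: "\<And>t x. ((\<lambda>t. \<phi> (t, x)) has_vector_derivative Z (t, \<phi> (t, x))) (at t)"
  shows "((\<lambda>t. frechet_derivative \<phi> (at (t, x)) (0, w)) has_vector_derivative
    frechet_derivative Z (at (t, \<phi> (t, x))) (0, frechet_derivative \<phi> (at (t, x)) (0, w))) (at t)"
proof -
  have time: "frechet_derivative \<phi> (at z) (1, 0) = Z (fst z, \<phi> z)" for z
  proof -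
    obtain t x where z: "z = (t, x)" by (cases z)
    have "((\<lambda>s. \<phi> ((0, x) + s *\<^sub>R (1, 0))) has_vector_derivative frechet_derivative \<phi> (at ((0, x) + t *\<^sub>R (1, 0))) (1, 0)) (at t)"
      by (rule has_vector_derivative_along[OF smooth_has_derivative[OF \<phi>]])
    then show ?thesis using vector_derivative_unique_at[OF _ der] by (simp add: z)
  qed
  have sm: "smooth (\<lambda>z. frechet_derivative \<phi> (at z) v)" for v by (intro smooth_intros \<phi>)
  have sm2: "smooth (\<lambda>z. (fst z, \<phi> z))" by (intro smooth_intros \<phi>)
  have "frechet_derivative (\<lambda>z. frechet_derivative \<phi> (at z) (0, w)) (at (t, x)) (1, 0)
      = frechet_derivative (\<lambda>z. Z (fst z, \<phi> z)) (at (t, x)) (0, w)"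
    unfolding frechet_derivative_commute[OF \<phi>, of "(0, w)"] time ..
  also have "\<dots> = frechet_derivative Z (at (t, \<phi> (t, x))) (frechet_derivative (\<lambda>z. (fst z, \<phi> z)) (at (t, x)) (0, w))"
    using frechet_derivative_chain[OF Z sm2, of "(t, x)" "(0, w)"] by simp
  also have "frechet_derivative (\<lambda>z. (fst z, \<phi> z)) (at (t, x)) (0, w) = (0, frechet_derivative \<phi> (at (t, x)) (0, w))"
  proof -
    have "((\<lambda>z. (fst z, \<phi> z)) has_derivative (\<lambda>v. (fst v, frechet_derivative \<phi> (at (t, x)) v))) (at (t, x))"
      by (intro has_derivative_Pair has_derivative_fst has_derivative_ident smooth_has_derivative \<phi>)
    from fun_cong[OF frechet_derivative_at[OF this], of "(0, w)"] show ?thesis by simp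
  qed
  finally have eq: "frechet_derivative (\<lambda>z. frechet_derivative \<phi> (at z) (0, w)) (at (t, x)) (1, 0)
     = frechet_derivative Z (at (t, \<phi> (t, x))) (0, frechet_derivative \<phi> (at (t, x)) (0, w))" .
  have "((\<lambda>s. frechet_derivative \<phi> (at ((0, x) + s *\<^sub>R (1, 0))) (0, w)) has_vector_derivative
    frechet_derivative (\<lambda>z. frechet_derivative \<phi> (at z) (0, w)) (at ((0, x) + t *\<^sub>R (1, 0))) (1, 0)) (at t)"
    by (rule has_vector_derivative_along[OF smooth_has_derivative[OF sm]])
  then show ?thesis by (simp add: eq)
qed

text \<open>Cartan's formula in coordinates: the three summands are the differential of
  \<open>A \<bullet> X\<close> and the two slots of the exterior derivative, the last including the
  time derivative of the moving form. The first hypothesis settles the radial component of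
  \<open>W\<close>, the second the tangential one.\<close>

lemma moser_identity:
  fixes p' m h h0 h1 u hx hy ux uy q1 q2 W1 W2 r :: real
  assumes "m * (2 * h + q1 * hx + q2 * hy) = q1 * ux + q2 * uy + 2 * u"
    and "- q2 * ux + q1 * uy = h0 - h1" and "r = q1\<^sup>2 + q2\<^sup>2"
    and "X1 = p' * (m * q2)" "X2 = p' * (- (m * q1))" "dW = hx * W1 + hy * W2" "dX = p' * (h0 - h1) + hx * X1 + hy * X2"
  shows "- (p' * ((2 * q1 * W1 + 2 * q2 * W2) * u + r * (ux * W1 + uy * W2)))
      - (- (W2 * h + q2 * dW) * X1 + (W1 * h + q1 * dW) * X2)
      + (- (X2 * h + q2 * dX) * W1 + (X1 * h + q1 * dX) * W2) = 0"
proof -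
  have "- (p' * ((2 * q1 * W1 + 2 * q2 * W2) * u + r * (ux * W1 + uy * W2)))
      - (- (W2 * h + q2 * dW) * X1 + (W1 * h + q1 * dW) * X2)
      + (- (X2 * h + q2 * dX) * W1 + (X1 * h + q1 * dX) * W2)
    = p' * ((m * (2 * h + q1 * hx + q2 * hy)) * (q1 * W1 + q2 * W2) + (h0 - h1) * (q1 * W2 - q2 * W1)
       - 2 * (q1 * W1 + q2 * W2) * u - r * (ux * W1 + uy * W2))"
    unfolding assms(4-7) by (simp add: algebra_simps)
  also have "\<dots> = 0"
    unfolding assms(1) assms(2)[symmetric] assms(3) by (simp add: algebra_simps power2_eq_square)
  finally show ?thesis .
qed

text \<open>The path between the two forms is linear in \<open>h\<close>, so its area density stays
  positive. On each circle the ends differ by a function of mean zero, for which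
  \<open>rot_sawtooth\<close> supplies a primitive; hence Moser's equation has a solution whose
  horizontal part is tangent to the circles, and this field is complete.\<close>

lemma moser_isotopy:
  assumes sm: "smooth h0" and inv: "vertical_invariant h0"
    and pos: "\<And>q. 0 < 2 * h0 q + frechet_derivative h0 (at q) q"
  obtains \<Phi> where "contact_map \<Phi> (rotational_form h0) (rotational_form (rot_average h0))"
proof -
  define h1 where "h1 = rot_average h0"
  define u where "u = rot_sawtooth h0"
  have sm1: "smooth h1" and smu: "smooth u"
    by (simp_all add: h1_def u_def smooth_rot_average smooth_rot_sawtooth sm)
  have inv1: "vertical_invariant h1" and invu: "vertical_invariant u"
    by (simp_all add: h1_def u_def vertical_invariant_rot_average vertical_invariant_rot_sawtooth inv)
  define D where "D f q = (frechet_derivative f (at q) :: real^3 \<Rightarrow> real)" for f and q :: "real^3"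
  have pos1: "0 < 2 * h1 q + D h1 q q" for q
    unfolding D_def h1_def rot_average_euler[OF sm]
    by (intro rot_average_pos smooth_intros sm) (rule pos)
  define hz where "hz z = (1 - pulse (fst z)) * h1 (snd z) + pulse (fst z) * h0 (snd z)" for z
  define gz where "gz z = (1 - pulse (fst z)) * (2 * h1 (snd z) + D h1 (snd z) (snd z))
      + pulse (fst z) * (2 * h0 (snd z) + D h0 (snd z) (snd z))" for z
  have gpos: "gz z > 0" for z
  proof (cases "pulse (fst z) = 0")
    case True
    then show ?thesis using pos1 by (simp add: gz_def)
  next
    case False
    then have "pulse (fst z) > 0" using pulse_bounds(1)[of "fst z"] by simp
    from mult_pos_pos[OF this pos[of "snd z"]]
    have "0 < pulse (fst z) * (2 * h0 (snd z) + D h0 (snd z) (snd z))" by (simp add: D_def)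
    moreover have "0 \<le> (1 - pulse (fst z)) * (2 * h1 (snd z) + D h1 (snd z) (snd z))"
      using pos1[of "snd z"] pulse_bounds(2)[of "fst z"] by (intro mult_nonneg_nonneg) simp_all
    ultimately show ?thesis unfolding gz_def by linarith
  qed
  \<comment> \<open>Once \<open>A \<bullet> X\<close> is prescribed as \<open>- pulse'\<close> times
    \<open>r * u\<close>, the tangential part of Moser's equation is the sawtooth identity; this
    \<open>m\<close> is what the radial part then demands.\<close>
  define m where "m z = (D u (snd z) (snd z) + 2 * u (snd z)) / gz z" for z
  define r where "r q = (q$1)\<^sup>2 + (q$2)\<^sup>2" for q :: "real^3"
  \<comment> \<open>The vertical entry makes the terms with \<open>m\<close> cancel in
    \<open>A \<bullet> X\<close>.\<close>
  define X where "X z = pulse' (fst z) *\<^sub>R (vector [m z * snd z $ 2, - (m z * snd z $ 1), r (snd z) * (m z * hz z - u (snd z))] :: real^3)" for z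
  define A where "A z = (vector [- (snd z $ 2 * hz z), snd z $ 1 * hz z, 1] :: real^3)" for z
  have smhz: "smooth hz"
    unfolding hz_def by (intro smooth_intros smooth_pulse smooth_compose[OF sm] smooth_compose[OF sm1])
  have smgz: "smooth gz"
    unfolding gz_def D_def
    by (intro smooth_intros smooth_pulse smooth_compose[OF sm] smooth_compose[OF sm1] sm sm1)
  have smm: "smooth m"
    unfolding m_def D_def
    by (intro smooth_divide smooth_intros smooth_compose[OF smu] smgz smu) (use gpos in \<open>simp add: less_imp_neq[symmetric]\<close>)
  have smr: "smooth r" unfolding r_def by (intro smooth_intros)
  have smX: "smooth X"
    unfolding X_def by (intro smooth_intros smooth_pulse smm smhz smooth_compose[OF smr] smooth_compose[OF smu])
  have smA: "smooth A" unfolding A_def by (intro smooth_intros smhz)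
  define pr where "pr q = (vector [q$1, q$2, 0] :: real^3)" for q :: "real^3"
  have field: "seminorm_preserving_field pr X"
  proof (intro seminorm_preserving_field.intro seminorm_preserving.intro seminorm_preserving_field_axioms.intro)
    show "linear pr" by (rule linearI) (simp_all add: pr_def vec_eq_iff forall_3)
    show "pr (pr q) = pr q" for q by (simp add: pr_def)
    show "pr q \<bullet> v = q \<bullet> pr v" for q v by (simp add: pr_def inner_vec_def sum_3)
    show "pr q \<bullet> X (t, q) = 0" for t q by (simp add: pr_def X_def inner_vec_def sum_3)
    show "X (t, pr q) = X (t, q)" for t q
    proof -
      have pr: "pr q = q + (- q$3) *\<^sub>R axis 3 1" by (simp add: pr_def vec_eq_iff forall_3)
      have f: "f (pr q) = f q" if "vertical_invariant f" for f :: "real^3 \<Rightarrow> real"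
        unfolding pr by (rule vertical_invariantD[OF that])
      have df: "D f (pr q) (pr q) = D f q q" if "smooth f" "vertical_invariant f" for f
      proof -
        have "D f (pr q) = D f q"
          unfolding D_def pr by (rule frechet_vertical_invariant(2)[OF that])
        then show ?thesis
          using frechet_vertical_invariant(1)[OF that, of q "pr q"] frechet_vertical_invariant(1)[OF that, of q q]
          by (simp add: D_def) (simp add: pr_def)
      qed
      have "hz (t, pr q) = hz (t, q)" "gz (t, pr q) = gz (t, q)"
        by (simp_all add: hz_def gz_def f inv inv1 df sm sm1)
      moreover from this have "m (t, pr q) = m (t, q)"
        by (simp add: m_def f df smu invu)
      moreover have "r (pr q) = r q" "pr q $ 1 = q$1" "pr q $ 2 = q$2" by (simp_all add: r_def pr_def)
      ultimately show ?thesis by (simp add: X_def f invu)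
    qed
    show "\<exists>L\<ge>0. \<forall>t p q. norm p \<le> R \<longrightarrow> norm q \<le> R \<longrightarrow> norm (X (t, p) - X (t, q)) \<le> L * norm (p - q)" for R
      by (rule smooth_lipschitz_periodic[OF smX]) (simp add: X_def m_def hz_def gz_def)
  qed (rule smX)
  \<comment> \<open>Moser's equation. Time is the first argument of \<open>A\<close>, so its
    derivative in direction \<open>(1, X z)\<close> includes the change of the form itself.\<close>
  have pointwise: "A z \<bullet> frechet_derivative X (at z) (0, W) + frechet_derivative A (at z) (1, X z) \<bullet> W = 0" for z W
  proof -
    obtain t q where z: "z = (t, q)" by (cases z)
    have Dlin: "D f q w = D f q (axis 1 1) * w$1 + D f q (axis 2 1) * w$2" if "smooth f" "vertical_invariant f" for f w
      using frechet_vertical_invariant(1)[OF that, of q w] by (simp add: D_def mult.commute)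
    define hx where "hx = (1 - pulse t) * D h1 q (axis 1 1) + pulse t * D h0 q (axis 1 1)"
    define hy where "hy = (1 - pulse t) * D h1 q (axis 2 1) + pulse t * D h0 q (axis 2 1)"
    define ux uy where "ux = D u q (axis 1 1)" and "uy = D u q (axis 2 1)"
    define dh where "dh v = pulse' t * fst v * (h0 q - h1 q) + hx * snd v $ 1 + hy * snd v $ 2" for v :: "real \<times> (real^3)"
    have dhz: "(hz has_derivative dh) (at z)"
    proof -
      have 1: "((\<lambda>z. pulse (fst z)) has_derivative (\<lambda>v. pulse' t * fst v)) (at z)"
        using has_derivative_compose[OF has_derivative_fst[OF has_derivative_ident] DERIV_pulse[unfolded has_field_derivative_def], of z]
        by (simp add: z)
      have 2: "((\<lambda>z::real \<times> (real^3). f (snd z)) has_derivative (\<lambda>v. D f q (snd v))) (at z)" if "smooth f" for f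
        using has_derivative_compose[OF has_derivative_snd[OF has_derivative_ident] smooth_has_derivative[OF that], of z]
        by (simp add: z D_def)
      have "(hz has_derivative (\<lambda>v. ((1 - pulse t) * D h1 q (snd v) + (0 - pulse' t * fst v) * h1 q)
          + (pulse t * D h0 q (snd v) + pulse' t * fst v * h0 q))) (at z)"
        using has_derivative_add[OF has_derivative_mult[OF has_derivative_diff[OF has_derivative_const[of 1] 1] 2[OF sm1]]
            has_derivative_mult[OF 1 2[OF sm]]]
        unfolding hz_def[abs_def] z fst_conv snd_conv .
      moreover have "(\<lambda>v. ((1 - pulse t) * D h1 q (snd v) + (0 - pulse' t * fst v) * h1 q)
          + (pulse t * D h0 q (snd v) + pulse' t * fst v * h0 q)) = dh"
      proof
        fix v :: "real \<times> (real^3)"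
        show "((1 - pulse t) * D h1 q (snd v) + (0 - pulse' t * fst v) * h1 q)
          + (pulse t * D h0 q (snd v) + pulse' t * fst v * h0 q) = dh v"
          unfolding dh_def hx_def hy_def Dlin[OF sm inv, of "snd v"] Dlin[OF sm1 inv1, of "snd v"]
          by (simp add: algebra_simps)
      qed
      ultimately show ?thesis by simp
    qed
    have DA: "frechet_derivative A (at z) v = vector [- (snd v $ 2 * hz z + q$2 * dh v), snd v $ 1 * hz z + q$1 * dh v, 0]" for v
    proof -
      have c: "((\<lambda>z::real \<times> (real^3). snd z $ i) has_derivative (\<lambda>v. snd v $ i)) (at z)" for i
        by (intro bounded_linear_imp_has_derivative bounded_linear_compose[OF bounded_linear_vec_nth bounded_linear_snd])
      have "(A has_derivative (\<lambda>v. (- (snd z $ 2 * dh v + snd v $ 2 * hz z)) *\<^sub>R axis 1 1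
          + (snd z $ 1 * dh v + snd v $ 1 * hz z) *\<^sub>R axis 2 1 + 0 *\<^sub>R axis 3 1)) (at z)"
        unfolding A_def[abs_def] vector_3_axis
        by (intro has_derivative_add has_derivative_scaleR_left has_derivative_minus has_derivative_mult
            has_derivative_const c dhz)
      from fun_cong[OF frechet_derivative_at[OF this], of v] show ?thesis
        by (simp add: z vector_3_axis algebra_simps)
    qed
    define C where "C z = - (pulse' (fst z) * (r (snd z) * u (snd z)))" for z :: "real \<times> (real^3)"
    have AX: "(\<lambda>z. A z \<bullet> X z) = C"
      by (rule ext) (simp add: A_def X_def C_def inner_vec_def sum_3 r_def algebra_simps power2_eq_square)
    have smC: "smooth C"
      unfolding C_def by (intro smooth_intros smooth_pulse smooth_compose[OF smr] smooth_compose[OF smu])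
    have "((\<lambda>z. A z \<bullet> X z) has_derivative (\<lambda>v. A z \<bullet> frechet_derivative X (at z) v + frechet_derivative A (at z) v \<bullet> X z)) (at z)"
      by (intro has_derivative_inner smooth_has_derivative smA smX)
    from fun_cong[OF frechet_derivative_at[OF this], of "(0, W)"]
    have 1: "A z \<bullet> frechet_derivative X (at z) (0, W) = frechet_derivative C (at z) (0, W) - frechet_derivative A (at z) (0, W) \<bullet> X z"
      by (simp add: AX)
    have 2: "frechet_derivative C (at z) (0, W) = - (pulse' t * ((2 * q$1 * W$1 + 2 * q$2 * W$2) * u q + r q * (ux * W$1 + uy * W$2)))"
    proof -
      have i: "((\<lambda>q. (t, q)) has_derivative (\<lambda>w. (0, w))) (at q)" by (auto intro!: derivative_eq_intros)
      have comp: "((\<lambda>q. C (t, q)) has_derivative (\<lambda>w. frechet_derivative C (at z) (0, w))) (at q)"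
        using has_derivative_compose[OF i smooth_has_derivative[OF smC]] by (simp add: z)
      have "((\<lambda>q. q $ i) has_derivative (\<lambda>w. w $ i)) (at q)" for i :: 3
        by (intro bounded_linear_imp_has_derivative bounded_linear_vec_nth)
      note c2 = has_derivative_mult[OF this this]
      have dr: "(r has_derivative (\<lambda>w. (q$1 * w$1 + w$1 * q$1) + (q$2 * w$2 + w$2 * q$2))) (at q)"
        unfolding r_def[abs_def] power2_eq_square by (intro has_derivative_add c2)
      have "((\<lambda>q. - (pulse' t * (r q * u q))) has_derivative
          (\<lambda>w. - (pulse' t * (r q * D u q w + ((q$1 * w$1 + w$1 * q$1) + (q$2 * w$2 + w$2 * q$2)) * u q)))) (at q)"
        unfolding D_def
        by (intro has_derivative_minus has_derivative_mult_right has_derivative_mult dr smooth_has_derivative smu)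
      then have "((\<lambda>q. C (t, q)) has_derivative
          (\<lambda>w. - (pulse' t * (r q * D u q w + ((q$1 * w$1 + w$1 * q$1) + (q$2 * w$2 + w$2 * q$2)) * u q)))) (at q)"
        by (simp add: C_def)
      from fun_cong[OF has_derivative_unique[OF comp this], of W] show ?thesis
        unfolding Dlin[OF smu invu, of W] by (simp add: ux_def uy_def algebra_simps)
    qed
    have mg: "m z * (2 * hz z + q$1 * hx + q$2 * hy) = q$1 * ux + q$2 * uy + 2 * u q"
    proof -
      have "2 * hz z + q$1 * hx + q$2 * hy = gz z"
        unfolding gz_def using Dlin[OF sm inv, of q] Dlin[OF sm1 inv1, of q]
        by (simp add: z hz_def hx_def hy_def algebra_simps)
      moreover have "m z * gz z = D u q q + 2 * u q"
        using gpos[of z] by (simp add: m_def z)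
      ultimately show ?thesis using Dlin[OF smu invu, of q] by (simp add: ux_def uy_def algebra_simps)
    qed
    have tu: "- q$2 * ux + q$1 * uy = h0 q - h1 q"
      using frechet_rot_sawtooth_turn[OF sm, of q] Dlin[OF smu invu, of "turn q"]
      by (simp add: D_def u_def h1_def ux_def uy_def algebra_simps)
    have X12: "X z $ 1 = pulse' t * (m z * q$2)" "X z $ 2 = pulse' t * (- (m z * q$1))"
      by (simp_all add: X_def z)
    show ?thesis
      unfolding 1 2 DA
      using moser_identity[OF mg tu r_def X12, where ?W1.0="W$1" and ?W2.0="W$2" and dW="dh (0, W)" and dX="dh (1, X z)"]
      by (simp add: dh_def inner_vector_3 algebra_simps)
  qed
  interpret seminorm_preserving_field pr X by (rule field)
  obtain \<phi> where \<phi>: "smooth \<phi>" "\<And>x. \<phi> (0, x) = x"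
    "\<And>t x. ((\<lambda>t. \<phi> (t, x)) has_vector_derivative X (t, \<phi> (t, x))) (at t)"
    using flow_exists by blast
  obtain \<psi> where \<psi>: "smooth \<psi>" "\<And>x. \<psi> (\<phi> (1, x)) = x" "\<And>x. \<phi> (1, \<psi> x) = x"
    using time_one_diffeomorphism[OF \<phi>] by blast
  have inner: "frechet_derivative (\<lambda>x. \<phi> (t, x)) (at x) w = frechet_derivative \<phi> (at (t, x)) (0, w)" for t x w
  proof -
    have i: "((\<lambda>x. (t, x)) has_derivative (\<lambda>w. (0, w))) (at x)" by (auto intro!: derivative_eq_intros)
    from fun_cong[OF frechet_derivative_at[OF has_derivative_compose[OF i smooth_has_derivative[OF \<phi>(1)]]], of w]
    show ?thesis by simp
  qed
  have const: "A (1, \<phi> (1, x)) \<bullet> frechet_derivative (\<lambda>x. \<phi> (1, x)) (at x) w = A (0, x) \<bullet> w" for x w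
  proof -
    define W where "W t = frechet_derivative \<phi> (at (t, x)) (0, w)" for t
    define c where "c t = A (t, \<phi> (t, x)) \<bullet> W t" for t
    have dW: "(W has_vector_derivative frechet_derivative X (at (t, \<phi> (t, x))) (0, W t)) (at t)" for t
      unfolding W_def[abs_def] by (rule flow_variation[OF smX \<phi>(1,3)])
    have curve: "((\<lambda>t. (t, \<phi> (t, x))) has_vector_derivative (1, X (t, \<phi> (t, x)))) (at t)" for t
      by (intro has_vector_derivative_Pair has_vector_derivative_id \<phi>(3))
    have "(c has_vector_derivative 0) (at t)" for t
      unfolding c_def[abs_def]
      by (rule has_vector_derivative_eq_rhs[OF has_vector_derivative_inner[OF has_vector_derivative_smooth_compose[OF smA curve] dW]])
        (rule pointwise)
    then have "(c has_real_derivative 0) (at t)" for t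
      by (simp add: has_real_derivative_iff_has_vector_derivative)
    then have "c 1 = c 0"
      using DERIV_const_ratio_const[of 1 0 c 0] by auto
    moreover have "W 0 = w"
      using inner[of 0 x w] by (simp add: W_def \<phi>(2))
    ultimately show ?thesis by (simp add: c_def \<phi>(2) inner) (simp add: W_def)
  qed
  have "contact_map (\<lambda>x. \<phi> (1, x)) (rotational_form h0) (rotational_form h1)"
    unfolding contact_map_def diffeomorphism_def
  proof (intro conjI exI[of _ \<psi>] exI[of _ "\<lambda>_. 1"] allI)
    show "smooth (\<lambda>x. \<phi> (1, x))" by (intro smooth_compose[OF \<phi>(1)] smooth_intros)
    show "rotational_form h0 (\<phi> (1, q)) \<bullet> frechet_derivative (\<lambda>x. \<phi> (1, x)) (at q) w = 1 * (rotational_form h1 q \<bullet> w)" for q w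
      using const[of q w] by (simp add: A_def hz_def rotational_form_def)
  qed (simp_all add: \<psi>)
  then show thesis using that by (simp add: h1_def)
qed

subsection \<open>Smooth inverses\<close>

lemma Ck_cross3:
  assumes "Ck k f" "Ck k g"
  shows "Ck k (\<lambda>x. cross3 (f x) (g x))"
proof -
  have c: "Ck k (\<lambda>x. f x $ i)" "Ck k (\<lambda>x. g x $ i)" for i
    using Ck_linear_compose[OF bounded_linear_vec_nth] assms by blast+
  show ?thesis
    unfolding cross3_def vector_3_axis by (intro Ck_add Ck_diff Ck_mult Ck_scaleR Ck_const c)
qed

text \<open>Cramer's rule: the inverse of a derivative is a rational expression in its columns, from
  which C^k regularity can be read off.\<close>

lemma cramer_cross3:
  assumes "linear (L :: real^3 \<Rightarrow> real^3)"
    and "d = L (axis 3 1) \<bullet> cross3 (L (axis 1 1)) (L (axis 2 1))" "d \<noteq> 0"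
  shows "w = (L w \<bullet> cross3 (L (axis 2 1)) (L (axis 3 1)) / d) *\<^sub>R axis 1 1
     + (L w \<bullet> cross3 (L (axis 3 1)) (L (axis 1 1)) / d) *\<^sub>R axis 2 1
     + (L w \<bullet> cross3 (L (axis 1 1)) (L (axis 2 1)) / d) *\<^sub>R axis 3 1"
proof -
  have d: "L (axis 1 1) \<bullet> cross3 (L (axis 2 1)) (L (axis 3 1)) = d" "L (axis 2 1) \<bullet> cross3 (L (axis 3 1)) (L (axis 1 1)) = d"
    unfolding assms(2) by (metis cross_triple inner_commute)+
  have "L w \<bullet> cross3 (L (axis 2 1)) (L (axis 3 1)) = w$1 * d"
    "L w \<bullet> cross3 (L (axis 3 1)) (L (axis 1 1)) = w$2 * d"
    "L w \<bullet> cross3 (L (axis 1 1)) (L (axis 2 1)) = w$3 * d"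
    unfolding linear_vec3[OF assms(1), of w]
    by (simp_all add: inner_add_left d assms(2)[symmetric] dot_cross_self)
  then show ?thesis using assms(3) vec3_axis[of w] by simp
qed

text \<open>The inverse function theorem supplies differentiability. The derivative of
  \<open>\<psi>\<close> is rational in that of \<open>\<phi>\<close> evaluated at
  \<open>\<psi>\<close>, so each order of regularity of \<open>\<psi>\<close> yields the
  next.\<close>

lemma smooth_inverse:
  fixes \<phi> :: "real^3 \<Rightarrow> real^3"
  assumes sm: "smooth \<phi>" and left: "\<And>x. \<psi> (\<phi> x) = x" and right: "\<And>x. \<phi> (\<psi> x) = x"
    and inj: "\<And>x. inj (frechet_derivative \<phi> (at x))"
  shows "smooth \<psi>"
proof -
  define D where "D x = frechet_derivative \<phi> (at x)" for x
  have lin: "linear (D x)" for x unfolding D_def by (rule smooth_frechet_linear[OF sm])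
  have "\<exists>B. \<forall>x. linear (B x) \<and> (\<forall>v. B x (D x v) = v) \<and> (\<forall>v. D x (B x v) = v)"
    using linear_injective_isomorphism[OF lin inj[folded D_def]] by (intro choice allI) blast
  then obtain B where B: "\<And>x v. B x (D x v) = v" "\<And>x v. D x (B x v) = v" by blast
  have der: "(\<psi> has_derivative B (\<psi> y)) (at y)" for y
  proof -
    have "(\<psi> has_derivative B (\<psi> y)) (at (\<phi> (\<psi> y)))"
      by (rule has_derivative_inverse_strong[of UNIV _ \<phi> \<psi> "D (\<psi> y)"])
        (auto simp: left smooth_continuous_on[OF sm] B(2)[unfolded D_def] fun_eq_iff D_def smooth_has_derivative[OF sm])
    then show ?thesis by (simp add: right)
  qed
  define d where "d x = D x (axis 3 1) \<bullet> cross3 (D x (axis 1 1)) (D x (axis 2 1))" for x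
  have d: "d x \<noteq> 0" for x
  proof -
    have "surj (D x)" using B(2) by (metis surjI)
    then show ?thesis
      unfolding d_def by (intro triple_product_nonzero lin inj[folded D_def])
  qed
  have "Ck k \<psi>" for k
  proof (induction k)
    case 0
    show ?case using has_derivative_continuous_on[OF has_derivative_at_withinI[OF der]] by simp
  next
    case (Suc k)
    have C: "Ck k (\<lambda>y. D (\<psi> y) v)" for v
    proof -
      have "smooth (\<lambda>x. D x v)" unfolding D_def by (intro smooth_intros sm)
      then have "Ck k (\<lambda>x. D x v)" by (simp add: smooth_def)
      from Ck_compose[OF this Suc.IH] show ?thesis .
    qed
    show ?case
    proof (rule Ck_SucI[OF der])
      fix v
      have eq: "B (\<psi> y) v = (v \<bullet> cross3 (D (\<psi> y) (axis 2 1)) (D (\<psi> y) (axis 3 1)) / d (\<psi> y)) *\<^sub>R axis 1 1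
         + (v \<bullet> cross3 (D (\<psi> y) (axis 3 1)) (D (\<psi> y) (axis 1 1)) / d (\<psi> y)) *\<^sub>R axis 2 1
         + (v \<bullet> cross3 (D (\<psi> y) (axis 1 1)) (D (\<psi> y) (axis 2 1)) / d (\<psi> y)) *\<^sub>R axis 3 1" for y
        using cramer_cross3[OF lin[of "\<psi> y"] d_def d, where w="B (\<psi> y) v"] unfolding B(2) .
      have Cd: "Ck k (\<lambda>y. d (\<psi> y))" unfolding d_def by (intro Ck_inner Ck_cross3 C)
      show "Ck k (\<lambda>y. B (\<psi> y) v)"
        unfolding eq by (intro Ck_add Ck_scaleR Ck_divide Ck_inner Ck_cross3 Ck_const C Cd d)
    qed
  qed
  then show ?thesis by (simp add: smooth_def)
qed

subsection \<open>Rotationally invariant forms are standard\<close>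

text \<open>Turns invariance under rotations and vertical translations into dependence on the radius
  alone.\<close>

lemma same_radius_rot:
  fixes p q :: "real^3"
  assumes "(p$1)\<^sup>2 + (p$2)\<^sup>2 = (q$1)\<^sup>2 + (q$2)\<^sup>2"
  shows "\<exists>s t. p = rot s q + t *\<^sub>R axis 3 1"
proof (cases "(q$1)\<^sup>2 + (q$2)\<^sup>2 = 0")
  case True
  then have "q$1 = 0" "q$2 = 0" "p$1 = 0" "p$2 = 0"
    using assms by (simp_all add: sum_power2_eq_zero_iff)
  then show ?thesis
    by (intro exI[of _ 0] exI[of _ "p$3 - q$3"]) (simp add: vec_eq_iff forall_3)
next
  case False
  define r where "r = (q$1)\<^sup>2 + (q$2)\<^sup>2"
  have r: "r \<noteq> 0" using False by (simp add: r_def)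
  \<comment> \<open>Real and imaginary part of the quotient of the horizontal parts of
    \<open>p\<close> and \<open>q\<close>, read as complex numbers; equal radii make its modulus
    1.\<close>
  define c s where "c = (q$1 * p$1 + q$2 * p$2) / r" and "s = (q$1 * p$2 - q$2 * p$1) / r"
  have "(q$1 * p$1 + q$2 * p$2)\<^sup>2 + (q$1 * p$2 - q$2 * p$1)\<^sup>2 = ((q$1)\<^sup>2 + (q$2)\<^sup>2) * ((p$1)\<^sup>2 + (p$2)\<^sup>2)"
    by (simp add: power2_eq_square algebra_simps)
  then have "(q$1 * p$1 + q$2 * p$2)\<^sup>2 + (q$1 * p$2 - q$2 * p$1)\<^sup>2 = r\<^sup>2"
    unfolding assms by (simp add: r_def power2_eq_square)
  then have "c\<^sup>2 + s\<^sup>2 = 1"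
    unfolding c_def s_def power_divide using r by (simp add: add_divide_distrib[symmetric])
  then obtain a where a: "c = cos a" "s = sin a" using sincos_total_2pi by metis
  have "(c * q$1 - s * q$2) * r = p$1 * r" "(s * q$1 + c * q$2) * r = p$2 * r"
  proof -
    have cr: "c * r = q$1 * p$1 + q$2 * p$2" "s * r = q$1 * p$2 - q$2 * p$1"
      using r by (simp_all add: c_def s_def)
    have "(c * q$1 - s * q$2) * r = (c * r) * q$1 - (s * r) * q$2"
      "(s * q$1 + c * q$2) * r = (s * r) * q$1 + (c * r) * q$2" by (simp_all add: algebra_simps)
    then show "(c * q$1 - s * q$2) * r = p$1 * r" "(s * q$1 + c * q$2) * r = p$2 * r"
      unfolding cr by (simp_all add: r_def power2_eq_square algebra_simps)
  qed
  then have "p$1 = c * q$1 - s * q$2" "p$2 = s * q$1 + c * q$2" using r by simp_all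
  then show ?thesis
    by (intro exI[of _ a] exI[of _ "p$3 - q$3"]) (simp add: vec_eq_iff forall_3 a)
qed

lemma rotation_identities:
  fixes t x y :: real
  shows "(cos t * x - sin t * y)\<^sup>2 + (sin t * x + cos t * y)\<^sup>2 = x\<^sup>2 + y\<^sup>2"
    and "cos t * (cos t * x - sin t * y) + sin t * (sin t * x + cos t * y) = x"
    and "cos t * (sin t * x + cos t * y) - sin t * (cos t * x - sin t * y) = y"
proof -
  have "(C * x - S * y)\<^sup>2 + (S * x + C * y)\<^sup>2 = (S\<^sup>2 + C\<^sup>2) * (x\<^sup>2 + y\<^sup>2)"
    "C * (C * x - S * y) + S * (S * x + C * y) = (S\<^sup>2 + C\<^sup>2) * x"
    "C * (S * x + C * y) - S * (C * x - S * y) = (S\<^sup>2 + C\<^sup>2) * y" for C S :: real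
    by (simp_all add: power2_eq_square algebra_simps)
  from this[of "cos t" "sin t"] show
    "(cos t * x - sin t * y)\<^sup>2 + (sin t * x + cos t * y)\<^sup>2 = x\<^sup>2 + y\<^sup>2"
    "cos t * (cos t * x - sin t * y) + sin t * (sin t * x + cos t * y) = x"
    "cos t * (sin t * x + cos t * y) - sin t * (cos t * x - sin t * y) = y"
    by simp_all
qed

lemma parallel_identities:
  fixes q1 q2 w1 w2 :: real
  assumes "q1 * w2 = q2 * w1"
  shows "(q1 * w1 + q2 * w2) * q1 = (q1\<^sup>2 + q2\<^sup>2) * w1" "(q1 * w1 + q2 * w2) * q2 = (q1\<^sup>2 + q2\<^sup>2) * w2"
proof -
  have "(q1 * w1 + q2 * w2) * q1 = q1\<^sup>2 * w1 + q2 * (q1 * w2)" by (simp add: algebra_simps power2_eq_square)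
  also have "\<dots> = (q1\<^sup>2 + q2\<^sup>2) * w1" unfolding assms by (simp add: algebra_simps power2_eq_square)
  finally show "(q1 * w1 + q2 * w2) * q1 = (q1\<^sup>2 + q2\<^sup>2) * w1" .
  have "(q1 * w1 + q2 * w2) * q2 = q1 * (q2 * w1) + q2\<^sup>2 * w2" by (simp add: algebra_simps power2_eq_square)
  also have "\<dots> = (q1\<^sup>2 + q2\<^sup>2) * w2" unfolding assms[symmetric] by (simp add: algebra_simps power2_eq_square)
  finally show "(q1 * w1 + q2 * w2) * q2 = (q1\<^sup>2 + q2\<^sup>2) * w2" .
qed

text \<open>Evaluates x dy - y dx on the derivative of a map that rotates with speed
  \<open>c\<close> in the height and stretches by \<open>\<rho>\<close>. A radial change does not
  affect the angle, so the derivative \<open>d\<close> of the stretching cancels.\<close>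

lemma twist_identity:
  fixes C S \<rho> c d q1 q2 w1 w2 w3 :: real
  assumes "C\<^sup>2 + S\<^sup>2 = 1" "a = C * q1 - S * q2" "b = S * q1 + C * q2"
  shows "- (\<rho> * b) * (d * a + \<rho> * (C * w1 - S * w2 - c * w3 * b)) + \<rho> * a * (d * b + \<rho> * (S * w1 + C * w2 + c * w3 * a))
     = \<rho>\<^sup>2 * ((q1 * w2 - q2 * w1) + c * w3 * (q1\<^sup>2 + q2\<^sup>2))"
proof -
  have "- (\<rho> * b) * (d * a + \<rho> * (C * w1 - S * w2 - c * w3 * b)) + \<rho> * a * (d * b + \<rho> * (S * w1 + C * w2 + c * w3 * a))
    = \<rho>\<^sup>2 * ((C\<^sup>2 + S\<^sup>2) * ((q1 * w2 - q2 * w1) + c * w3 * (q1\<^sup>2 + q2\<^sup>2)))"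
    unfolding assms(2,3) by (simp add: power2_eq_square algebra_simps)
  then show ?thesis using assms(1) by simp
qed

text \<open>If the area function \<^term>\<open>H\<close>, the coefficient of the polar angle form, stays below \<^term>\<open>1 / c\<close>, then in
  a frame rotating at speed \<^term>\<open>c\<close> along the vertical axis it becomes \<^term>\<open>H / (1 - c * H)\<close>, which is unbounded
  when \<^term>\<open>1 / c\<close> is the supremum of \<^term>\<open>H\<close>. This treats finite and infinite total area alike.\<close>

lemma rotational_form_standard:
  assumes sm: "smooth h" and inv: "vertical_invariant h" and rotinv: "\<And>s q. h (rot s q) = h q"
    and pos: "\<And>q. 0 < 2 * h q + frechet_derivative h (at q) q"
  obtains K where "contact_map K (rotational_form (\<lambda>_. 1)) (rotational_form h)"
proof -
  define r where "r q = (q$1)\<^sup>2 + (q$2)\<^sup>2" for q :: "real^3"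
  define H where "H q = r q * h q" for q
  have r0: "0 \<le> r q" for q by (simp add: r_def)
  have rz: "q$1 = 0 \<and> q$2 = 0" if "r q = 0" for q using that by (simp add: r_def sum_power2_eq_zero_iff)
  have rsc: "r (t *\<^sub>R q) = t\<^sup>2 * r q" for t q by (simp add: r_def power_mult_distrib ring_distribs)
  have hr: "h p = h q" if "r p = r q" for p q
    using same_radius_rot[of p q] that rotinv vertical_invariantD[OF inv] unfolding r_def by metis
  have Hr: "H p = H q" if "r p = r q" for p q using hr[OF that] that by (simp add: H_def)
  have smr: "smooth r" unfolding r_def by (intro smooth_intros)
  have smH: "smooth H" unfolding H_def by (intro smooth_intros smr sm)
  \<comment> \<open>Along a ray the derivative of \<open>H\<close> is a positive multiple of the
    area density, so \<open>H\<close> increases strictly with the radius.\<close>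
  have ray: "H (s *\<^sub>R q) < H (t *\<^sub>R q)" if "0 \<le> s" "s < t" "0 < r q" for s t q
  proof (rule DERIV_pos_imp_increasing_open[OF that(2)])
    fix x assume x: "s < x" "x < t"
    have "((\<lambda>t. h (t *\<^sub>R q)) has_real_derivative frechet_derivative h (at (x *\<^sub>R q)) q) (at x)"
      using has_vector_derivative_ray[OF sm] by (simp add: has_real_derivative_iff_has_vector_derivative)
    then have "((\<lambda>t. t\<^sup>2 * r q * h (t *\<^sub>R q)) has_real_derivative
        x * r q * (2 * h (x *\<^sub>R q) + x * frechet_derivative h (at (x *\<^sub>R q)) q)) (at x)"
      by (auto intro!: derivative_eq_intros simp: algebra_simps power2_eq_square)
    moreover have "x * frechet_derivative h (at (x *\<^sub>R q)) q = frechet_derivative h (at (x *\<^sub>R q)) (x *\<^sub>R q)"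
      by (simp add: linear_scale[OF smooth_frechet_linear[OF sm]])
    ultimately have "((\<lambda>t. H (t *\<^sub>R q)) has_real_derivative
        x * r q * (2 * h (x *\<^sub>R q) + frechet_derivative h (at (x *\<^sub>R q)) (x *\<^sub>R q))) (at x)"
      by (simp add: H_def rsc)
    moreover have "0 < x * r q * (2 * h (x *\<^sub>R q) + frechet_derivative h (at (x *\<^sub>R q)) (x *\<^sub>R q))"
      using x that pos by (intro mult_pos_pos) auto
    ultimately show "\<exists>y. ((\<lambda>t. H (t *\<^sub>R q)) has_real_derivative y) (at x) \<and> 0 < y" by blast
  next
    show "continuous_on {s..t} (\<lambda>t. H (t *\<^sub>R q))"
      by (intro smooth_continuous_on smooth_compose[OF smH] smooth_intros)
  qed
  have H0: "H q = 0" if "r q = 0" for q using that by (simp add: H_def)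
  have Hpos: "0 < H q" if "0 < r q" for q
    using ray[of 0 1 q] that H0[of 0] rsc[of 0 q] by simp
  have Hmono: "H p < H q" if "r p < r q" for p q
  proof -
    have rq: "0 < r q" using r0[of p] that by linarith
    define t where "t = sqrt (r p / r q)"
    have t: "0 \<le> t" "t < 1" using that rq r0[of p] by (simp_all add: t_def)
    have "r (t *\<^sub>R q) = r p" using rq r0[of p] by (simp add: rsc t_def)
    then have "H p = H (t *\<^sub>R q)" using Hr by metis
    also have "\<dots> < H (1 *\<^sub>R q)" by (rule ray[OF t rq])
    finally show ?thesis by simp
  qed
  have hpos: "0 < h q" for q
  proof (cases "r q = 0")
    case True
    then have "frechet_derivative h (at q) q = 0"
      using frechet_vertical_invariant(1)[OF sm inv, of q q] rz[OF True] by simp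
    then show ?thesis using pos[of q] by simp
  next
    case False
    then have "0 < r q" using r0[of q] by simp
    with Hpos[OF this] show ?thesis by (simp add: H_def zero_less_mult_iff)
  qed
  define I where "I = (\<lambda>q. 1 / H q) ` {q. 0 < r q}"
  \<comment> \<open>The reciprocal of the supremum of \<open>H\<close>; it is 0 when
    \<open>H\<close> is unbounded, and then the frame does not rotate.\<close>
  define c where "c = Inf I"
  have bdd: "bdd_below I"
    unfolding I_def by (rule bdd_belowI[of _ 0]) (auto intro!: divide_nonneg_pos Hpos)
  have "r (axis 1 1) = 1" by (simp add: r_def)
  then have ne: "I \<noteq> {}" unfolding I_def by (metis (mono_tags) empty_is_image empty_iff mem_Collect_eq zero_less_one)
  have c0: "0 \<le> c"
    unfolding c_def using ne by (rule cInf_greatest) (auto simp: I_def intro!: divide_nonneg_pos Hpos)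
  \<comment> \<open>Strict because the supremum is not attained: off the axis, \<open>H\<close> is
    larger still at twice the radius.\<close>
  have cH: "c * H q < 1" for q
  proof (cases "r q = 0")
    case True
    then show ?thesis by (simp add: H0)
  next
    case False
    then have rq: "0 < r q" using r0[of q] by simp
    then have r2: "0 < r (2 *\<^sub>R q)" by (simp add: rsc)
    have "c \<le> 1 / H (2 *\<^sub>R q)" unfolding c_def by (rule cInf_lower[OF _ bdd]) (use r2 in \<open>auto simp: I_def\<close>)
    also have "\<dots> < 1 / H q"
      using Hmono[of q "2 *\<^sub>R q"] Hpos[OF rq] rq by (intro divide_strict_left_mono mult_pos_pos) (auto simp: rsc intro: Hpos)
    finally show ?thesis using Hpos[OF rq] by (simp add: field_simps)
  qed
  define e where "e q = 1 - c * H q" for q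
  have e: "0 < e q" for q using cH by (simp add: e_def)
  have sme: "smooth e" unfolding e_def by (intro smooth_intros smH)
  define B where "B q = H q / e q" for q
  have Br: "B p = B q" if "r p = r q" for p q using Hr[OF that] by (simp add: B_def e_def)
  have Binj: "r p = r q" if "B p = B q" for p q
  proof -
    have "H p * e q = H q * e p" using that e[of p] e[of q] by (simp add: B_def frac_eq_eq)
    then have "H p = H q" by (simp add: e_def algebra_simps)
    then show ?thesis using Hmono[of p q] Hmono[of q p] by (cases "r p" "r q" rule: linorder_cases) auto
  qed
  \<comment> \<open>Since \<open>c\<close> is an infimum, some \<open>1 / H q\<close> lies below
    \<open>c + 1 / y\<close>, which rearranges to \<open>y < B q\<close>. Surjectivity of
    \<open>K\<close> rests on this.\<close>
  have Bunb: "\<exists>q. 0 < r q \<and> y < B q" if "0 < y" for y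
  proof -
    have "Inf I < c + 1 / y" using that by (simp add: c_def)
    then obtain x where "x \<in> I" "x < c + 1 / y" using cInf_lessD[OF ne] by blast
    then obtain q where q: "0 < r q" "1 / H q < c + 1 / y" by (auto simp: I_def)
    have "y < B q"
      using q(2) Hpos[OF q(1)] e[of q] that by (simp add: B_def e_def field_simps)
    then show ?thesis using q(1) by blast
  qed
  have smB: "smooth B"
    unfolding B_def by (intro smooth_divide smH sme) (use e in \<open>simp add: less_imp_neq[symmetric]\<close>)
  \<comment> \<open>The stretching that sends the squared radius \<open>r\<close> to
    \<open>B\<close>. Written with \<open>h\<close> instead of \<open>H / r\<close> it is smooth on
    the axis as well.\<close>
  define \<rho> where "\<rho> q = sqrt (h q / e q)" for q
  have \<rho>: "0 < \<rho> q" "(\<rho> q)\<^sup>2 = h q / e q" "(\<rho> q)\<^sup>2 * r q = B q" for q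
    using hpos[of q] e[of q] by (simp_all add: \<rho>_def B_def H_def)
  have \<rho>r: "\<rho> p = \<rho> q" if "r p = r q" for p q
    using hr[OF that] Hr[OF that] by (simp add: \<rho>_def e_def)
  have sm\<rho>: "smooth \<rho>"
    unfolding \<rho>_def using hpos e
    by (intro smooth_sqrt smooth_divide sm sme) (simp_all add: less_imp_neq[symmetric])
  define ka where "ka q = cos (c * q$3) * q$1 - sin (c * q$3) * q$2" for q :: "real^3"
  define kb where "kb q = sin (c * q$3) * q$1 + cos (c * q$3) * q$2" for q :: "real^3"
  define K where "K q = (vector [\<rho> q * ka q, \<rho> q * kb q, q$3] :: real^3)" for q
  have smK: "smooth K" unfolding K_def ka_def kb_def by (intro smooth_intros sm\<rho>)
  have rK: "r (K q) = B q" for q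
  proof -
    have "(ka q)\<^sup>2 + (kb q)\<^sup>2 = r q"
      unfolding ka_def kb_def r_def by (rule rotation_identities)
    then have "r (K q) = (\<rho> q)\<^sup>2 * r q"
      by (simp add: r_def K_def power_mult_distrib ring_distribs[symmetric])
    then show ?thesis using \<rho>(3) by simp
  qed
  have unrot: "cos (c * q$3) * ka q + sin (c * q$3) * kb q = q$1" "cos (c * q$3) * kb q - sin (c * q$3) * ka q = q$2" for q
    unfolding ka_def kb_def by (rule rotation_identities)+
  have injK: "p = q" if eq: "K p = K q" for p q
  proof -
    have 3: "p$3 = q$3" using arg_cong[OF eq, of "\<lambda>v. v$3"] by (simp add: K_def)
    have "B p = B q" using arg_cong[OF eq, of r] by (simp add: rK)
    then have "\<rho> p = \<rho> q" by (intro \<rho>r Binj)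
    then have "ka p = ka q" "kb p = kb q"
      using arg_cong[OF eq, of "\<lambda>v. v$1"] arg_cong[OF eq, of "\<lambda>v. v$2"] \<rho>(1)[of q] by (simp_all add: K_def)
    then have "p$1 = q$1" "p$2 = q$2" using unrot[of p] unrot[of q] 3 by auto
    then show ?thesis using 3 by (simp add: vec_eq_iff forall_3)
  qed
  have surjK: "\<exists>q. K q = y" for y
  proof (cases "r y = 0")
    case True
    then show ?thesis using rz[OF True]
      by (intro exI[of _ y]) (simp add: K_def ka_def kb_def vec_eq_iff forall_3)
  next
    case False
    then have ry: "0 < r y" using r0[of y] by simp
    \<comment> \<open>Undo the rotation at the height of \<open>y\<close>. Up to height, the
      preimage lies on the ray through \<open>x\<close>, at a distance found by the intermediate
      value theorem.\<close>
    define x where "x = rot (- (c * y$3)) y"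
    have x: "rot (c * y$3) x = y" by (simp add: x_def rot_rot)
    have rx: "r x = r y"
      unfolding r_def x_def rot_simps by (rule rotation_identities)
    obtain q' where q': "0 < r q'" "r y < B q'" using Bunb[OF ry] by blast
    define t1 where "t1 = sqrt (r q' / r x)"
    have t1: "0 \<le> t1" by (simp add: t1_def r0)
    have "r (t1 *\<^sub>R x) = r q'" using ry rx r0[of q'] by (simp add: rsc t1_def)
    from Br[OF this] have "r y \<le> B (t1 *\<^sub>R x)" using q'(2) by simp
    moreover have "B (0 *\<^sub>R x) \<le> r y" using ry by (simp add: B_def H_def r_def)
    moreover have "continuous_on {0..t1} (\<lambda>t. B (t *\<^sub>R x))"
      by (intro smooth_continuous_on smooth_compose[OF smB] smooth_intros)
    ultimately obtain t where t: "0 \<le> t" "B (t *\<^sub>R x) = r y"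
      using IVT'[of "\<lambda>t. B (t *\<^sub>R x)" 0 "r y" t1] t1 by auto
    define q where "q = (vector [t * x$1, t * x$2, y$3] :: real^3)"
    have rq: "r q = r (t *\<^sub>R x)" by (simp add: r_def q_def)
    have "(\<rho> q)\<^sup>2 * (t\<^sup>2 * r y) = r y" using \<rho>(3)[of q] Br[OF rq] t(2) by (simp add: rq rsc rx)
    then have "(\<rho> q * t)\<^sup>2 = 1" using ry by (simp add: power_mult_distrib)
    moreover have "0 \<le> \<rho> q * t" using \<rho>(1)[of q] t(1) by simp
    ultimately have "\<rho> q * t = 1" by (simp add: power2_eq_1_iff)
    then have one: "\<rho> q * (t * z) = z" for z by (simp add: mult.assoc[symmetric])
    have "K q = rot (c * y$3) x"
    proof -
      have 3: "q$1 = t * x$1" "q$2 = t * x$2" "q$3 = y$3" "x$3 = y$3" by (simp_all add: q_def x_def)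
      have "\<rho> q * ka q = cos (c * y$3) * (\<rho> q * (t * x$1)) - sin (c * y$3) * (\<rho> q * (t * x$2))"
        unfolding ka_def 3 by (simp only: right_diff_distrib mult.left_commute)
      moreover have "\<rho> q * kb q = sin (c * y$3) * (\<rho> q * (t * x$1)) + cos (c * y$3) * (\<rho> q * (t * x$2))"
        unfolding kb_def 3 by (simp only: distrib_left mult.left_commute)
      ultimately have "\<rho> q * ka q = cos (c * y$3) * x$1 - sin (c * y$3) * x$2"
        "\<rho> q * kb q = sin (c * y$3) * x$1 + cos (c * y$3) * x$2"
        by (simp_all only: one)
      then show ?thesis by (simp only: K_def rot_def 3)
    qed
    then have "K q = y" by (simp only: x)
    then show ?thesis by blast
  qed
  define \<psi> where "\<psi> = inv K"
  have \<psi>: "\<psi> (K q) = q" "K (\<psi> q) = q" for q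
  proof -
    have "inj K" by (rule injI) (rule injK)
    then show "\<psi> (K q) = q" unfolding \<psi>_def by (rule inv_f_f)
    have "q \<in> range K" using surjK[of q] by (metis rangeI)
    then show "K (\<psi> q) = q" unfolding \<psi>_def by (rule f_inv_into_f)
  qed
  have DK: "frechet_derivative K (at q) w $ 1 = frechet_derivative \<rho> (at q) w * ka q
        + \<rho> q * (cos (c * q$3) * w$1 - sin (c * q$3) * w$2 - c * w$3 * kb q)"
    "frechet_derivative K (at q) w $ 2 = frechet_derivative \<rho> (at q) w * kb q
        + \<rho> q * (sin (c * q$3) * w$1 + cos (c * q$3) * w$2 + c * w$3 * ka q)"
    "frechet_derivative K (at q) w $ 3 = w$3" for q w
  proof -
    have n: "((\<lambda>q. q $ i) has_derivative (\<lambda>w. w $ i)) (at q)" for i :: 3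
      by (intro bounded_linear_imp_has_derivative bounded_linear_vec_nth)
    have cn: "((\<lambda>q::real^3. c * q$3) has_derivative (\<lambda>w. c * w$3)) (at q)"
      by (rule has_derivative_mult_right[OF n])
    have co: "((\<lambda>q::real^3. cos (c * q$3)) has_derivative (\<lambda>w. - sin (c * q$3) * (c * w$3))) (at q)"
      using has_derivative_compose[OF cn DERIV_cos[unfolded has_field_derivative_def]] by simp
    have si: "((\<lambda>q::real^3. sin (c * q$3)) has_derivative (\<lambda>w. cos (c * q$3) * (c * w$3))) (at q)"
      using has_derivative_compose[OF cn DERIV_sin[unfolded has_field_derivative_def]] by simp
    have a: "(ka has_derivative (\<lambda>w. (cos (c * q$3) * w$1 + - sin (c * q$3) * (c * w$3) * q$1)
        - (sin (c * q$3) * w$2 + cos (c * q$3) * (c * w$3) * q$2))) (at q)"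
      unfolding ka_def[abs_def] by (intro has_derivative_diff has_derivative_mult n co si)
    have b: "(kb has_derivative (\<lambda>w. (sin (c * q$3) * w$1 + cos (c * q$3) * (c * w$3) * q$1)
        + (cos (c * q$3) * w$2 + - sin (c * q$3) * (c * w$3) * q$2))) (at q)"
      unfolding kb_def[abs_def] by (intro has_derivative_add has_derivative_mult n co si)
    have comp: "((\<lambda>q. K q $ i) has_derivative (\<lambda>w. frechet_derivative K (at q) w $ i)) (at q)" for i
      by (rule bounded_linear.has_derivative[OF bounded_linear_vec_nth smooth_has_derivative[OF smK]])
    note \<rho>' = smooth_has_derivative[OF sm\<rho>, of q]
    show "frechet_derivative K (at q) w $ 1 = frechet_derivative \<rho> (at q) w * ka q
        + \<rho> q * (cos (c * q$3) * w$1 - sin (c * q$3) * w$2 - c * w$3 * kb q)"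
      using fun_cong[OF has_derivative_unique[OF comp[of 1, unfolded K_def vector_3] has_derivative_mult[OF \<rho>' a]], of w]
      unfolding K_def[symmetric] by (simp add: kb_def algebra_simps)
    show "frechet_derivative K (at q) w $ 2 = frechet_derivative \<rho> (at q) w * kb q
        + \<rho> q * (sin (c * q$3) * w$1 + cos (c * q$3) * w$2 + c * w$3 * ka q)"
      using fun_cong[OF has_derivative_unique[OF comp[of 2, unfolded K_def vector_3] has_derivative_mult[OF \<rho>' b]], of w]
      unfolding K_def[symmetric] by (simp add: ka_def algebra_simps)
    show "frechet_derivative K (at q) w $ 3 = w$3"
      using fun_cong[OF has_derivative_unique[OF comp[of 3, unfolded K_def vector_3] n], of w]
      unfolding K_def[symmetric] by simp
  qed
  \<comment> \<open>In polar terms the pullback is dz + B (d\<theta> + c dz); as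
    \<open>1 + c * B = 1 / e\<close> and \<open>B = H / e\<close>, this is \<open>1 / e\<close>
    times dz + H d\<theta>.\<close>
  have form: "rotational_form (\<lambda>_. 1) (K q) \<bullet> frechet_derivative K (at q) w = 1 / e q * (rotational_form h q \<bullet> w)" for q w
  proof -
    have "rotational_form (\<lambda>_. 1) (K q) \<bullet> frechet_derivative K (at q) w
      = (\<rho> q)\<^sup>2 * ((q$1 * w$2 - q$2 * w$1) + c * w$3 * r q) + w$3"
      using twist_identity[OF _ ka_def kb_def, of q "\<rho> q" "frechet_derivative \<rho> (at q) w" "w$1" "w$2" c "w$3"]
      unfolding rotational_form_def inner_vector_3 DK r_def by (simp add: K_def)
    also have "\<dots> = (\<rho> q)\<^sup>2 * (q$1 * w$2 - q$2 * w$1) + (1 + c * ((\<rho> q)\<^sup>2 * r q)) * w$3"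
      by (simp add: algebra_simps)
    also have "1 + c * ((\<rho> q)\<^sup>2 * r q) = 1 / e q"
      unfolding \<rho>(3) B_def using e[of q] by (simp add: field_simps) (simp add: e_def)
    also have "(\<rho> q)\<^sup>2 * (q$1 * w$2 - q$2 * w$1) + 1 / e q * w$3 = 1 / e q * (rotational_form h q \<bullet> w)"
      unfolding \<rho>(2) rotational_form_def inner_vector_3 using e[of q] by (simp add: field_simps)
    finally show ?thesis .
  qed
  \<comment> \<open>A kernel vector has no vertical entry, and the pulled back form leaves it no
    angular one off the axis. It is then radial, a direction in which the radius of \<open>K\<close>
    has positive derivative.\<close>
  have ker: "w = 0" if z: "frechet_derivative K (at q) w = 0" for q w
  proof -
    have w3: "w$3 = 0" using z DK(3)[of q w] by simp
    have "rotational_form h q \<bullet> w = 0" using form[of q w] z e[of q] by simp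
    then have "h q * (q$1 * w$2 - q$2 * w$1) = 0"
      by (simp add: rotational_form_def inner_vector_3 w3 algebra_simps)
    then have par: "q$1 * w$2 = q$2 * w$1" using hpos[of q] by simp
    show ?thesis
    proof (cases "r q = 0")
      case True
      then have "ka q = 0" "kb q = 0" using rz[OF True] by (simp_all add: ka_def kb_def)
      then have ab: "cos (c * q$3) * w$1 - sin (c * q$3) * w$2 = 0" "sin (c * q$3) * w$1 + cos (c * q$3) * w$2 = 0"
        using DK(1,2)[of q w] z \<rho>(1)[of q] by (simp_all add: less_imp_neq[symmetric])
      have "w$1 = 0" "w$2 = 0"
        using rotation_identities(2,3)[of "c * q$3" "w$1" "w$2"] unfolding ab by simp_all
      then show ?thesis using w3 by (simp add: vec_eq_iff forall_3)
    next
      case False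
      define l where "l = (q$1 * w$1 + q$2 * w$2) / r q"
      have "(q$1 * w$1 + q$2 * w$2) * q$1 = r q * w$1" "(q$1 * w$1 + q$2 * w$2) * q$2 = r q * w$2"
        unfolding r_def by (rule parallel_identities[OF par])+
      then have w: "w$1 = l * q$1" "w$2 = l * q$2" using False by (simp_all add: l_def field_simps)
      have n: "((\<lambda>q. q $ i) has_derivative (\<lambda>w. w $ i)) (at p)" for i :: 3 and p :: "real^3"
        by (intro bounded_linear_imp_has_derivative bounded_linear_vec_nth)
      have dr: "(r has_derivative (\<lambda>w. (p$1 * w$1 + w$1 * p$1) + (p$2 * w$2 + w$2 * p$2))) (at p)" for p
        unfolding r_def[abs_def] power2_eq_square by (intro has_derivative_add has_derivative_mult n)
      define dH where "dH w = r q * frechet_derivative h (at q) w + ((q$1 * w$1 + w$1 * q$1) + (q$2 * w$2 + w$2 * q$2)) * h q" for w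
      have dH: "(H has_derivative dH) (at q)"
        unfolding H_def[abs_def] dH_def by (intro has_derivative_mult dr smooth_has_derivative sm)
      have de: "(e has_derivative (\<lambda>w. 0 - c * dH w)) (at q)"
        unfolding e_def[abs_def] by (intro has_derivative_diff has_derivative_const has_derivative_mult_right dH)
      have e0: "e q \<noteq> 0" using e[of q] by simp
      \<comment> \<open>Differentiating \<open>B * e = H\<close> avoids the derivative of a
        quotient; the differential of \<open>B\<close> kills \<open>w\<close> because
        \<open>B\<close> is the squared radius of \<open>K\<close>.\<close>
      have Be: "(\<lambda>q. B q * e q) = H" by (rule ext) (use e in \<open>simp add: B_def less_imp_neq[symmetric]\<close>)
      have "((\<lambda>q. r (K q)) has_derivative (\<lambda>w. frechet_derivative r (at (K q)) (frechet_derivative K (at q) w))) (at q)"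
        by (rule has_derivative_compose[OF smooth_has_derivative[OF smK] smooth_has_derivative[OF smr]])
      then have "(B has_derivative (\<lambda>w. frechet_derivative r (at (K q)) (frechet_derivative K (at q) w))) (at q)"
        by (simp add: rK)
      from fun_cong[OF has_derivative_unique[OF has_derivative_mult[OF this de, unfolded Be] dH], of w]
      have "- (B q * (c * dH w)) = dH w"
        using z linear_0[OF smooth_frechet_linear[OF smr]] by simp
      then have "dH w * (1 + c * B q) = 0" by (simp add: algebra_simps)
      moreover have "1 + c * B q = 1 / e q" using e0 unfolding B_def by (simp add: field_simps) (simp add: e_def)
      ultimately have "dH w * (1 / e q) = 0" by (simp only:)
      then have "dH w = 0" using e0 by simp
      moreover have "dH w = l * (r q * (2 * h q + frechet_derivative h (at q) q))"
        using frechet_vertical_invariant(1)[OF sm inv, of q w] frechet_vertical_invariant(1)[OF sm inv, of q q]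
        by (simp add: dH_def w r_def power2_eq_square algebra_simps)
      ultimately have "l = 0" using False pos[of q] by simp
      then show ?thesis using w w3 by (simp add: vec_eq_iff forall_3)
    qed
  qed
  have "inj (frechet_derivative K (at q))" for q
    using ker by (simp add: linear_injective_0[OF smooth_frechet_linear[OF smK]])
  from smooth_inverse[OF smK \<psi> this] have "smooth \<psi>" .
  then have "contact_map K (rotational_form (\<lambda>_. 1)) (rotational_form h)"
    unfolding contact_map_def diffeomorphism_def using smK \<psi> form e
    by (intro conjI exI[of _ \<psi>] exI[of _ "\<lambda>q. 1 / e q"]) (auto simp: less_imp_neq[symmetric])
  then show thesis using that by blast
qed

section \<open>The standard structure\<close>

text \<open>Adding half the differential of x y turns the symmetric primitive of the area form into
  x dy; halving the second coordinate absorbs the factor 2 in the area.\<close>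

lemma rotational_form_one_alpha_st:
  "contact_map (\<lambda>q. vector [q$1, q$2 / 2, q$3 + q$1 * q$2 / 2]) (rotational_form (\<lambda>_. 1)) alpha_st"
  unfolding contact_map_def diffeomorphism_def
proof (intro conjI exI[of _ "\<lambda>q. vector [q$1, 2 * q$2, q$3 - q$1 * q$2]"] exI[of _ "\<lambda>_. 1"] allI)
  show "smooth (\<lambda>q::real^3. vector [q$1, q$2 / 2, q$3 + q$1 * q$2 / 2] :: real^3)"
    "smooth (\<lambda>q::real^3. vector [q$1, 2 * q$2, q$3 - q$1 * q$2] :: real^3)"
    by (intro smooth_intros smooth_divide | simp)+
  fix p w :: "real^3"
  have n: "((\<lambda>q. q $ i) has_derivative (\<lambda>w. w $ i)) (at p)" for i :: 3
    by (intro bounded_linear_imp_has_derivative bounded_linear_vec_nth)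
  have half: "((\<lambda>q. f q / 2) has_derivative (\<lambda>w. f' w / 2)) (at p)" if "(f has_derivative f') (at p)" for f f' :: "real^3 \<Rightarrow> real"
    using has_derivative_mult_left[OF that, of "1/2"] by simp
  have "((\<lambda>q. q$1 *\<^sub>R axis 1 1 + (q$2 / 2) *\<^sub>R axis 2 1 + (q$3 + q$1 * q$2 / 2) *\<^sub>R (axis 3 1 :: real^3)) has_derivative
     (\<lambda>w. w$1 *\<^sub>R axis 1 1 + (w$2 / 2) *\<^sub>R axis 2 1 + (w$3 + (p$1 * w$2 + w$1 * p$2) / 2) *\<^sub>R axis 3 1)) (at p)"
    by (intro has_derivative_add has_derivative_scaleR_left n half has_derivative_mult)
  from fun_cong[OF frechet_derivative_at[OF this], of w]
  have "frechet_derivative (\<lambda>q. vector [q$1, q$2 / 2, q$3 + q$1 * q$2 / 2]) (at p) w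
      = (vector [w$1, w$2 / 2, w$3 + (p$1 * w$2 + w$1 * p$2) / 2] :: real^3)"
    unfolding vector_3_axis by simp
  then show "rotational_form (\<lambda>_. 1) (vector [p$1, p$2 / 2, p$3 + p$1 * p$2 / 2]) \<bullet>
      frechet_derivative (\<lambda>q. vector [q$1, q$2 / 2, q$3 + q$1 * q$2 / 2]) (at p) w = 1 * (alpha_st p \<bullet> w)"
    by (simp add: rotational_form_def alpha_st_def inner_vector_3 field_simps)
qed (simp_all add: vec_eq_iff forall_3)

text \<open>Reversing the height and then the sign of the form negates the horizontal coefficients,
  which reduces a negative curl to a positive one.\<close>

lemma reflect_vertical:
  assumes "vertical_invariant l1" "vertical_invariant l2"
  shows "contact_map (\<lambda>q. vector [q$1, q$2, - q$3]) (\<lambda>q. vector [l1 q, l2 q, 1]) (\<lambda>q. vector [- l1 q, - l2 q, 1])"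
  unfolding contact_map_def diffeomorphism_def
proof (intro conjI exI[of _ "\<lambda>q. vector [q$1, q$2, - q$3]"] exI[of _ "\<lambda>_. - 1"] allI)
  show "smooth (\<lambda>q::real^3. vector [q$1, q$2, - q$3] :: real^3)" "smooth (\<lambda>q::real^3. vector [q$1, q$2, - q$3] :: real^3)"
    by (intro smooth_intros)+
  fix p w :: "real^3"
  have n: "((\<lambda>q. q $ i) has_derivative (\<lambda>w. w $ i)) (at p)" for i :: 3
    by (intro bounded_linear_imp_has_derivative bounded_linear_vec_nth)
  have "((\<lambda>q. q$1 *\<^sub>R axis 1 1 + q$2 *\<^sub>R axis 2 1 + (- q$3) *\<^sub>R (axis 3 1 :: real^3)) has_derivative
     (\<lambda>w. w$1 *\<^sub>R axis 1 1 + w$2 *\<^sub>R axis 2 1 + (- w$3) *\<^sub>R axis 3 1)) (at p)"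
    by (intro has_derivative_add has_derivative_scaleR_left n has_derivative_minus)
  from fun_cong[OF frechet_derivative_at[OF this], of w]
  have D: "frechet_derivative (\<lambda>q. vector [q$1, q$2, - q$3]) (at p) w = (vector [w$1, w$2, - w$3] :: real^3)"
    unfolding vector_3_axis by simp
  have "(vector [p$1, p$2, - p$3] :: real^3) = p + (- 2 * p$3) *\<^sub>R axis 3 1"
    by (simp add: vec_eq_iff forall_3)
  then have "l1 (vector [p$1, p$2, - p$3]) = l1 p" "l2 (vector [p$1, p$2, - p$3]) = l2 p"
    using vertical_invariantD[OF assms(1)] vertical_invariantD[OF assms(2)] by metis+
  then show "(vector [l1 (vector [p$1, p$2, - p$3]), l2 (vector [p$1, p$2, - p$3]), 1] :: real^3) \<bullet>
      frechet_derivative (\<lambda>q. vector [q$1, q$2, - q$3]) (at p) w = - 1 * (vector [- l1 p, - l2 p, 1] \<bullet> w)"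
    by (simp add: D inner_vector_3)
qed (simp_all add: vec_eq_iff forall_3)

section \<open>Assembly of the contact maps\<close>

lemma frechet_derivative_uminus:
  fixes f :: "'a::real_normed_vector \<Rightarrow> real"
  assumes "smooth f"
  shows "frechet_derivative (\<lambda>q. - f q) (at q) w = - frechet_derivative f (at q) w"
  using fun_cong[OF frechet_derivative_at[OF has_derivative_minus[OF smooth_has_derivative[OF assms, of q]]], of w] by simp

lemma vertical_form_standard:
  assumes sm: "smooth l1" "smooth l2" and inv: "vertical_invariant l1" "vertical_invariant l2"
    and pos: "\<And>q. 0 < frechet_derivative l2 (at q) (axis 1 1) - frechet_derivative l1 (at q) (axis 2 1)"
  shows "\<exists>\<phi>. contact_map \<phi> (\<lambda>q. vector [l1 q, l2 q, 1]) alpha_st"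
proof -
  obtain G h where G: "contact_map G (\<lambda>q. vector [l1 q, l2 q, 1]) (rotational_form h)"
    "smooth h" "vertical_invariant h"
    "\<And>q. 2 * h q + frechet_derivative h (at q) q = frechet_derivative l2 (at q) (axis 1 1) - frechet_derivative l1 (at q) (axis 2 1)"
    by (rule radial_gauge[OF sm inv refl]) blast
  then have hpos: "0 < 2 * h q + frechet_derivative h (at q) q" for q using pos by simp
  obtain \<Phi> where \<Phi>: "contact_map \<Phi> (rotational_form h) (rotational_form (rot_average h))"
    by (rule moser_isotopy[OF G(2,3) hpos])
  have "0 < 2 * rot_average h q + frechet_derivative (rot_average h) (at q) q" for q
    unfolding rot_average_euler[OF G(2)]
    by (intro rot_average_pos smooth_intros G(2) hpos)
  then obtain K where "contact_map K (rotational_form (\<lambda>_. 1)) (rotational_form (rot_average h))"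
    using rotational_form_standard[OF smooth_rot_average[OF G(2)] vertical_invariant_rot_average[OF G(3)] rot_average_rot[OF G(2)]]
    by blast
  then obtain K' where K': "contact_map K' (rotational_form (rot_average h)) (rotational_form (\<lambda>_. 1))"
    using contact_map_inverse by blast
  show ?thesis
    using contact_map_compose[OF G(1) contact_map_compose[OF \<Phi> contact_map_compose[OF K' rotational_form_one_alpha_st]]]
    by blast
qed

lemma nonvanishing_sign:
  fixes g :: "'a::real_normed_vector \<Rightarrow> real"
  assumes "continuous_on UNIV g" "\<And>q. g q \<noteq> 0"
  shows "(\<forall>q. 0 < g q) \<or> (\<forall>q. g q < 0)"
proof (rule ccontr)
  assume "\<not> ?thesis"
  then obtain p q where "g p \<le> 0" "0 \<le> g q" by (auto simp: not_less)
  moreover have "connected (range g)" using connected_continuous_image[OF assms(1) connected_UNIV] .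
  ultimately have "0 \<in> range g" unfolding connected_iff_interval by blast
  then show False using assms(2) by auto
qed

context contact_line_fibration
begin

lemma contact_map_alpha_st: "\<exists>\<phi>. contact_map \<phi> V alpha_st"
proof -
  obtain M l1 l2 where M: "contact_map M V (\<lambda>q. vector [l1 q, l2 q, 1])" "smooth l1" "smooth l2"
    "\<And>q t. l1 (q + t *\<^sub>R axis 3 1) = l1 q" "\<And>q t. l2 (q + t *\<^sub>R axis 3 1) = l2 q"
    "\<And>q. frechet_derivative l2 (at q) (axis 1 1) - frechet_derivative l1 (at q) (axis 2 1) \<noteq> 0"
    by (rule reeb_coordinates) blast
  have inv: "vertical_invariant l1" "vertical_invariant l2" using M by (simp_all add: vertical_invariant_def)
  have "continuous_on UNIV (\<lambda>q. frechet_derivative l2 (at q) (axis 1 1) - frechet_derivative l1 (at q) (axis 2 1))"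
    by (intro smooth_continuous_on smooth_intros M)
  from nonvanishing_sign[OF this M(6)] consider
    "\<And>q. 0 < frechet_derivative l2 (at q) (axis 1 1) - frechet_derivative l1 (at q) (axis 2 1)" |
    "\<And>q. frechet_derivative l2 (at q) (axis 1 1) - frechet_derivative l1 (at q) (axis 2 1) < 0" by blast
  then show ?thesis
  proof cases
    case 1
    from vertical_form_standard[OF M(2,3) inv 1] show ?thesis using contact_map_compose[OF M(1)] by blast
  next
    case 2
    have neg: "vertical_invariant (\<lambda>q. - l1 q)" "vertical_invariant (\<lambda>q. - l2 q)"
      using inv by (simp_all add: vertical_invariant_def)
    have "0 < frechet_derivative (\<lambda>q. - l2 q) (at q) (axis 1 1) - frechet_derivative (\<lambda>q. - l1 q) (at q) (axis 2 1)" for q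
      using 2[of q] by (simp add: frechet_derivative_uminus M)
    from vertical_form_standard[OF smooth_minus[OF M(2)] smooth_minus[OF M(3)] neg this]
    show ?thesis
      using contact_map_compose[OF M(1) contact_map_compose[OF reflect_vertical[OF inv]]] by blast
  qed
qed

end

text \<open>The derivative of the inverse supplies preimages, so the kernel is filled and not merely
  mapped into.\<close>

lemma contact_map_image:
  assumes "contact_map \<phi> a b"
  shows "frechet_derivative \<phi> (at p) ` {w. b p \<bullet> w = 0} = {w. a (\<phi> p) \<bullet> w = 0}"
proof -
  obtain \<mu> \<psi> where 1: "smooth \<phi>" "smooth \<psi>" "\<And>x. \<psi> (\<phi> x) = x" "\<And>x. \<phi> (\<psi> x) = x"
    "\<And>p. \<mu> p \<noteq> 0" "\<And>p w. a (\<phi> p) \<bullet> frechet_derivative \<phi> (at p) w = \<mu> p * (b p \<bullet> w)"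
    using assms unfolding contact_map_def diffeomorphism_def by blast
  have inv: "frechet_derivative \<phi> (at p) (frechet_derivative \<psi> (at (\<phi> p)) w) = w" for w
    using frechet_derivative_chain[OF 1(1,2), of "\<phi> p" w] by (simp add: 1(3,4))
  show ?thesis
  proof (intro equalityI subsetI)
    fix v assume v: "v \<in> {w. a (\<phi> p) \<bullet> w = 0}"
    then have "b p \<bullet> frechet_derivative \<psi> (at (\<phi> p)) v = 0"
      using 1(6)[of p "frechet_derivative \<psi> (at (\<phi> p)) v"] 1(5)[of p] by (simp add: inv)
    then show "v \<in> frechet_derivative \<phi> (at p) ` {w. b p \<bullet> w = 0}"
      by (intro image_eqI[of _ _ "frechet_derivative \<psi> (at (\<phi> p)) v"]) (simp_all add: inv)
  qed (auto simp: 1(6))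
qed

theorem mainTheorem1:
  fixes V :: "real^3 \<Rightarrow> real^3"
  assumes "smooth V"
    and "\<forall>p. norm (V p) = 1"
    and "defines_line_fibration V"
    and "contact_form V"
  shows "\<exists>\<phi> :: real^3 \<Rightarrow> real^3. diffeomorphism \<phi> \<and>
           (\<forall>p. frechet_derivative \<phi> (at p) ` xi_st p = perp_plane_field V (\<phi> p))"
proof -
  interpret contact_line_fibration V
    using assms by unfold_locales auto
  obtain \<phi> where \<phi>: "contact_map \<phi> V alpha_st" using contact_map_alpha_st by blast
  have "xi_st p = {w. alpha_st p \<bullet> w = 0}" for p
    by (auto simp: xi_st_def alpha_st_def inner_vector_3 algebra_simps)
  then have "frechet_derivative \<phi> (at p) ` xi_st p = perp_plane_field V (\<phi> p)" for p
    using contact_map_image[OF \<phi>] by (simp add: perp_plane_field_def)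
  moreover have "diffeomorphism \<phi>" using \<phi> by (simp add: contact_map_def)
  ultimately show ?thesis by blast
qed

end
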